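(* Let $\alpha\in(0,1)$ and consider the test of $H_0^{(1)}:\rho_1\ge0$ against $H_1^{(1)}:\rho_1<0$ with rejection region $C_n^{\mathcal M}(\alpha)$. 1. If $p$ satisfies $H_0^{(1)}$ and $\rho_1=0$, then $\lim_{n\to\infty}P(X_{1:n}\in C_n^{\mathcal M}(\alpha))=\alpha$. 2. If $p$ satisfies $H_0^{(1)}$ and $\rho_1>0$, then $\lim_{n\to\infty}P(X_{1:n}\in C_n^{\mathcal M}(\alpha))=0$. 3. If $p$ satisfies $H_1^{(1)}$, then $\lim_{n\to\infty}P(X_{1:n}\in C_n^{\mathcal M}(\alpha))=1$.
   Context: Let $m<M$ be integers, $\mathcal S=\{m,\dots,M\}$, $\mathcal S_1=\{m,\dots,M-1\}$, and let $p$ be a p.m.f. on $\mathbb Z$ with support $\mathcal S$ (i.e. $p(j)>0$ iff $j\in\mathcal S$). Put $\nabla^1q(j)=q(j)-q(j+1)$ and $\rho_1=\min_{j\in\mathcal S_1}\nabla^1p(j)$. Let $X_1,X_2,\dots$ be i.i.d. with p.m.f. $p$, $X_{1:n}=(X_1,\dots,X_n)$, $\widehat p_n(j)=\frac1n\sum_{i=1}^n\mathbf 1_{\{X_i=j\}}$, $X_{(1)}$ and $X_{(n)}$ the minimum and maximum of $X_{1:n}$, and $\widehat{\mathcal S}_{1,n}=\{X_{(1)},\dots,X_{(n)}-1\}$ (all integers between the endpoints). $\Vert\cdot\Vert_2$ is the Euclidean norm. Test statistic: let $\mathcal M$ be the set of non-increasing p.m.f.s on $\mathcal S$, $\widehat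 p_n^{\mathcal M}=\arg\min_{q\in\mathcal M}\Vert\widehat p_n-q\Vert_2$ (the Grenander estimator), and $\widehat T_n^{\mathcal M}=\sqrt n\,\Vert\widehat p_n^{\mathcal M}-\widehat p_n\Vert_2$. Estimated knots: let $\widehat\sigma_{j,n}^2=\widehat p_n(j)+\widehat p_n(j+1)-(\widehat p_n(j)-\widehat p_n(j+1))^2$ (the empirical variance of $\mathbf 1_{\{X_1=j\}}-\mathbf 1_{\{X_1=j+1\}}$), let $z_\beta$ be the $\beta$-quantile of the standard Gaussian, and for $n\ge2$ let $\widehat I_{0,n}=\{j\in\widehat{\mathcal S}_{1,n}:\sqrt n(\widehat p_n(j)-\widehat p_n(j+1))/\widehat\sigma_{j,n}\le z_{1-1/n}\}$ (read as $\sqrt n(\widehat p_n(j)-\widehat p_n(j+1))\le z_{1-1/n}\widehat\sigma_{j,n}$ if $\widehat\sigma_{j,n}=0$) and $\widehat J_{0,n}=\widehat{\mathcal S}_{1,n}\setminus\widehat I_{0,n}$. Critical value: for a vector $v\in\mathbb R^q$, $\mathrm{gren}(v)=\arg\min\{\Vert v-w\Vert_2:w\in\mathbb R^q,\ w_1\ge\dots\ge w_q\}$. For $J=\{j_1<\dots<j_q\}\subseteq\mathcal S_1$ and a vector $G=(G_1,\dots,G_{M-m+1})$, let $G^{\mathcal M}(J)=(G_1^{\mathcal M},\dots,G_{M-m+1}^{\mathcal M})$ be defined blockwise: for each block $\{u,\dots,v\}$ among $\{m,\dots,j_1\},\{j_1+1,\dots,j_2\},\dots,\{j_q+1,\dots,M\}$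 (a single block $\{m,\dots,M\}$ if $J=\emptyset$), $(G^{\mathcal M}_{u-m+1},\dots,G^{\mathcal M}_{v-m+1})=\mathrm{gren}(G_{u-m+1},\dots,G_{v-m+1})$. Let $\widehat\Gamma_n$ be the $(M-m+1)\times(M-m+1)$ matrix with entries $(\widehat\Gamma_n)_{r,s}=\mathbf 1_{\{r=s\}}\widehat p_n(m-1+r)-\widehat p_n(m-1+r)\widehat p_n(m-1+s)$. Conditionally on $X_{1:n}$, let $\widehat G\sim\mathcal N(0,\widehat\Gamma_n)$ and let $\widehat t^{\mathcal M}_{1-\alpha,n}(\widehat J_{0,n})$ be the $(1-\alpha)$-quantile of the conditional law given $X_{1:n}$ of $\Vert\widehat G^{\mathcal M}(\widehat J_{0,n})-\widehat G\Vert_2$. The event $X_{1:n}\in C_n^{\mathcal M}(\alpha)$ is the event $\widehat T_n^{\mathcal M}>\widehat t^{\mathcal M}_{1-\alpha,n}(\widehat J_{0,n})$.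
   Formalization: Part 1 is false for large α (uniform p on two points, α=0.9: power ≤1/2); it is proved for α ≤ 1 − ∏ 1/|B|!, the product over the level sets B of p on S, and for larger α the limit is never α. Parts 2 and 3 hold for all α in (0,1). *)

theory Defs
  imports "HOL-Probability.Probability"
begin

text \<open>Vectors indexed by the support \<open>{m..M}\<close> (or by a part of it) are functions on \<open>int\<close>, and
  their Euclidean norm is \<open>L2_set\<close> over that index set. A sample \<open>X\<^sub>1, \<dots>, X\<^sub>n\<close> is given by \<open>n\<close> and
  a sequence \<open>x :: nat \<Rightarrow> int\<close>, of which only the values at \<open>1, \<dots>, n\<close> are used.\<close>

definition rho1 :: "int \<Rightarrow> int \<Rightarrow> int pmf \<Rightarrow> real" where
  "rho1 m M p = (MIN j\<in>{m..M - 1}. pmf p j - pmf p (j + 1))"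

definition emp :: "nat \<Rightarrow> (nat \<Rightarrow> int) \<Rightarrow> int \<Rightarrow> real" where
  "emp n x j = (\<Sum>i=1..n. of_bool (x i = j)) / real n"

definition grenander :: "int \<Rightarrow> int \<Rightarrow> (int \<Rightarrow> real) \<Rightarrow> int pmf" where
  "grenander m M v = arg_min (\<lambda>q. L2_set (\<lambda>j. v j - pmf q j) {m..M})
     (\<lambda>q. set_pmf q \<subseteq> {m..M} \<and> antimono_on {m..M} (pmf q))"

definition test_stat :: "int \<Rightarrow> int \<Rightarrow> nat \<Rightarrow> (nat \<Rightarrow> int) \<Rightarrow> real" where
  "test_stat m M n x =
     sqrt (real n) * L2_set (\<lambda>j. pmf (grenander m M (emp n x)) j - emp n x j) {m..M}"

definition quantile :: "real measure \<Rightarrow> real \<Rightarrow> real" where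
  "quantile D \<beta> = Inf {t. \<beta> \<le> cdf D t}"

definition S1_hat :: "nat \<Rightarrow> (nat \<Rightarrow> int) \<Rightarrow> int set" where
  "S1_hat n x = {Min (x ` {1..n}) .. Max (x ` {1..n}) - 1}"

definition sigma_hat :: "nat \<Rightarrow> (nat \<Rightarrow> int) \<Rightarrow> int \<Rightarrow> real" where
  "sigma_hat n x j = sqrt (emp n x j + emp n x (j + 1) - (emp n x j - emp n x (j + 1))\<^sup>2)"

text \<open>The studentized comparison is multiplied out, so that it also makes sense when
  \<open>sigma_hat n x j = 0\<close>; \<open>sigma_hat\<close> is never negative.\<close>

definition I0_hat :: "nat \<Rightarrow> (nat \<Rightarrow> int) \<Rightarrow> int set" where
  "I0_hat n x = {j \<in> S1_hat n x. sqrt (real n) * (emp n x j - emp n x (j + 1))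
     \<le> quantile std_normal_distribution (1 - 1 / real n) * sigma_hat n x j}"

definition J0_hat :: "nat \<Rightarrow> (nat \<Rightarrow> int) \<Rightarrow> int set" where
  "J0_hat n x = S1_hat n x - I0_hat n x"

definition gren :: "int set \<Rightarrow> (int \<Rightarrow> real) \<Rightarrow> int \<Rightarrow> real" where
  "gren B v = arg_min (\<lambda>w. L2_set (\<lambda>i. v i - w i) B) (\<lambda>w. w \<in> extensional B \<and> antimono_on B w)"

text \<open>A knot \<open>k\<close> is the right end of a block, so two points lie in the same block iff no \<open>k \<in> J\<close>
  satisfies \<open>i \<le> k < j\<close> or \<open>j \<le> k < i\<close>.\<close>

definition knot_block :: "int \<Rightarrow> int \<Rightarrow> int set \<Rightarrow> int \<Rightarrow> int set" where
  "knot_block m M J j = {i \<in> {m..M}. \<forall>k\<in>J. i \<le> k \<longleftrightarrow> j \<le> k}"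

definition blockwise_gren :: "int \<Rightarrow> int \<Rightarrow> int set \<Rightarrow> (int \<Rightarrow> real) \<Rightarrow> int \<Rightarrow> real" where
  "blockwise_gren m M J g j = gren (knot_block m M J j) g j"

definition Gamma_hat :: "nat \<Rightarrow> (nat \<Rightarrow> int) \<Rightarrow> int \<Rightarrow> int \<Rightarrow> real" where
  "Gamma_hat n x r s = (if r = s then emp n x r else 0) - emp n x r * emp n x s"

text \<open>\<open>\<mu>\<close> is the (possibly degenerate) law \<open>N(0, \<Gamma>)\<close> on \<open>\<real>\<^sup>I\<close>: every linear form \<open>a\<close> is normally
  distributed with mean \<open>0\<close> and variance \<open>a\<^sup>T \<Gamma> a\<close>, a point mass at \<open>0\<close> if that variance vanishes.
  For finite \<open>I\<close> and positive semidefinite \<open>\<Gamma>\<close> there is exactly one such \<open>\<mu>\<close>.\<close>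

definition centered_gaussian :: "'i set \<Rightarrow> ('i \<Rightarrow> 'i \<Rightarrow> real) \<Rightarrow> ('i \<Rightarrow> real) measure \<Rightarrow> bool" where
  "centered_gaussian I \<Gamma> \<mu> \<longleftrightarrow>
     prob_space \<mu> \<and> sets \<mu> = sets (Pi\<^sub>M I (\<lambda>_. borel)) \<and>
     (\<forall>a. distr \<mu> borel (\<lambda>g. \<Sum>i\<in>I. a i * g i) =
          distr std_normal_distribution borel
            (\<lambda>z. sqrt (\<Sum>i\<in>I. \<Sum>j\<in>I. a i * \<Gamma> i j * a j) * z))"

definition mv_normal :: "'i set \<Rightarrow> ('i \<Rightarrow> 'i \<Rightarrow> real) \<Rightarrow> ('i \<Rightarrow> real) measure" where
  "mv_normal I \<Gamma> = (THE \<mu>. centered_gaussian I \<Gamma> \<mu>)"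

definition crit_value :: "int \<Rightarrow> int \<Rightarrow> real \<Rightarrow> nat \<Rightarrow> (nat \<Rightarrow> int) \<Rightarrow> int set \<Rightarrow> real" where
  "crit_value m M \<alpha> n x J = quantile
     (distr (mv_normal {m..M} (Gamma_hat n x)) borel
        (\<lambda>g. L2_set (\<lambda>j. blockwise_gren m M J g j - g j) {m..M}))
     (1 - \<alpha>)"

definition rejects :: "int \<Rightarrow> int \<Rightarrow> real \<Rightarrow> nat \<Rightarrow> (nat \<Rightarrow> int) \<Rightarrow> bool" where
  "rejects m M \<alpha> n x \<longleftrightarrow> crit_value m M \<alpha> n x (J0_hat n x) < test_stat m M n x"

text \<open>If \<open>p\<close> is non-increasing, the limit law of the test statistic has an atom at \<open>0\<close>: the limit
  vanishes iff the limiting Gaussian vector is non-increasing on each level set \<open>B\<close> of \<open>p\<close>. Within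
  \<open>B\<close> this vector is, up to a common shift, a multiple of an i.i.d. normal vector, independently
  over the level sets, so the atom has mass \<open>\<Prod>\<^sub>B 1 / |B|!\<close>. The power at \<open>p\<close> converges to at most one
  minus this mass, so no larger level can be attained at \<open>p\<close>. For \<open>m = 0\<close>, \<open>M = 1\<close> and uniform \<open>p\<close> the
  power is at most \<open>P (emp n X 0 < emp n X 1) \<le> 1/2\<close>, whatever \<open>\<alpha>\<close> is. If \<open>p\<close> has any tie,
  \<open>max_level\<close> is at least \<open>1/2\<close>.\<close>

definition max_level :: "int \<Rightarrow> int \<Rightarrow> int pmf \<Rightarrow> real" where
  "max_level m M p =
     1 - (\<Prod>c\<in>pmf p ` {m..M}. 1 / fact (card {j \<in> {m..M}. pmf p j = c}))"

end

theory Submission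
  imports Defs "HOL-Real_Asymp.Real_Asymp" "HOL-Combinatorics.Permutations"
begin

text \<open>Both the statistic and the bootstrap variable are Euclidean distances to the cone of vectors
  that are non-increasing on each block: the projection of a p.m.f. onto the monotone cone is
  automatically a p.m.f. If \<open>p\<close> is non-increasing, the statistic equals with high probability the
  distance of \<open>sqrt n (emp - p)\<close> to the cone with knots at the strict descents of \<open>p\<close>, and these
  knots are estimated consistently since the normal quantile at \<open>1 - 1/n\<close> tends to infinity
  more slowly than \<open>sqrt n\<close>.

  The law \<open>N(0, \<Gamma>)\<close> is realised on i.i.d. standard normals \<open>z\<close> by
  \<open>sqrt (q j) z j - q j \<Sum>\<^sub>k sqrt (q k) z k\<close>, so that critical values depend continuously on \<open>q\<close> by
  dominated convergence. The limit law of the distance has no atom at \<open>t > 0\<close>: as the distance is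
  homogeneous and the scaled Gaussian laws are equivalent, one atom would produce uncountably many.
  Its atom at \<open>0\<close> is the probability that \<open>z\<close> is ordered within each level set of \<open>p\<close>.

  The multivariate central limit theorem needs only the one-dimensional Levy theorem: if all
  projections converge, then so do all projections under a change of measure whose density is a
  product of functions of coordinates treated before, which gives the coordinates one at a time.\<close>

section \<open>Convergence in distribution from one-dimensional projections\<close>

text \<open>Uniqueness of the projections is never proved: whichever minimiser
  \<open>arg_min\<close> selects, only the attained distance enters the statistic and the critical
  value, and this is a Lipschitz function of the vector. By contrast \<open>mv_normal\<close> is a
  definite description, so the Gaussian law must be shown unique before anything can be said about a
  critical value. Limits are used only as lower bounds for probabilities of open events; upper
  bounds come from the complementary event. This suffices because all random ingredients other than
  \<open>scaled\<close> are frozen on an event of probability tending to 1: the estimated knots are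
  exact, and the critical value lies within any prescribed distance of its limit. The latter holds
  because the limiting distribution function increases strictly to the right of its quantile as soon
  as some index is not a knot. The bound by \<open>max_level\<close> enters at one place, where the
  limiting quantile is 0: it makes the distribution function there equal to 1 - \<alpha> rather than
  larger.\<close>

lemma tilted_distr:
  fixes Q :: "'c measure" and v r :: "'c \<Rightarrow> real"
  assumes "prob_space Q" and [measurable]: "v \<in> borel_measurable Q" "r \<in> borel_measurable Q"
    and v: "\<And>x. 1 \<le> v x" "\<And>x. v x \<le> K"
  defines "D \<equiv> distr (density Q (\<lambda>x. ennreal (v x / (LINT x|Q. v x)))) borel r"
  shows "1 \<le> (LINT x|Q. v x)" (is ?A)
    and "real_distribution D"
    and "\<And>g :: real \<Rightarrow> real. g \<in> borel_measurable borel \<Longrightarrow>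
        (LINT x|D. g x) = (LINT x|Q. v x * g (r x)) / (LINT x|Q. v x)"
proof -
    interpret Q: prob_space Q by fact
    have iv: "integrable Q v"
    proof (rule Q.integrable_const_bound[where B=K])
      have "norm (v x) \<le> K" for x using v(1)[of x] v(2)[of x] by simp
      thus "AE x in Q. norm (v x) \<le> K" by simp
    qed simp
    \<comment> \<open>The lower bound 1 on the weight keeps the normalising constant away from
      0.\<close>
    have "(LINT x|Q. 1) \<le> (LINT x|Q. v x)"
      by (intro integral_mono) (use iv v in auto)
    thus ?A by (simp add: Q.prob_space)
    have v0: "0 \<le> v x / (LINT x|Q. v x)" for x
      using \<open>?A\<close> v(1)[of x] by (intro divide_nonneg_nonneg) linarith+
    have "(\<integral>\<^sup>+x. ennreal (v x / (LINT x|Q. v x)) \<partial>Q) = ennreal (LINT x|Q. v x / (LINT x|Q. v x))"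
      using v0 iv by (intro nn_integral_eq_integral) auto
    hence "emeasure (density Q (\<lambda>x. ennreal (v x / (LINT x|Q. v x)))) (space Q) = 1"
      using \<open>?A\<close> by (simp add: emeasure_density cong: nn_integral_cong_simp)
    hence "prob_space (density Q (\<lambda>x. ennreal (v x / (LINT x|Q. v x))))"
      by (intro prob_spaceI) simp
    hence "prob_space D"
      unfolding D_def by (rule prob_space.prob_space_distr) simp
    thus "real_distribution D"
      by (simp add: D_def real_distribution_def real_distribution_axioms_def)
    show "(LINT x|D. g x) = (LINT x|Q. v x * g (r x)) / (LINT x|Q. v x)" if [measurable]: "g \<in> borel_measurable borel" for g :: "real \<Rightarrow> real"
      unfolding D_def using v0 by (subst integral_distr) (simp_all add: integral_density)
qed

text \<open>The densities proportional to \<open>V n\<close> and \<open>U\<close> turn the claim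
  into ordinary weak convergence. The hypothesis at \<open>t = c = 0\<close> gives convergence of
  the normalising constants, so the tilted laws have convergent characteristic functions and Levy's
  theorem applies; multiplying by the constants undoes the tilt.\<close>

lemma weighted_levy_continuity:
  fixes M :: "'a measure" and N :: "'b measure" and V R :: "nat \<Rightarrow> 'a \<Rightarrow> real" and U S :: "'b \<Rightarrow> real"
    and f :: "real \<Rightarrow> real"
  assumes "prob_space M" and "prob_space N"
    and [measurable]: "\<And>n. V n \<in> borel_measurable M" "\<And>n. R n \<in> borel_measurable M"
      "U \<in> borel_measurable N" "S \<in> borel_measurable N"
    and V: "\<And>n x. 1 \<le> V n x" "\<And>n x. V n x \<le> K"
    and U: "\<And>x. 1 \<le> U x" "\<And>x. U x \<le> K"
    and conv: "\<And>t c. (\<lambda>n. LINT x|M. V n x * cos (t * R n x + c)) \<longlonglongrightarrow> (LINT x|N. U x * cos (t * S x + c))"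
    and f: "\<And>x. isCont f x" "\<And>x. \<bar>f x\<bar> \<le> C"
  shows "(\<lambda>n. LINT x|M. V n x * f (R n x)) \<longlonglongrightarrow> (LINT x|N. U x * f (S x))"
proof -
  interpret M: prob_space M by fact
  interpret N: prob_space N by fact
  have [measurable]: "f \<in> borel_measurable borel"
    using f(1) by (intro borel_measurable_continuous_onI continuous_at_imp_continuous_on) auto
  define D where "D n = distr (density M (\<lambda>x. ennreal (V n x / (LINT x|M. V n x)))) borel (R n)" for n
  define D' where "D' = distr (density N (\<lambda>x. ennreal (U x / (LINT x|N. U x)))) borel S"
  have D: "1 \<le> (LINT x|M. V n x)" "real_distribution (D n)"
      "\<And>g :: real \<Rightarrow> real. g \<in> borel_measurable borel \<Longrightarrow>
        (LINT x|D n. g x) = (LINT x|M. V n x * g (R n x)) / (LINT x|M. V n x)" for n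
    unfolding D_def 
    by (rule tilted_distr[OF \<open>prob_space M\<close>, of "V n" "R n" K]; (rule V)?; simp)+
  have D': "1 \<le> (LINT x|N. U x)" "real_distribution D'"
      "\<And>g :: real \<Rightarrow> real. g \<in> borel_measurable borel \<Longrightarrow>
        (LINT x|D'. g x) = (LINT x|N. U x * g (S x)) / (LINT x|N. U x)"
    unfolding D'_def 
    by (rule tilted_distr[OF \<open>prob_space N\<close>, of U S K]; (rule U)?; simp)+
  have total: "(\<lambda>n. LINT x|M. V n x) \<longlonglongrightarrow> (LINT x|N. U x)"
    using conv[of 0 0] by simp
  have cosconv: "(\<lambda>n. LINT x|D n. cos (t * x + c)) \<longlonglongrightarrow> (LINT x|D'. cos (t * x + c))" for t c
    using D' conv[of t c] total by (subst D(3) D'(3); measurable?)+ (auto intro!: tendsto_divide)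
  \<comment> \<open>The phase -pi/2 turns the cosine into a sine, so real cosines with arbitrary
    phase carry the whole characteristic function.\<close>
  have char_cos: "char Q t = complex_of_real (LINT x|Q. cos (t * x + 0)) + \<i> * complex_of_real (LINT x|Q. cos (t * x + (- pi / 2)))"
    if "real_distribution Q" for Q t
  proof -
    interpret Q: real_distribution Q by fact
    have "char Q t = (LINT x|Q. complex_of_real (cos (t * x)) + \<i> * complex_of_real (sin (t * x)))"
      unfolding char_def by (intro Bochner_Integration.integral_cong) (simp_all add: complex_eq_iff Re_exp Im_exp)
    also have "\<dots> = (LINT x|Q. complex_of_real (cos (t * x))) + (LINT x|Q. \<i> * complex_of_real (sin (t * x)))"
      by (intro Bochner_Integration.integral_add Q.integrable_const_bound[where B=1] integrable_mult_right)
         (auto simp: norm_mult)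
    also have "\<dots> = complex_of_real (LINT x|Q. cos (t * x)) + \<i> * complex_of_real (LINT x|Q. sin (t * x))"
      by simp
    also have "(\<lambda>x. sin (t * x)) = (\<lambda>x. cos (t * x + (- pi / 2)))"
      by (simp add: cos_diff fun_eq_iff)
    finally show ?thesis by simp
  qed
  have "(\<lambda>n. char (D n) t) \<longlonglongrightarrow> char D' t" for t
    unfolding char_cos[OF D(2)] char_cos[OF D'(2)] by (intro tendsto_intros cosconv)
  hence "weak_conv_m D D'"
    using D D' by (intro levy_continuity) auto
  hence "(\<lambda>n. LINT x|D n. f x) \<longlonglongrightarrow> (LINT x|D'. f x)"
    using D D' f by (intro weak_conv_imp_integral_bdd_continuous_conv[where B=C]) auto
  hence "(\<lambda>n. (LINT x|D n. f x) * (LINT x|M. V n x)) \<longlonglongrightarrow> (LINT x|D'. f x) * (LINT x|N. U x)"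
    using total by (rule tendsto_mult)
  moreover have "(LINT x|M. V n x) \<noteq> 0" for n using D(1)[of n] by linarith
  ultimately show ?thesis using D'(1) by (simp add: D(3) D'(3))
qed


text \<open>Openness is stated through the coordinates in \<open>I\<close> alone: vectors are total
  functions, and values outside \<open>I\<close> must not influence membership. For finite
  \<open>I\<close> these are the open sets of the Euclidean space over \<open>I\<close>, pulled back
  along restriction.\<close>

definition box_open :: "'i set \<Rightarrow> ('i \<Rightarrow> real) set \<Rightarrow> bool" where
  "box_open I U \<longleftrightarrow> (\<forall>v\<in>U. \<exists>e>0. \<forall>w. (\<forall>i\<in>I. \<bar>w i - v i\<bar> < e) \<longrightarrow> w \<in> U)"

lemma box_open_countable_boxes:
  fixes I :: "'i set"
  assumes I: "finite I" "I \<noteq> {}" and U: "box_open I U"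
  obtains c :: "nat \<Rightarrow> 'i \<Rightarrow> real" and e :: "nat \<Rightarrow> real"
  where "U = (\<Union>k. {v. \<forall>i\<in>I. \<bar>v i - c k i\<bar> < e k})"
proof -
  let ?box = "\<lambda>(c, e). {v. \<forall>i\<in>I. \<bar>v i - c i\<bar> < (e :: real)}"
  define P where "P = {ce \<in> (I \<rightarrow>\<^sub>E \<rat>) \<times> \<rat>. ?box ce \<subseteq> U}"
  have "countable P"
    unfolding P_def using I countable_rat by (intro countable_subset[OF Collect_restrict] countable_SIGMA countable_PiE) auto
  \<comment> \<open>A box of radius 0 is empty because \<open>I\<close> is nonempty. It is a filler:
    no rational box of positive radius fits into an empty \<open>U\<close>, but the enumeration
    needs a nonempty index set.\<close>
  moreover have "(restrict (\<lambda>_. 0) I, 0) \<in> P"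
    using I by (auto simp: P_def)
  hence "P \<noteq> {}" by blast
  ultimately have P: "range (from_nat_into P) = P" by (simp add: range_from_nat_into)
  have "U \<subseteq> (\<Union>ce\<in>P. ?box ce)"
  proof
    fix v assume "v \<in> U"
    then obtain e where e: "e > 0" "\<And>w. (\<forall>i\<in>I. \<bar>w i - v i\<bar> < e) \<Longrightarrow> w \<in> U"
      using U unfolding box_open_def by metis
    obtain r where r: "r \<in> \<rat>" "0 < r" "r < e / 2" using Rats_dense_in_real[of 0 "e / 2"] e by auto
    have "\<forall>i. \<exists>q\<in>\<rat>. \<bar>v i - q\<bar> < r"
    proof
      fix i show "\<exists>q\<in>\<rat>. \<bar>v i - q\<bar> < r"
        using Rats_dense_in_real[of "v i - r" "v i + r"] r(2) by (auto intro!: bexI simp: abs_less_iff)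
    qed
    then obtain q where q: "\<And>i. q i \<in> \<rat>" "\<And>i. \<bar>v i - q i\<bar> < r" by metis
    have "w \<in> U" if "\<forall>i\<in>I. \<bar>w i - q i\<bar> < r" for w
    proof (rule e(2), safe)
      fix i assume "i \<in> I"
      with that have "\<bar>w i - q i\<bar> < r" by blast
      with q(2)[of i] r(3) show "\<bar>w i - v i\<bar> < e" by linarith
    qed
    hence "(restrict q I, r) \<in> P" using q r by (auto simp: P_def)
    moreover have "v \<in> ?box (restrict q I, r)" using q by auto
    ultimately show "v \<in> (\<Union>ce\<in>P. ?box ce)" by blast
  qed
  moreover have "(\<Union>ce\<in>P. ?box ce) \<subseteq> U" by (auto simp: P_def)
  ultimately have "U = (\<Union>ce\<in>P. ?box ce)" by blast
  also have "\<dots> = (\<Union>k. ?box (from_nat_into P k))" using P by (metis image_image)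
  finally show ?thesis
    by (intro that[of "\<lambda>k. fst (from_nat_into P k)" "\<lambda>k. snd (from_nat_into P k)"]) (simp add: case_prod_beta)
qed

lemma measurable_box_open:
  assumes I: "finite I" "I \<noteq> {}" and U: "box_open I U"
    and [measurable]: "\<And>i. i \<in> I \<Longrightarrow> (\<lambda>x. f x i) \<in> borel_measurable M"
  shows "{x \<in> space M. f x \<in> U} \<in> sets M"
proof -
  obtain c :: "nat \<Rightarrow> 'a \<Rightarrow> real" and e where ce: "U = (\<Union>k. {v. \<forall>i\<in>I. \<bar>v i - c k i\<bar> < e k})"
    using box_open_countable_boxes[OF I U] .
  have [simp]: "countable I" using I(1) by (rule countable_finite)
  show ?thesis
    unfolding ce UN_iff mem_Collect_eq by measurable
qed

text \<open>The integrand has the shape of \<open>expand\<close> in \<open>test_fun_mult\<close>: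
  one plain cosine and two weighted ones.\<close>

lemma integral_lincomb3:
  fixes g g' g'' :: "'z \<Rightarrow> real"
  assumes "integrable Q g" "integrable Q g'" "integrable Q g''"
  shows "(LINT x|Q. b * g x + (g' x / 2 + g'' x / 2)) = b * (LINT x|Q. g x) + ((LINT x|Q. g' x) / 2 + (LINT x|Q. g'' x) / 2)"
  using assms by simp

section \<open>Test functions built from single coordinates\<close>

locale projected_convergence = M: prob_space M + N: prob_space N
  for M :: "'a measure" and N :: "'b measure" +
  fixes I :: "'i set" and Y :: "nat \<Rightarrow> 'a \<Rightarrow> 'i \<Rightarrow> real" and W :: "'b \<Rightarrow> 'i \<Rightarrow> real"
  assumes finite_I: "finite I"
    and measurable_Y[measurable]: "\<And>n i. i \<in> I \<Longrightarrow> (\<lambda>\<omega>. Y n \<omega> i) \<in> borel_measurable M"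
    and measurable_W[measurable]: "\<And>i. i \<in> I \<Longrightarrow> (\<lambda>\<omega>. W \<omega> i) \<in> borel_measurable N"
    and cos_conv: "\<And>a c. (\<lambda>n. LINT \<omega>|M. cos ((\<Sum>i\<in>I. a i * Y n \<omega> i) + c))
       \<longlonglongrightarrow> (LINT \<omega>|N. cos ((\<Sum>i\<in>I. a i * W \<omega> i) + c))"
begin

text \<open>The weights that preserve convergence of all cosines of linear forms. Carrying the
  cosine along is what makes the class closed under multiplication by a bounded continuous function
  of one coordinate; convergence of the plain expectations would be too weak for that
  induction.\<close>

definition test_fun :: "(('i \<Rightarrow> real) \<Rightarrow> real) \<Rightarrow> bool" where
  "test_fun \<phi> \<longleftrightarrow> (\<forall>n. (\<lambda>\<omega>. \<phi> (Y n \<omega>)) \<in> borel_measurable M) \<and> (\<lambda>\<omega>. \<phi> (W \<omega>)) \<in> borel_measurable N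
     \<and> (\<exists>B. \<forall>v. \<bar>\<phi> v\<bar> \<le> B)
     \<and> (\<forall>a c. (\<lambda>n. LINT \<omega>|M. \<phi> (Y n \<omega>) * cos ((\<Sum>i\<in>I. a i * Y n \<omega> i) + c))
          \<longlonglongrightarrow> (LINT \<omega>|N. \<phi> (W \<omega>) * cos ((\<Sum>i\<in>I. a i * W \<omega> i) + c)))"

lemma test_fun_one: "test_fun (\<lambda>_. 1)"
  unfolding test_fun_def using cos_conv by (auto intro!: exI[of _ 1])

lemma test_fun_diff:
  assumes "test_fun \<phi>" "test_fun \<psi>"
  shows "test_fun (\<lambda>v. \<phi> v - \<psi> v)"
proof -
  obtain B C where B: "\<And>v. \<bar>\<phi> v\<bar> \<le> B" and C: "\<And>v. \<bar>\<psi> v\<bar> \<le> C"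
    using assms unfolding test_fun_def by auto
  have [measurable]: "\<And>n. (\<lambda>\<omega>. \<phi> (Y n \<omega>)) \<in> borel_measurable M" "(\<lambda>\<omega>. \<phi> (W \<omega>)) \<in> borel_measurable N"
    "\<And>n. (\<lambda>\<omega>. \<psi> (Y n \<omega>)) \<in> borel_measurable M" "(\<lambda>\<omega>. \<psi> (W \<omega>)) \<in> borel_measurable N"
    using assms unfolding test_fun_def by auto
  have bnd: "\<bar>x * cos y\<bar> \<le> b" if "\<bar>x\<bar> \<le> b" for x y b :: real
    using mult_mono[OF that abs_cos_le_one[of y]] that by (simp add: abs_mult)
  have iM: "integrable M (\<lambda>\<omega>. \<phi> (Y n \<omega>) * cos ((\<Sum>i\<in>I. a i * Y n \<omega> i) + c))"
           "integrable M (\<lambda>\<omega>. \<psi> (Y n \<omega>) * cos ((\<Sum>i\<in>I. a i * Y n \<omega> i) + c))" for a n c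
    by (rule M.integrable_const_bound[where B=B] M.integrable_const_bound[where B=C]; auto intro!: bnd B C)+
  have iN: "integrable N (\<lambda>\<omega>. \<phi> (W \<omega>) * cos ((\<Sum>i\<in>I. a i * W \<omega> i) + c))"
           "integrable N (\<lambda>\<omega>. \<psi> (W \<omega>) * cos ((\<Sum>i\<in>I. a i * W \<omega> i) + c))" for a c
    by (rule N.integrable_const_bound[where B=B] N.integrable_const_bound[where B=C]; auto intro!: bnd B C)+
  have "(\<lambda>n. LINT \<omega>|M. (\<phi> (Y n \<omega>) - \<psi> (Y n \<omega>)) * cos ((\<Sum>i\<in>I. a i * Y n \<omega> i) + c))
          \<longlonglongrightarrow> (LINT \<omega>|N. (\<phi> (W \<omega>) - \<psi> (W \<omega>)) * cos ((\<Sum>i\<in>I. a i * W \<omega> i) + c))" for a c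
    using assms unfolding test_fun_def left_diff_distrib
    by (subst (1 2) Bochner_Integration.integral_diff) (auto intro!: iM iN tendsto_diff)
  moreover have "\<bar>\<phi> v - \<psi> v\<bar> \<le> B + C" for v
    using B[of v] C[of v] by linarith
  ultimately show ?thesis
    unfolding test_fun_def by auto
qed

lemma test_fun_conv: 
  assumes "test_fun \<phi>"
  shows "(\<lambda>n. LINT \<omega>|M. \<phi> (Y n \<omega>)) \<longlonglongrightarrow> (LINT \<omega>|N. \<phi> (W \<omega>))"
proof -
  have "(\<lambda>n. LINT \<omega>|M. \<phi> (Y n \<omega>) * cos ((\<Sum>i\<in>I. 0 * Y n \<omega> i) + 0)) \<longlonglongrightarrow> 
     (LINT \<omega>|N. \<phi> (W \<omega>) * cos ((\<Sum>i\<in>I. 0 * W \<omega> i) + 0))"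
    using assms unfolding test_fun_def by (elim conjE allE[of _ "\<lambda>_. 0"] allE[of _ 0])
  thus ?thesis by simp
qed

text \<open>The product of \<open>\<phi>\<close> with a cosine may be negative and is then no
  density. Adding the constant \<open>B + 1\<close> makes it one up to normalisation;
  \<open>weighted_levy_continuity\<close> is applied to the sum and to a constant weight, and the
  claim is obtained by subtraction.\<close>

lemma test_fun_mult:
  assumes "test_fun \<phi>" and k: "k \<in> I" and f: "\<And>x. isCont f x" "\<And>x. \<bar>f x\<bar> \<le> C"
  shows "test_fun (\<lambda>v. \<phi> v * f (v k))"
proof -
  obtain B where B: "\<And>v. \<bar>\<phi> v\<bar> \<le> B" 
    using assms unfolding test_fun_def by auto
  have [measurable]: "\<And>n. (\<lambda>\<omega>. \<phi> (Y n \<omega>)) \<in> borel_measurable M" "(\<lambda>\<omega>. \<phi> (W \<omega>)) \<in> borel_measurable N"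
    using assms unfolding test_fun_def by auto
  have [measurable]: "f \<in> borel_measurable borel"
    using f(1) by (intro borel_measurable_continuous_onI continuous_at_imp_continuous_on) auto
  note [measurable] = measurable_Y[OF k] measurable_W[OF k]
  have shift: "(\<Sum>i\<in>I. (a i + (if i = k then t else 0)) * v i) = (\<Sum>i\<in>I. a i * v i) + t * v k" for a t and v :: "'i \<Rightarrow> real"
    using finite_I k by (simp add: distrib_right sum.distrib if_distrib[of "\<lambda>x. x * _"] sum.delta cong: if_cong)
  have bnd: "\<bar>x * cos y\<bar> \<le> b" if "\<bar>x\<bar> \<le> b" for x y b :: real
    using mult_mono[OF that abs_cos_le_one[of y]] that by (simp add: abs_mult)
  have B0: "0 \<le> B" using B[of "\<lambda>_. 0"] by linarith
  let ?L = "\<lambda>a v. (\<Sum>i\<in>I. a i * v i) :: real"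
  have f1: "(\<lambda>n. LINT \<omega>|M. 1 * f (Y n \<omega> k)) \<longlonglongrightarrow> (LINT \<omega>|N. 1 * f (W \<omega> k))"
  proof (rule weighted_levy_continuity[where V = "\<lambda>_ _. 1" and U = "\<lambda>_. 1" and K = 1 and C = C and f = f
        and R = "\<lambda>n \<omega>. Y n \<omega> k" and S = "\<lambda>\<omega>. W \<omega> k"])
    fix t c
    show "(\<lambda>n. LINT \<omega>|M. 1 * cos (t * Y n \<omega> k + c)) \<longlonglongrightarrow> (LINT \<omega>|N. 1 * cos (t * W \<omega> k + c))"
      using cos_conv[of "\<lambda>i. 0 + (if i = k then t else 0)" c] unfolding shift by simp
  qed (use f in \<open>auto simp: M.prob_space_axioms N.prob_space_axioms\<close>)
  have conv: "(\<lambda>n. LINT \<omega>|M. (\<phi> (Y n \<omega>) * f (Y n \<omega> k)) * cos (?L a (Y n \<omega>) + c))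
          \<longlonglongrightarrow> (LINT \<omega>|N. (\<phi> (W \<omega>) * f (W \<omega> k)) * cos (?L a (W \<omega>) + c))" for a c
  proof -
    define V where "V v = (B + 1) + \<phi> v * cos (?L a v + c)" for v
    have V: "1 \<le> V v" "V v \<le> 2 * B + 1" for v
      using bnd[OF B[of v], of "?L a v + c"] by (auto simp: V_def abs_le_iff)
    have mV[measurable]: "\<And>n. (\<lambda>\<omega>. V (Y n \<omega>)) \<in> borel_measurable M" "(\<lambda>\<omega>. V (W \<omega>)) \<in> borel_measurable N"
      unfolding V_def by measurable
    \<comment> \<open>By the product-to-sum formula a product of two cosines of linear forms is a
      sum of such cosines, here with \<open>a\<close> shifted by \<open>t\<close> or
      \<open>- t\<close> at \<open>k\<close>, so the assumptions on single cosines apply.\<close>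
    have expand: "V v * cos (t * v k + c') = (B + 1) * cos (?L (\<lambda>i. 0 + (if i = k then t else 0)) v + c')
       + (\<phi> v * cos (?L (\<lambda>i. a i + (if i = k then t else 0)) v + (c + c')) / 2
        + \<phi> v * cos (?L (\<lambda>i. a i + (if i = k then - t else 0)) v + (c - c')) / 2)" for v t c'
      unfolding shift V_def by (simp add: cos_add cos_diff sin_add sin_diff field_simps)
    have 1: "(\<lambda>n. LINT \<omega>|M. V (Y n \<omega>) * f (Y n \<omega> k)) \<longlonglongrightarrow> (LINT \<omega>|N. V (W \<omega>) * f (W \<omega> k))"
    proof (rule weighted_levy_continuity[where V = "\<lambda>n \<omega>. V (Y n \<omega>)" and U = "\<lambda>\<omega>. V (W \<omega>)" and K = "2 * B + 1" and C = C and f = f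
        and R = "\<lambda>n \<omega>. Y n \<omega> k" and S = "\<lambda>\<omega>. W \<omega> k"])
      fix t c'
      have iM: "integrable M (\<lambda>\<omega>. \<phi> (Y n \<omega>) * cos (?L a (Y n \<omega>) + c))" for a n c
        by (rule M.integrable_const_bound[where B=B]; auto intro!: bnd B)
      have iN: "integrable N (\<lambda>\<omega>. \<phi> (W \<omega>) * cos (?L a (W \<omega>) + c))" for a c
        by (rule N.integrable_const_bound[where B=B]; auto intro!: bnd B)
      have iM1: "integrable M (\<lambda>\<omega>. cos (?L a (Y n \<omega>) + c))" for a n c
        by (rule M.integrable_const_bound[where B=1]; auto)
      have iN1: "integrable N (\<lambda>\<omega>. cos (?L a (W \<omega>) + c))" for a c
        by (rule N.integrable_const_bound[where B=1]; auto)
      have \<phi>c: "(\<lambda>n. LINT \<omega>|M. \<phi> (Y n \<omega>) * cos (?L a (Y n \<omega>) + c)) \<longlonglongrightarrow> (LINT \<omega>|N. \<phi> (W \<omega>) * cos (?L a (W \<omega>) + c))" for a c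
        using assms(1) unfolding test_fun_def by blast
      show "(\<lambda>n. LINT \<omega>|M. V (Y n \<omega>) * cos (t * Y n \<omega> k + c')) \<longlonglongrightarrow> (LINT \<omega>|N. V (W \<omega>) * cos (t * W \<omega> k + c'))"
        unfolding expand integral_lincomb3[OF iM1 iM iM] integral_lincomb3[OF iN1 iN iN] by (intro tendsto_intros cos_conv \<phi>c) simp_all
    qed (use f V in \<open>auto simp: M.prob_space_axioms N.prob_space_axioms\<close>)
    have fV: "\<bar>V v * f x\<bar> \<le> (2 * B + 1) * C" for v x
      unfolding abs_mult using V[of v] f(2)[of x] by (intro mult_mono) auto
    have iM: "integrable M (\<lambda>\<omega>. V (Y n \<omega>) * f (Y n \<omega> k))" "integrable M (\<lambda>\<omega>. f (Y n \<omega> k))" for n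
      by (rule M.integrable_const_bound[where B="(2 * B + 1) * C"] M.integrable_const_bound[where B=C]; auto intro!: fV f)+
    have iN: "integrable N (\<lambda>\<omega>. V (W \<omega>) * f (W \<omega> k))" "integrable N (\<lambda>\<omega>. f (W \<omega> k))"
      by (rule N.integrable_const_bound[where B="(2 * B + 1) * C"] N.integrable_const_bound[where B=C]; auto intro!: fV f)+
    have split: "(\<phi> v * f x) * cos (?L a v + c) = V v * f x - (B + 1) * f x" for v x
      by (simp add: V_def algebra_simps)
    show ?thesis
      unfolding split
      by (subst (1 2) Bochner_Integration.integral_diff) 
         (use iM iN 1 f1 in \<open>auto intro!: tendsto_intros\<close>)
  qed
  have "\<bar>\<phi> v * f (v k)\<bar> \<le> B * C" for v
    unfolding abs_mult using B0 by (intro mult_mono B f) auto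
  thus ?thesis
    unfolding test_fun_def using conv by auto
qed

definition tent :: "real \<Rightarrow> real \<Rightarrow> real \<Rightarrow> real" where
  "tent s r x = max 0 (min 1 (s * (r - \<bar>x\<bar>)))"

text \<open>Multiplying by a new factor means subtracting from the previous product its multiple by
  a product of tents, and that multiple is built one coordinate at a time with
  \<open>test_fun_mult\<close>.\<close>

lemma test_fun_cover:
  fixes c :: "nat \<Rightarrow> 'i \<Rightarrow> real" and e :: "nat \<Rightarrow> real"
  shows "test_fun (\<lambda>v. \<Prod>k<l. 1 - (\<Prod>i\<in>I. tent s (e k) (v i - c k i)))"
proof (induction l)
  case 0 show ?case by (simp add: test_fun_one)
next
  case (Suc l)
  define \<phi> where "\<phi> = (\<lambda>v :: 'i \<Rightarrow> real. \<Prod>k<l. 1 - (\<Prod>i\<in>I. tent s (e k) (v i - c k i)))"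
  have "test_fun (\<lambda>v. \<phi> v * (\<Prod>i\<in>J. tent s (e l) (v i - c l i)))" if "finite J" "J \<subseteq> I" for J
    using that
  proof (induction rule: finite_induct)
    case empty show ?case using Suc by (simp add: \<phi>_def)
  next
    case (insert j J)
    have "test_fun (\<lambda>v. \<phi> v * (\<Prod>i\<in>J. tent s (e l) (v i - c l i)) * (\<lambda>x. tent s (e l) (x - c l j)) (v j))"
    proof (rule test_fun_mult[where C = 1])
      show "isCont (\<lambda>x. tent s (e l) (x - c l j)) x" for x
        unfolding tent_def by (intro continuous_intros)
    qed (use insert in \<open>auto simp: tent_def\<close>)
    thus ?case using insert by (simp add: mult_ac)
  qed
  from test_fun_diff[OF Suc this[OF finite_I subset_refl]] show ?case
    by (simp add: \<phi>_def right_diff_distrib)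
qed

text \<open>The products below approximate the indicator of the complement of \<open>U\<close> from above, because a tent
  of slope \<open>l\<close> vanishes outside its interval and equals 1 at a given inner point for large \<open>l\<close>.\<close>

theorem portmanteau_open:
  assumes "I \<noteq> {}" "box_open I U" "x < measure N {\<omega> \<in> space N. W \<omega> \<in> U}"
  shows "\<forall>\<^sub>F n in sequentially. x < measure M {\<omega> \<in> space M. Y n \<omega> \<in> U}"
proof -
  obtain c :: "nat \<Rightarrow> 'i \<Rightarrow> real" and e where U: "U = (\<Union>k. {v. \<forall>i\<in>I. \<bar>v i - c k i\<bar> < e k})"
    using box_open_countable_boxes[OF finite_I assms(1,2)] .
  note [measurable] = measurable_box_open[OF finite_I assms(1,2) measurable_Y] measurable_box_open[OF finite_I assms(1,2) measurable_W]
  define h where "h l v = (\<Prod>k<l. 1 - (\<Prod>i\<in>I. tent (real l) (e k) (v i - c k i)))" for l v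
  have tent01: "0 \<le> tent s r z" "tent s r z \<le> 1" for s r z by (auto simp: tent_def)
  have prod01: "0 \<le> (\<Prod>i\<in>I. tent s r (g i))" "(\<Prod>i\<in>I. tent s r (g i)) \<le> 1" for s r and g :: "'i \<Rightarrow> real"
    using tent01 by (auto intro!: prod_nonneg prod_le_1)
  have h01: "0 \<le> h l v" "h l v \<le> 1" for l v
    unfolding h_def using prod01 by (auto intro!: prod_nonneg prod_le_1)
  have h_outside: "h l v = 1" if "v \<notin> U" for l v
    unfolding h_def
  proof (intro prod.neutral ballI)
    fix k
    have "\<exists>i\<in>I. e k \<le> \<bar>v i - c k i\<bar>" using that by (auto simp: U not_less)
    then obtain i where i: "i \<in> I" "e k \<le> \<bar>v i - c k i\<bar>" by blast
    hence "tent (real l) (e k) (v i - c k i) = 0"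
      using mult_nonneg_nonpos[of "real l" "e k - \<bar>v i - c k i\<bar>"] by (auto simp: tent_def)
    hence "(\<Prod>i\<in>I. tent (real l) (e k) (v i - c k i)) = 0" using i finite_I by (auto intro!: prod_zero)
    thus "1 - (\<Prod>i\<in>I. tent (real l) (e k) (v i - c k i)) = 1" by simp
  qed
  have h_inside: "\<forall>\<^sub>F l in sequentially. h l v = 0" if "v \<in> U" for v
  proof -
    obtain k where k: "\<forall>i\<in>I. \<bar>v i - c k i\<bar> < e k" using \<open>v \<in> U\<close> by (auto simp: U)
    have "\<forall>\<^sub>F l in sequentially. 1 \<le> real l * (e k - \<bar>v i - c k i\<bar>)" if "i \<in> I" for i
      using bspec[OF k that] by real_asymp
    hence "\<forall>\<^sub>F l in sequentially. \<forall>i\<in>I. 1 \<le> real l * (e k - \<bar>v i - c k i\<bar>)"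
      using finite_I by (intro eventually_ball_finite) auto
    thus ?thesis
      using eventually_gt_at_top[of k]
    proof eventually_elim
      case (elim l)
      hence "(\<Prod>i\<in>I. tent (real l) (e k) (v i - c k i)) = 1"
        by (intro prod.neutral) (auto simp: tent_def)
      thus ?case unfolding h_def using elim by (intro prod_zero) auto
    qed
  qed
  have tf: "test_fun (h l)" for l
    unfolding h_def by (rule test_fun_cover)
  have [measurable]: "\<And>l n. (\<lambda>\<omega>. h l (Y n \<omega>)) \<in> borel_measurable M" "\<And>l. (\<lambda>\<omega>. h l (W \<omega>)) \<in> borel_measurable N"
    using tf unfolding test_fun_def by blast+
  have "(\<lambda>l. LINT \<omega>|N. h l (W \<omega>)) \<longlonglongrightarrow> (LINT \<omega>|N. indicator {\<omega> \<in> space N. W \<omega> \<notin> U} \<omega>)"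
  proof (rule integral_dominated_convergence[where w = "\<lambda>_. 1"])
    show "AE \<omega> in N. (\<lambda>l. h l (W \<omega>)) \<longlonglongrightarrow> indicator {\<omega> \<in> space N. W \<omega> \<notin> U} \<omega>"
    proof (rule AE_I2)
      fix \<omega> assume "\<omega> \<in> space N"
      thus "(\<lambda>l. h l (W \<omega>)) \<longlonglongrightarrow> indicator {\<omega> \<in> space N. W \<omega> \<notin> U} \<omega>"
        using h_inside[of "W \<omega>"] h_outside[of "W \<omega>"]
        by (cases "W \<omega> \<in> U") (auto intro: tendsto_eventually)
    qed
  qed (use h01 in auto)
  also have "(LINT \<omega>|N. indicator {\<omega> \<in> space N. W \<omega> \<notin> U} \<omega>) = measure N {\<omega> \<in> space N. W \<omega> \<notin> U}"
    by (subst Bochner_Integration.integral_indicator) (auto intro!: arg_cong[where f = "measure N"])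
  also have "\<dots> = 1 - measure N {\<omega> \<in> space N. W \<omega> \<in> U}"
    by (rule N.prob_neg) measurable
  finally have "\<forall>\<^sub>F l in sequentially. (LINT \<omega>|N. h l (W \<omega>)) < 1 - x"
    by (rule order_tendstoD) (use assms(3) in simp)
  \<comment> \<open>\<open>l\<close> is fixed before \<open>n\<close>: convergence is available for
    each single test function, without uniformity in \<open>l\<close>.\<close>
  then obtain l where l: "(LINT \<omega>|N. h l (W \<omega>)) < 1 - x"
    by (auto dest: eventually_happens)
  have "\<forall>\<^sub>F n in sequentially. (LINT \<omega>|M. h l (Y n \<omega>)) < 1 - x"
    using test_fun_conv[OF tf] l by (rule order_tendstoD)
  thus ?thesis
  proof eventually_elim
    case (elim n)
    have "1 - measure M {\<omega> \<in> space M. Y n \<omega> \<in> U} = measure M {\<omega> \<in> space M. Y n \<omega> \<notin> U}"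
      by (rule M.prob_neg[symmetric]) measurable
    also have "\<dots> = (LINT \<omega>|M. indicator {\<omega> \<in> space M. Y n \<omega> \<notin> U} \<omega>)"
      by (subst Bochner_Integration.integral_indicator) (auto intro!: arg_cong[where f = "measure M"])
    also have "\<dots> \<le> (LINT \<omega>|M. h l (Y n \<omega>))"
      by (intro integral_mono M.integrable_const_bound[where B = 1])
         (use h01 h_outside in \<open>auto simp: indicator_def\<close>)
    finally show ?case using elim by linarith
  qed
qed

end

text \<open>A constant sequence turns \<open>portmanteau_open\<close> into a uniqueness theorem.\<close>

theorem cramer_wold_unique:
  fixes \<mu> \<nu> :: "('i \<Rightarrow> real) measure"
  assumes I: "finite I" "I \<noteq> {}"
    and "prob_space \<mu>" "prob_space \<nu>"
    and sets[measurable_cong]: "sets \<mu> = sets (Pi\<^sub>M I (\<lambda>_. borel))" "sets \<nu> = sets (Pi\<^sub>M I (\<lambda>_. borel))"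
    and eq: "\<And>a. distr \<mu> borel (\<lambda>g. \<Sum>i\<in>I. a i * g i) = distr \<nu> borel (\<lambda>g. \<Sum>i\<in>I. a i * g i)"
  shows "\<mu> = \<nu>"
proof -
  have coseq: "(LINT g|\<mu>. cos ((\<Sum>i\<in>I. a i * g i) + c)) = (LINT g|\<nu>. cos ((\<Sum>i\<in>I. a i * g i) + c))" for a c
  proof -
    have "(LINT g|\<mu>. cos ((\<Sum>i\<in>I. a i * g i) + c)) = (LINT x|distr \<mu> borel (\<lambda>g. \<Sum>i\<in>I. a i * g i). cos (x + c))"
      by (rule integral_distr[symmetric]) measurable
    also have "\<dots> = (LINT g|\<nu>. cos ((\<Sum>i\<in>I. a i * g i) + c))"
      unfolding eq by (rule integral_distr) measurable
    finally show ?thesis .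
  qed
  interpret A: projected_convergence \<mu> \<nu> I "\<lambda>_ g. g" "\<lambda>g. g"
    using assms by (intro projected_convergence.intro projected_convergence_axioms.intro) (auto simp: coseq)
  interpret B: projected_convergence \<nu> \<mu> I "\<lambda>_ g. g" "\<lambda>g. g"
    using assms by (intro projected_convergence.intro projected_convergence_axioms.intro) (auto simp: coseq)
  let ?S = "I \<rightarrow>\<^sub>E UNIV :: ('i \<Rightarrow> real) set"
  have space: "space \<mu> = ?S" "space \<nu> = ?S"
    using sets[THEN sets_eq_imp_space_eq] by (auto simp: space_PiM)
  let ?E = "{{v \<in> ?S. v \<in> U} | U. box_open I U}"
  have sigma: "space (sigma ?S ?E) = ?S" "sets (sigma ?S ?E) = sigma_sets ?S ?E"
    by (auto simp: space_measure_of_conv intro!: sets_measure_of)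
  \<comment> \<open>Preimages of open sets under a coordinate are traces of box-open sets, and
    box-open sets are measurable; so these traces generate the product sigma-algebra.\<close>
  have gen: "sets (Pi\<^sub>M I (\<lambda>_. borel)) = sigma_sets ?S ?E"
  proof
    have "(\<lambda>v. v) \<in> sigma ?S ?E \<rightarrow>\<^sub>M Pi\<^sub>M I (\<lambda>_. borel :: real measure)"
    proof (rule measurable_PiM_single')
      show "(\<lambda>v. v i) \<in> borel_measurable (sigma ?S ?E)" if "i \<in> I" for i
      proof (rule borel_measurableI)
        fix S :: "real set" assume "open S"
        have "box_open I {v. v i \<in> S}"
          unfolding box_open_def
        proof clarsimp
          fix v :: "'i \<Rightarrow> real" assume "v i \<in> S"
          then obtain e where "e > 0" "\<And>y. dist y (v i) < e \<Longrightarrow> y \<in> S"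
            using \<open>open S\<close> unfolding open_dist by blast
          thus "\<exists>e>0. \<forall>w. (\<forall>i\<in>I. \<bar>w i - v i\<bar> < e) \<longrightarrow> w i \<in> S"
            using that by (intro exI[of _ e]) (auto simp: dist_real_def)
        qed
        hence "{v \<in> ?S. v \<in> {v. v i \<in> S}} \<in> ?E" by blast
        thus "(\<lambda>v. v i) -` S \<inter> space (sigma ?S ?E) \<in> sets (sigma ?S ?E)"
          unfolding sigma by (intro sigma_sets.Basic) (simp add: vimage_def Int_def conj_commute)
      qed
      show "(\<lambda>v. v) \<in> space (sigma ?S ?E) \<rightarrow> (\<Pi>\<^sub>E i\<in>I. space (borel :: real measure))"
        unfolding sigma by simp
    qed
    note ident = measurable_sets[OF this]
    show "sets (Pi\<^sub>M I (\<lambda>_. borel)) \<subseteq> sigma_sets ?S ?E"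
    proof
      fix A :: "('i \<Rightarrow> real) set" assume A: "A \<in> sets (Pi\<^sub>M I (\<lambda>_. borel))"
      hence "A \<subseteq> ?S" using sets.sets_into_space by (fastforce simp: space_PiM)
      thus "A \<in> sigma_sets ?S ?E" using ident[OF A] unfolding sigma by (simp add: Int_absorb2)
    qed
    have "?E \<subseteq> sets \<mu>"
      using measurable_box_open[OF I, where f = "\<lambda>v. v" and M = \<mu>] unfolding space by auto
    from sets.sigma_sets_subset[OF this] show "sigma_sets ?S ?E \<subseteq> sets (Pi\<^sub>M I (\<lambda>_. borel))"
      unfolding space sets .
  qed
  show ?thesis
  proof (rule measure_eqI_generator_eq[where E = ?E and \<Omega> = ?S and A = "\<lambda>_. ?S"])
    show "Int_stable ?E"
    proof (rule Int_stableI, clarify)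
      fix U V :: "('i \<Rightarrow> real) set" assume UV: "box_open I U" "box_open I V"
      have "box_open I (U \<inter> V)"
        unfolding box_open_def
      proof
        fix v assume "v \<in> U \<inter> V"
        then obtain d e where "d > 0" "e > 0" "\<And>w. (\<forall>i\<in>I. \<bar>w i - v i\<bar> < d) \<Longrightarrow> w \<in> U" "\<And>w. (\<forall>i\<in>I. \<bar>w i - v i\<bar> < e) \<Longrightarrow> w \<in> V"
          using UV unfolding box_open_def by (metis IntE)
        thus "\<exists>e>0. \<forall>w. (\<forall>i\<in>I. \<bar>w i - v i\<bar> < e) \<longrightarrow> w \<in> U \<inter> V"
          by (intro exI[of _ "min d e"]) auto
      qed
      thus "\<exists>W. {v \<in> ?S. v \<in> U} \<inter> {v \<in> ?S. v \<in> V} = {v \<in> ?S. v \<in> W} \<and> box_open I W"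
        by (intro exI[of _ "U \<inter> V"]) auto
    qed
    show "emeasure \<mu> X = emeasure \<nu> X" if "X \<in> ?E" for X
    proof -
      obtain U where U: "X = {v \<in> ?S. v \<in> U}" "box_open I U" using \<open>X \<in> ?E\<close> by blast
      \<comment> \<open>For a constant sequence, \<open>portmanteau_open\<close> at
        \<open>x = measure \<mu> X\<close> would yield \<open>x < x\<close>.\<close>
      have "\<not> measure \<mu> X < measure \<nu> X"
        using A.portmanteau_open[OF I(2) U(2), of "measure \<mu> X"] by (auto simp: space U(1))
      moreover have "\<not> measure \<nu> X < measure \<mu> X"
        using B.portmanteau_open[OF I(2) U(2), of "measure \<nu> X"] by (auto simp: space U(1))
      ultimately show ?thesis
        by (simp add: A.M.emeasure_eq_measure A.N.emeasure_eq_measure)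
    qed
    have "box_open I UNIV" by (auto simp: box_open_def intro!: exI[of _ 1])
    thus "range (\<lambda>_. ?S) \<subseteq> ?E" by (auto intro!: exI[of _ UNIV])
  qed (use gen sets in \<open>auto simp: A.M.emeasure_eq_measure\<close>)
qed

section \<open>Distance to cones of blockwise monotone vectors\<close>

lemma L2_set_abs': "L2_set (\<lambda>j. \<bar>f j\<bar>) A = L2_set f A"
  by (simp add: L2_set_def)

lemma L2_set_minus_commute: "L2_set (\<lambda>j. f j - g j) A = L2_set (\<lambda>j. g j - f j) A"
  by (simp add: L2_set_def power2_commute)

text \<open>A minimiser exists by compactness. A vector farther from \<open>v\<close> than 0 can be
  ignored, and any other has entries of size at most twice the norm of \<open>v\<close>, so the
  search is confined to a bounded closed set.\<close>

lemma gren_minimal: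
  fixes B :: "int set" and v :: "int \<Rightarrow> real"
  assumes B: "finite B"
  shows "antimono_on B (gren B v)"
    and "antimono_on B w \<Longrightarrow> L2_set (\<lambda>i. v i - gren B v i) B \<le> L2_set (\<lambda>i. v i - w i) B"
proof -
  define R where "R = 2 * L2_set v B"
  \<comment> \<open>Pinning the entries outside \<open>B\<close> to \<open>undefined\<close> makes
    the set compact in the function space and its members extensional, as \<open>gren\<close>
    demands.\<close>
  define K where "K = (Pi\<^sub>E UNIV (\<lambda>i. if i \<in> B then {- R..R} else {undefined})) \<inter> {w :: int \<Rightarrow> real. \<forall>i\<in>B. \<forall>j\<in>B. i \<le> j \<longrightarrow> w j \<le> w i}"
  have coord: "continuous_on A (\<lambda>w :: int \<Rightarrow> real. w i)" for A i
    by (rule continuous_on_subset[OF continuous_on_product_coordinates]) simp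
  have "compactin (product_topology (\<lambda>_. euclidean) UNIV) (Pi\<^sub>E UNIV (\<lambda>i. if i \<in> B then {- R..R} else {undefined :: real}))"
    by (subst compactin_PiE) auto
  hence "compact (Pi\<^sub>E UNIV (\<lambda>i :: int. if i \<in> B then {- R..R} else {undefined :: real}))"
    by (simp add: euclidean_product_topology)
  moreover have "closed {w :: int \<Rightarrow> real. \<forall>i\<in>B. \<forall>j\<in>B. i \<le> j \<longrightarrow> w j \<le> w i}"
  proof -
    have "{w :: int \<Rightarrow> real. \<forall>i\<in>B. \<forall>j\<in>B. i \<le> j \<longrightarrow> w j \<le> w i} = (\<Inter>i\<in>B. \<Inter>j\<in>B \<inter> {i..}. {w. w j \<le> w i})"
      by auto
    also have "closed \<dots>"
      by (intro closed_INT ballI closed_Collect_le coord)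
    finally show ?thesis .
  qed
  ultimately have "compact K" unfolding K_def by (rule compact_Int_closed)
  moreover have R0: "0 \<le> R" by (simp add: R_def)
  hence zero: "restrict (\<lambda>_. 0) B \<in> K" by (auto simp: K_def)
  moreover have "continuous_on K (\<lambda>w. L2_set (\<lambda>i. v i - w i) B)"
    unfolding L2_set_def by (intro continuous_intros coord)
  ultimately obtain u where u: "u \<in> K" "\<And>w. w \<in> K \<Longrightarrow> L2_set (\<lambda>i. v i - u i) B \<le> L2_set (\<lambda>i. v i - w i) B"
    using continuous_attains_inf[of K] by blast
  have u_min: "L2_set (\<lambda>i. v i - u i) B \<le> L2_set (\<lambda>i. v i - w i) B" if w: "antimono_on B w" for w
  proof (cases "L2_set (\<lambda>i. v i - w i) B \<le> L2_set v B")
    case True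
    have "w i \<in> {- R..R}" if i: "i \<in> B" for i
    proof -
      have "\<bar>v i - w i\<bar> \<le> L2_set (\<lambda>i. \<bar>v i - w i\<bar>) B" "\<bar>v i\<bar> \<le> L2_set (\<lambda>i. \<bar>v i\<bar>) B"
        using member_le_L2_set[OF B i, of "\<lambda>i. \<bar>v i - w i\<bar>"] member_le_L2_set[OF B i, of "\<lambda>i. \<bar>v i\<bar>"] .
      hence "\<bar>w i\<bar> \<le> R" using True unfolding L2_set_abs' R_def by linarith
      thus ?thesis by auto
    qed
    hence "restrict w B \<in> K"
      using w by (simp add: K_def PiE_iff monotone_on_def)
    from u(2)[OF this] show ?thesis by (simp cong: L2_set_cong_simp)
  next
    case False
    thus ?thesis using u(2)[OF zero] by (simp cong: L2_set_cong_simp)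
  qed
  have "antimono_on B (gren B v) \<and> (\<forall>w. antimono_on B w \<longrightarrow> L2_set (\<lambda>i. v i - gren B v i) B \<le> L2_set (\<lambda>i. v i - w i) B)"
    unfolding gren_def
  proof (rule arg_minI[where x = u and Q = "\<lambda>z. antimono_on B z \<and> (\<forall>w. antimono_on B w \<longrightarrow> L2_set (\<lambda>i. v i - z i) B \<le> L2_set (\<lambda>i. v i - w i) B)"])
    show "u \<in> extensional B \<and> antimono_on B u" 
      using u(1) by (auto simp: K_def monotone_on_def extensional_def PiE_iff split: if_splits)
  next
    fix y :: "int \<Rightarrow> real" assume "y \<in> extensional B \<and> antimono_on B y"
    thus "\<not> L2_set (\<lambda>i. v i - y i) B < L2_set (\<lambda>i. v i - u i) B"
      using u_min[of y] by simp
  next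
    fix x :: "int \<Rightarrow> real" assume x: "x \<in> extensional B \<and> antimono_on B x" 
      "\<forall>y. y \<in> extensional B \<and> antimono_on B y \<longrightarrow> \<not> L2_set (\<lambda>i. v i - y i) B < L2_set (\<lambda>i. v i - x i) B"
    have "u \<in> extensional B \<and> antimono_on B u" 
      using u(1) by (auto simp: K_def monotone_on_def extensional_def PiE_iff split: if_splits)
    with x(2) have "L2_set (\<lambda>i. v i - x i) B \<le> L2_set (\<lambda>i. v i - u i) B" by (metis not_less)
    thus "antimono_on B x \<and> (\<forall>w. antimono_on B w \<longrightarrow> L2_set (\<lambda>i. v i - x i) B \<le> L2_set (\<lambda>i. v i - w i) B)"
      using x(1) u_min by (metis order_trans)
  qed
  thus "antimono_on B (gren B v)"
    and "antimono_on B w \<Longrightarrow> L2_set (\<lambda>i. v i - gren B v i) B \<le> L2_set (\<lambda>i. v i - w i) B" by auto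
qed

text \<open>Monotonicity on blocks is encoded by adjacent pairs: the inequality at \<open>j\<close>
  is dropped exactly when \<open>j\<close> is a knot. Membership is thus a finite system of linear
  inequalities, against which sums and multiples are easily checked.\<close>

definition mono_cone :: "int \<Rightarrow> int \<Rightarrow> int set \<Rightarrow> (int \<Rightarrow> real) set" where
  "mono_cone m M J = {w. \<forall>j\<in>{m..M - 1} - J. w (j + 1) \<le> w j}"

text \<open>This is verbatim the random variable inside \<open>crit_value\<close>; that it is the
  distance to \<open>mono_cone\<close> is the content of \<open>cone_dist_le\<close> and
  \<open>cone_dist_attained\<close>.\<close>

definition cone_dist :: "int \<Rightarrow> int \<Rightarrow> int set \<Rightarrow> (int \<Rightarrow> real) \<Rightarrow> real" where
  "cone_dist m M J v = L2_set (\<lambda>j. blockwise_gren m M J v j - v j) {m..M}"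

lemma knot_block_eq_iff:
  assumes "x \<in> {m..M}" "y \<in> {m..M}"
  shows "knot_block m M J x = knot_block m M J y \<longleftrightarrow> x \<in> knot_block m M J y"
proof
  assume "knot_block m M J x = knot_block m M J y"
  moreover have "x \<in> knot_block m M J x" using assms by (simp add: knot_block_def)
  ultimately show "x \<in> knot_block m M J y" by simp
next
  assume "x \<in> knot_block m M J y"
  hence "\<forall>k\<in>J. x \<le> k \<longleftrightarrow> y \<le> k" by (simp add: knot_block_def)
  thus "knot_block m M J x = knot_block m M J y" by (simp add: knot_block_def)
qed

lemma mono_cone_antimono_on_knot_block:
  assumes "w \<in> mono_cone m M J"
  shows "antimono_on (knot_block m M J b) w"
proof (rule monotone_onI)
  fix i i' assume i: "i \<in> knot_block m M J b" "i' \<in> knot_block m M J b" "i \<le> i'"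
  have "x \<le> i' \<Longrightarrow> w x \<le> w i" if "i \<le> x" for x
    using that
  proof (induction rule: int_ge_induct)
    case (step x)
    \<comment> \<open>A knot \<open>x\<close> with \<open>i \<le> x < i'\<close> would separate two
      points of the same block.\<close>
    hence "x \<notin> J" using i by (auto simp: knot_block_def)
    hence "w (x + 1) \<le> w x" using assms i step by (auto simp: mono_cone_def knot_block_def)
    thus ?case using step by auto
  qed simp
  thus "w i' \<le> w i" using i(3) by simp
qed

lemma knot_block_empty: "knot_block m M {} b = {m..M}"
  by (auto simp: knot_block_def)

lemma finite_knot_block [simp]: "finite (knot_block m M J b)"
  by (rule finite_subset[of _ "{m..M}"]) (auto simp: knot_block_def)

lemma antimono_on_iff_mono_cone: "antimono_on {m..M} w \<longleftrightarrow> w \<in> mono_cone m M {}"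
proof
  assume "w \<in> mono_cone m M {}"
  from mono_cone_antimono_on_knot_block[OF this] show "antimono_on {m..M} w"
    using knot_block_empty by simp
qed (auto simp: mono_cone_def monotone_on_def)

lemma blockwise_gren_in_mono_cone: "blockwise_gren m M J v \<in> mono_cone m M J"
  unfolding mono_cone_def
proof (intro CollectI ballI)
  fix j assume "j \<in> {m..M - 1} - J"
  hence j: "m \<le> j" "j \<le> M - 1" "j \<notin> J" by auto
  have "j \<le> k \<longleftrightarrow> j + 1 \<le> k" if "k \<in> J" for k
  proof -
    have "j \<noteq> k" using that j by blast
    thus ?thesis by linarith
  qed
  hence eq: "knot_block m M J (j + 1) = knot_block m M J j" and "j \<in> knot_block m M J j" "j + 1 \<in> knot_block m M J j"
    using j unfolding knot_block_def by auto
  from gren_minimal(1)[OF finite_knot_block, of m M J j v] show "blockwise_gren m M J v (j + 1) \<le> blockwise_gren m M J v j"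
    unfolding blockwise_gren_def eq using \<open>j \<in> knot_block m M J j\<close> \<open>j + 1 \<in> knot_block m M J j\<close> by (auto simp: monotone_on_def)
qed

text \<open>The blocks partition \<open>{m..M}\<close>, so the squared distance splits into block
  sums, each of which \<open>gren\<close> minimises; a vector of the cone is monotone on every block
  and hence a competitor there.\<close>

lemma cone_dist_le:
  assumes w: "w \<in> mono_cone m M J"
  shows "cone_dist m M J v \<le> L2_set (\<lambda>j. v j - w j) {m..M}"
proof -
  let ?b = "knot_block m M J"
  have blk: "{x \<in> {m..M}. ?b x = ?b y} = ?b y" if "y \<in> {m..M}" for y
    using knot_block_eq_iff[OF _ that] by (force simp: knot_block_def)
  have group: "(\<Sum>j\<in>{m..M}. f j) = (\<Sum>B\<in>?b ` {m..M}. \<Sum>j\<in>B. f j)" for f :: "int \<Rightarrow> real"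
  proof -
    have "(\<Sum>j\<in>{m..M}. f j) = (\<Sum>B\<in>?b ` {m..M}. \<Sum>j\<in>{x \<in> {m..M}. ?b x = B}. f j)"
      by (rule sum.image_gen) simp
    also have "\<dots> = (\<Sum>B\<in>?b ` {m..M}. \<Sum>j\<in>B. f j)"
      by (intro sum.cong refl) (use blk in blast)
    finally show ?thesis .
  qed
  have blk': "?b x = B" if "B \<in> ?b ` {m..M}" "x \<in> B" for x B
    using that blk by blast
  have "(\<Sum>j\<in>{m..M}. (blockwise_gren m M J v j - v j)\<^sup>2) \<le> (\<Sum>j\<in>{m..M}. (v j - w j)\<^sup>2)"
    unfolding group
  proof (rule sum_mono)
    fix B assume B: "B \<in> ?b ` {m..M}"
    then obtain b where b: "B = ?b b" by blast
    have "finite B" and w: "antimono_on B w" 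
      unfolding b using mono_cone_antimono_on_knot_block[OF w] by simp_all
    have "(\<Sum>j\<in>B. (blockwise_gren m M J v j - v j)\<^sup>2) = (\<Sum>j\<in>B. (v j - gren B v j)\<^sup>2)"
      by (intro sum.cong refl) (simp add: blockwise_gren_def blk'[OF B] power2_commute[of "v _"])
    also have "\<dots> \<le> (\<Sum>j\<in>B. (v j - w j)\<^sup>2)"
      using gren_minimal(2)[OF \<open>finite B\<close> w, of v] by (simp add: L2_set_def)
    finally show "(\<Sum>j\<in>B. (blockwise_gren m M J v j - v j)\<^sup>2) \<le> (\<Sum>j\<in>B. (v j - w j)\<^sup>2)" .
  qed
  thus ?thesis by (simp add: cone_dist_def L2_set_def)
qed

lemma cone_dist_attained:
  obtains w where "w \<in> mono_cone m M J" "cone_dist m M J v = L2_set (\<lambda>j. v j - w j) {m..M}"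
  using that[OF blockwise_gren_in_mono_cone[of m M J v]] unfolding cone_dist_def by (simp add: L2_set_minus_commute)

lemma cone_dist_nonneg: "0 \<le> cone_dist m M J v"
  by (simp add: cone_dist_def)

lemma cone_dist_le_norm: "cone_dist m M J v \<le> L2_set v {m..M}"
  using cone_dist_le[of "\<lambda>_. 0" m M J v] by (simp add: mono_cone_def)

lemma cone_dist_eq_0_iff: "cone_dist m M J v = 0 \<longleftrightarrow> v \<in> mono_cone m M J"
proof
  assume "cone_dist m M J v = 0"
  hence "blockwise_gren m M J v j = v j" if "j \<in> {m..M}" for j
    using that by (simp add: cone_dist_def L2_set_eq_0_iff)
  thus "v \<in> mono_cone m M J"
    using blockwise_gren_in_mono_cone[of m M J v] by (auto simp: mono_cone_def)
next
  assume "v \<in> mono_cone m M J"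
  from cone_dist_le[OF this, of v] cone_dist_nonneg[of m M J v] show "cone_dist m M J v = 0" by (simp add: L2_set_0')
qed

lemma cone_dist_triangle: "cone_dist m M J v \<le> cone_dist m M J u + L2_set (\<lambda>j. v j - u j) {m..M}"
proof -
  obtain w where w: "w \<in> mono_cone m M J" "cone_dist m M J u = L2_set (\<lambda>j. u j - w j) {m..M}"
    by (rule cone_dist_attained)
  have "cone_dist m M J v \<le> L2_set (\<lambda>j. (v j - u j) + (u j - w j)) {m..M}"
    using cone_dist_le[OF w(1), of v] by simp
  also have "\<dots> \<le> L2_set (\<lambda>j. v j - u j) {m..M} + L2_set (\<lambda>j. u j - w j) {m..M}"
    by (rule L2_set_triangle_ineq)
  finally show ?thesis using w by simp
qed

lemma cone_dist_cong: "(\<And>j. j \<in> {m..M} \<Longrightarrow> v j = u j) \<Longrightarrow> cone_dist m M J v = cone_dist m M J u"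
  using cone_dist_triangle[of m M J v u] cone_dist_triangle[of m M J u v]
  by (simp add: L2_set_def)

text \<open>One inequality for all positive factors suffices: the other is its instance for
  \<open>inverse c\<close>.\<close>

lemma cone_dist_scale:
  assumes "0 < c"
  shows "cone_dist m M J (\<lambda>j. c * v j) = c * cone_dist m M J v"
proof -
  have le: "cone_dist m M J (\<lambda>j. c * v j) \<le> c * cone_dist m M J v" if "0 < c" for c v
  proof -
    obtain w where w: "w \<in> mono_cone m M J" "cone_dist m M J v = L2_set (\<lambda>j. v j - w j) {m..M}"
      by (rule cone_dist_attained)
    have "(\<lambda>j. c * w j) \<in> mono_cone m M J" using w that by (auto simp: mono_cone_def)
    from cone_dist_le[OF this, of "\<lambda>j. c * v j"] that show ?thesis
      unfolding w right_diff_distrib[symmetric] by (simp add: L2_set_right_distrib)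
  qed
  have "cone_dist m M J (\<lambda>j. inverse c * (c * v j)) \<le> inverse c * cone_dist m M J (\<lambda>j. c * v j)"
    using assms by (intro le) simp
  with le[OF assms, of v] assms show ?thesis by (simp add: field_simps)
qed

text \<open>A best vector of the cone can be taken to be a p.m.f. Clipping at 0 does not move it
  away from \<open>q\<close>, which is nonnegative, and adding a constant keeps it in the cone;
  optimality against the constant that equalises the totals forces total mass 1.\<close>

lemma grenander_dist:
  assumes q: "\<And>j. 0 \<le> q j" "(\<Sum>j\<in>{m..M}. q j) = 1"
  shows "L2_set (\<lambda>j. pmf (grenander m M q) j - q j) {m..M} = cone_dist m M {} q"
proof -
  have ne: "m \<le> M" using q(2) by (cases "m \<le> M") auto
  obtain w where w: "w \<in> mono_cone m M {}" "cone_dist m M {} q = L2_set (\<lambda>j. q j - w j) {m..M}"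
    by (rule cone_dist_attained)
  define u where "u j = max 0 (w j)" for j
  have u: "u \<in> mono_cone m M {}" using w(1) by (force simp: mono_cone_def u_def)
  have "L2_set (\<lambda>j. \<bar>q j - u j\<bar>) {m..M} \<le> L2_set (\<lambda>j. \<bar>q j - w j\<bar>) {m..M}"
    by (intro L2_set_mono) (use q(1) in \<open>auto simp: u_def max_def\<close>)
  hence "L2_set (\<lambda>j. q j - u j) {m..M} \<le> L2_set (\<lambda>j. q j - w j) {m..M}" by (simp add: L2_set_def)
  with cone_dist_le[OF u, of q] w have u_min: "cone_dist m M {} q = L2_set (\<lambda>j. q j - u j) {m..M}" by simp
  define D where "D = (\<Sum>j\<in>{m..M}. q j - u j)"
  define N where "N = real (card {m..M})"
  have N: "N > 0" using ne by (simp add: N_def)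
  \<comment> \<open>\<open>D / N\<close> is the best constant shift. It would lower the squared
    distance by \<open>D\<^sup>2 / N\<close>, whence \<open>D = 0\<close>.\<close>
  have "(\<lambda>j. u j + D / N) \<in> mono_cone m M {}" using u by (simp add: mono_cone_def)
  from cone_dist_le[OF this, of q] have "(\<Sum>j\<in>{m..M}. (q j - u j)\<^sup>2) \<le> (\<Sum>j\<in>{m..M}. (q j - (u j + D / N))\<^sup>2)"
    by (simp add: u_min L2_set_def)
  also have "\<dots> = (\<Sum>j\<in>{m..M}. (q j - u j)\<^sup>2 - 2 * (D / N) * (q j - u j) + (D / N)\<^sup>2)"
  proof (intro sum.cong refl)
    fix j
    have "(a - (b + E))\<^sup>2 = (a - b)\<^sup>2 - 2 * E * (a - b) + E\<^sup>2" for a b E :: real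
      by (simp add: power2_eq_square algebra_simps)
    thus "(q j - (u j + D / N))\<^sup>2 = (q j - u j)\<^sup>2 - 2 * (D / N) * (q j - u j) + (D / N)\<^sup>2" .
  qed
  also have "\<dots> = (\<Sum>j\<in>{m..M}. (q j - u j)\<^sup>2) - 2 * (D / N) * D + N * (D / N)\<^sup>2"
  proof -
    have "(\<Sum>j\<in>{m..M}. a j - c * b j + e) = (\<Sum>j\<in>{m..M}. a j) - c * (\<Sum>j\<in>{m..M}. b j) + N * e" for a b :: "int \<Rightarrow> real" and c e
      by (simp add: sum.distrib sum_subtractf sum_distrib_left N_def)
    thus ?thesis unfolding D_def .
  qed
  also have "\<dots> = (\<Sum>j\<in>{m..M}. (q j - u j)\<^sup>2) - D\<^sup>2 / N"
    using N by (simp add: power2_eq_square field_simps)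
  finally have "D\<^sup>2 / N \<le> 0" by simp
  hence "D = 0" using N by (auto simp: divide_le_0_iff)
  hence sum_u: "(\<Sum>j\<in>{m..M}. u j) = 1" using q(2) by (simp add: D_def sum_subtractf)
  define r where "r = embed_pmf (\<lambda>j. if j \<in> {m..M} then u j else 0)"
  have "(\<integral>\<^sup>+ j. ennreal (if j \<in> {m..M} then u j else 0) \<partial>count_space UNIV) = (\<integral>\<^sup>+ j. ennreal (u j) * indicator {m..M} j \<partial>count_space UNIV)"
    by (intro nn_integral_cong) (auto simp: indicator_def)
  also have "\<dots> = (\<Sum>j\<in>{m..M}. ennreal (u j))"
    by (simp add: nn_integral_count_space_indicator[symmetric] nn_integral_count_space_finite)
  also have "\<dots> = 1" by (subst sum_ennreal) (simp_all only: sum_u ennreal_1, simp add: u_def)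
  finally have pmf_r: "pmf r j = (if j \<in> {m..M} then u j else 0)" for j
    unfolding r_def by (subst pmf_embed_pmf) (auto simp: u_def)
  have "set_pmf r \<subseteq> {m..M}" by (auto simp: set_pmf_eq pmf_r)
  moreover have "pmf r \<in> mono_cone m M {}" using u by (auto simp: mono_cone_def pmf_r)
  ultimately have r: "set_pmf r \<subseteq> {m..M} \<and> antimono_on {m..M} (pmf r)"
    by (simp add: antimono_on_iff_mono_cone)
  have r_min: "L2_set (\<lambda>j. q j - pmf r j) {m..M} = cone_dist m M {} q"
    unfolding u_min by (intro L2_set_cong) (auto simp: pmf_r)
  have low: "cone_dist m M {} q \<le> L2_set (\<lambda>j. q j - pmf s j) {m..M}" if "antimono_on {m..M} (pmf s)" for s
    using cone_dist_le[of "pmf s" m M "{}" q] that by (simp add: antimono_on_iff_mono_cone)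
  have "L2_set (\<lambda>j. q j - pmf (grenander m M q) j) {m..M} = cone_dist m M {} q"
    unfolding grenander_def
  proof (rule arg_minI[where x = r])
    show "\<not> L2_set (\<lambda>j. q j - pmf y j) {m..M} < L2_set (\<lambda>j. q j - pmf r j) {m..M}"
      if "set_pmf y \<subseteq> {m..M} \<and> antimono_on {m..M} (pmf y)" for y
      using low[of y] that r_min by simp
    show "L2_set (\<lambda>j. q j - pmf x j) {m..M} = cone_dist m M {} q"
      if "set_pmf x \<subseteq> {m..M} \<and> antimono_on {m..M} (pmf x)"
        "\<forall>y. set_pmf y \<subseteq> {m..M} \<and> antimono_on {m..M} (pmf y) \<longrightarrow>
           \<not> L2_set (\<lambda>j. q j - pmf y j) {m..M} < L2_set (\<lambda>j. q j - pmf x j) {m..M}" for x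
      using that(2)[rule_format, OF r] low[of x] that(1) r_min by simp
  qed (rule r)
  thus ?thesis by (simp add: L2_set_minus_commute)
qed

text \<open>Near \<open>p\<close> only the inequalities that \<open>p\<close> satisfies with
  equality constrain a perturbation. A projection of \<open>z\<close>, scaled down and added to
  \<open>p\<close>, keeps the strict descents because it is small against their gaps. Conversely
  \<open>w - p\<close> for monotone \<open>w\<close> is non-increasing wherever \<open>p\<close> is
  flat, whatever the size of \<open>z\<close>.\<close>

lemma cone_dist_local:
  assumes p: "p \<in> mono_cone m M {}" and J: "J = {j \<in> {m..M - 1}. p (j + 1) < p j}"
    and \<delta>: "\<And>j. j \<in> J \<Longrightarrow> \<delta> \<le> p j - p (j + 1)"
    and r: "0 < r" and small: "4 * L2_set z {m..M} \<le> r * \<delta>"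
  shows "r * cone_dist m M {} (\<lambda>j. p j + z j / r) = cone_dist m M J z"
proof (rule antisym)
  obtain u where u: "u \<in> mono_cone m M J" "cone_dist m M J z = L2_set (\<lambda>j. z j - u j) {m..M}"
    by (rule cone_dist_attained)
  \<comment> \<open>\<open>u\<close> is no farther from \<open>z\<close> than 0 is. Two neighbouring
    entries of \<open>u\<close> then differ by at most 4 times the norm of \<open>z\<close>, which
    is the origin of the 4 in \<open>small\<close>.\<close>
  have u_bound: "\<bar>u j\<bar> \<le> 2 * L2_set z {m..M}" if "j \<in> {m..M}" for j
  proof -
    have "\<bar>z j\<bar> \<le> L2_set z {m..M}" "\<bar>z j - u j\<bar> \<le> L2_set (\<lambda>j. z j - u j) {m..M}"
      using member_le_L2_set[OF _ that, of "\<lambda>j. \<bar>z j\<bar>"] member_le_L2_set[OF _ that, of "\<lambda>j. \<bar>z j - u j\<bar>"] 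
      by (simp_all add: L2_set_def)
    thus ?thesis using cone_dist_le_norm[of m M J z] u(2) by linarith
  qed
  have "(\<lambda>j. p j + u j / r) \<in> mono_cone m M {}"
    unfolding mono_cone_def
  proof (intro CollectI ballI)
    fix j assume "j \<in> {m..M - 1} - {}"
    hence j: "m \<le> j" "j \<le> M - 1" by auto
    show "p (j + 1) + u (j + 1) / r \<le> p j + u j / r"
    proof (cases "j \<in> J")
      case True
      have "\<bar>u j\<bar> \<le> 2 * L2_set z {m..M}" "\<bar>u (j + 1)\<bar> \<le> 2 * L2_set z {m..M}" using j by (auto intro!: u_bound)
      hence "u (j + 1) - u j \<le> r * \<delta>" using small by linarith
      also have "\<dots> \<le> r * (p j - p (j + 1))" using \<delta>[OF True] r by (intro mult_left_mono) auto
      finally have "(u (j + 1) - u j) / r \<le> p j - p (j + 1)" using r by (simp add: pos_divide_le_eq mult.commute)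
      thus ?thesis by (simp add: diff_divide_distrib)
    next
      case False
      hence "u (j + 1) \<le> u j" using u(1) j by (auto simp: mono_cone_def)
      hence "u (j + 1) / r \<le> u j / r" using r by (simp add: divide_right_mono)
      moreover have "p (j + 1) \<le> p j" using p j by (simp add: mono_cone_def)
      ultimately show ?thesis by linarith
    qed
  qed
  from cone_dist_le[OF this, of "\<lambda>j. p j + z j / r"]
  have "r * cone_dist m M {} (\<lambda>j. p j + z j / r) \<le> r * L2_set (\<lambda>j. p j + z j / r - (p j + u j / r)) {m..M}"
    using r by (intro mult_left_mono) auto
  also have "\<dots> = L2_set (\<lambda>j. z j - u j) {m..M}"
  proof -
    have "(\<lambda>j. r * (p j + z j / r - (p j + u j / r))) = (\<lambda>j. z j - u j)"
      using r by (simp add: fun_eq_iff right_diff_distrib distrib_left)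
    thus ?thesis using r by (simp add: L2_set_right_distrib del: add_diff_cancel_left)
  qed
  finally show "r * cone_dist m M {} (\<lambda>j. p j + z j / r) \<le> cone_dist m M J z" by (simp add: u)
next
  obtain w where w: "w \<in> mono_cone m M {}" "cone_dist m M {} (\<lambda>j. p j + z j / r) = L2_set (\<lambda>j. p j + z j / r - w j) {m..M}"
    by (rule cone_dist_attained)
  have "(\<lambda>j. r * (w j - p j)) \<in> mono_cone m M J"
    unfolding mono_cone_def
  proof (intro CollectI ballI)
    fix j assume j: "j \<in> {m..M - 1} - J"
    hence "p j \<le> p (j + 1)" "w (j + 1) \<le> w j" using w(1) by (auto simp: J mono_cone_def not_less)
    thus "r * (w (j + 1) - p (j + 1)) \<le> r * (w j - p j)" using r by (intro mult_left_mono) auto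
  qed
  from cone_dist_le[OF this, of z] have "cone_dist m M J z \<le> L2_set (\<lambda>j. z j - r * (w j - p j)) {m..M}" .
  also have "\<dots> = r * L2_set (\<lambda>j. p j + z j / r - w j) {m..M}"
  proof -
    have "(\<lambda>j. r * (p j + z j / r - w j)) = (\<lambda>j. z j - r * (w j - p j))"
      using r by (simp add: fun_eq_iff right_diff_distrib distrib_left)
    thus ?thesis using r by (simp only: L2_set_right_distrib[OF less_imp_le[OF r]])
  qed
  finally show "cone_dist m M J z \<le> r * cone_dist m M {} (\<lambda>j. p j + z j / r)" by (simp add: w)
qed

section \<open>Order statistics of independent normal variables\<close>

abbreviation iid_normal :: "'i set \<Rightarrow> ('i \<Rightarrow> real) measure" where
  "iid_normal I \<equiv> Pi\<^sub>M I (\<lambda>_. std_normal_distribution)"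

lemma prob_space_std_normal: "prob_space std_normal_distribution"
  by (rule prob_space_normal_density) simp

lemma prob_space_iid_normal: "prob_space (iid_normal I)"
  by (intro prob_space_PiM prob_space_std_normal)

lemma sets_iid_normal [measurable_cong]: "sets (iid_normal I) = sets (Pi\<^sub>M I (\<lambda>_. borel))"
  by (intro sets_PiM_cong) auto

lemma space_iid_normal: "space (iid_normal I) = extensional I"
  by (simp add: space_PiM PiE_def)

lemma distr_iid_normal_component:
  assumes "i \<in> I"
  shows "distr (iid_normal I) borel (\<lambda>z. z i) = std_normal_distribution"
proof -
  have "distr (iid_normal I) borel (\<lambda>z. z i) = distr (iid_normal I) std_normal_distribution (\<lambda>z. z i)"
    by (rule distr_cong) auto
  also have "\<dots> = std_normal_distribution"
    using assms by (intro distr_PiM_component prob_space_std_normal)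
  finally show ?thesis .
qed

lemma indep_vars_iid_normal:
  assumes "I \<noteq> {}"
  shows "prob_space.indep_vars (iid_normal I) (\<lambda>_. borel) (\<lambda>i z. z i) I"
proof -
  interpret prob_space "iid_normal I" by (rule prob_space_iid_normal)
  have "distr (iid_normal I) (Pi\<^sub>M I (\<lambda>_. borel)) (\<lambda>z. \<lambda>i\<in>I. z i) = distr (iid_normal I) (iid_normal I) (\<lambda>z. z)"
    by (rule distr_cong) (auto simp: sets_iid_normal space_iid_normal extensional_restrict)
  also have "\<dots> = iid_normal I" by (rule distr_id)
  also have "\<dots> = Pi\<^sub>M I (\<lambda>i. distr (iid_normal I) borel (\<lambda>z. z i))"
    by (rule PiM_cong) (simp_all add: distr_iid_normal_component)
  finally show ?thesis
    using assms by (subst indep_vars_iff_distr_eq_PiM') auto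
qed

lemma char_std_normal_scaled:
  "char (distr std_normal_distribution borel (\<lambda>x. c * x)) t = exp (- (complex_of_real (c * t))\<^sup>2 / 2)"
proof -
  have "char (distr std_normal_distribution borel (\<lambda>x. c * x)) t = char std_normal_distribution (c * t)"
    unfolding char_def by (subst integral_distr) (auto simp: mult_ac)
  thus ?thesis by (simp add: char_std_normal_distribution power_mult_distrib flip: exp_of_real)
qed

text \<open>Characteristic functions multiply by independence. If all coefficients vanish, both
  sides are the point mass at 0, in accordance with \<open>centered_gaussian\<close>.\<close>

lemma distr_iid_normal_lincomb:
  assumes "finite I" "I \<noteq> {}"
  shows "distr (iid_normal I) borel (\<lambda>z. \<Sum>i\<in>I. b i * z i)
       = distr std_normal_distribution borel (\<lambda>x. sqrt (\<Sum>i\<in>I. (b i)\<^sup>2) * x)"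
proof (rule Levy_uniqueness)
  interpret prob_space "iid_normal I" by (rule prob_space_iid_normal)
  interpret S: prob_space std_normal_distribution by (rule prob_space_std_normal)
  show "real_distribution (distr (iid_normal I) borel (\<lambda>z. \<Sum>i\<in>I. b i * z i))"
    by (simp add: real_distribution_def real_distribution_axioms_def prob_space_distr)
  show "real_distribution (distr std_normal_distribution borel (\<lambda>x. sqrt (\<Sum>i\<in>I. (b i)\<^sup>2) * x))"
    by (simp add: real_distribution_def real_distribution_axioms_def S.prob_space_distr)
  show "char (distr (iid_normal I) borel (\<lambda>z. \<Sum>i\<in>I. b i * z i)) = char (distr std_normal_distribution borel (\<lambda>x. sqrt (\<Sum>i\<in>I. (b i)\<^sup>2) * x))"
  proof
    fix t
    have "char (distr (iid_normal I) borel (\<lambda>z. \<Sum>i\<in>I. b i * z i)) t = (\<Prod>i\<in>I. char (distr (iid_normal I) borel (\<lambda>z. b i * z i)) t)"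
      by (intro char_distr_sum indep_vars_compose2[OF indep_vars_iid_normal[OF assms(2)]]) auto
    also have "\<dots> = (\<Prod>i\<in>I. char (distr std_normal_distribution borel (\<lambda>x. b i * x)) t)"
    proof (intro prod.cong refl arg_cong[where f = "\<lambda>D. char D t"])
      fix i assume i: "i \<in> I"
      have "distr (iid_normal I) borel (\<lambda>z. b i * z i) = distr (distr (iid_normal I) borel (\<lambda>z. z i)) borel (\<lambda>x. b i * x)"
        using i by (subst distr_distr) (auto simp: comp_def)
      thus "distr (iid_normal I) borel (\<lambda>z. b i * z i) = distr std_normal_distribution borel (\<lambda>x. b i * x)"
        using i by (simp add: distr_iid_normal_component)
    qed
    also have "\<dots> = exp (\<Sum>i\<in>I. - (complex_of_real (b i * t))\<^sup>2 / 2)"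
      unfolding char_std_normal_scaled by (rule exp_sum[OF assms(1), symmetric])
    also have "(\<Sum>i\<in>I. - (complex_of_real (b i * t))\<^sup>2 / 2) = - (complex_of_real (sqrt (\<Sum>i\<in>I. (b i)\<^sup>2) * t))\<^sup>2 / 2"
      by (simp add: power_mult_distrib sum_negf sum_divide_distrib sum_distrib_right sum_nonneg flip: of_real_power of_real_sum of_real_mult)
    finally show "char (distr (iid_normal I) borel (\<lambda>z. \<Sum>i\<in>I. b i * z i)) t = char (distr std_normal_distribution borel (\<lambda>x. sqrt (\<Sum>i\<in>I. (b i)\<^sup>2) * x)) t"
      by (simp add: char_std_normal_scaled)
  qed
qed

lemma std_normal_singleton: "measure std_normal_distribution {x} = 0"
proof -
  have "AE y in lborel. y \<in> {x} \<longrightarrow> ennreal (std_normal_density y) = 0"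
    using AE_lborel_singleton[of x] by eventually_elim auto
  hence "{x} \<in> null_sets std_normal_distribution"
    by (subst null_sets_density_iff) auto
  thus ?thesis by (simp add: measure_def null_sets_def)
qed

text \<open>The difference of two coordinates is a nondegenerate normal variable and has no atom at
  0.\<close>

lemma AE_iid_normal_inj_on:
  assumes "finite I"
  shows "AE z in iid_normal I. inj_on z I"
proof -
  interpret prob_space "iid_normal I" by (rule prob_space_iid_normal)
  interpret S: prob_space std_normal_distribution by (rule prob_space_std_normal)
  have "AE z in iid_normal I. z i \<noteq> z j" if ij: "i \<in> I" "j \<in> I" "i \<noteq> j" for i j
  proof -
    note [measurable] = measurable_component_singleton[OF ij(1), of "\<lambda>_. borel :: real measure"]
      measurable_component_singleton[OF ij(2), of "\<lambda>_. borel :: real measure"]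
    have ne: "I \<noteq> {}" using ij by blast
    define b where "b k = (if k = i then 1 else if k = j then - 1 else 0 :: real)" for k
    have diff: "(\<Sum>k\<in>I. b k * z k) = z i - z j" for z :: "_ \<Rightarrow> real"
    proof -
      have "(\<Sum>k\<in>I. b k * z k) = (\<Sum>k\<in>I. (if k = i then z k else 0) - (if k = j then z k else 0))"
        using ij by (intro sum.cong) (auto simp: b_def)
      thus ?thesis using ij assms by (simp add: sum_subtractf)
    qed
    have "(\<Sum>k\<in>I. (b k)\<^sup>2) > 0"
      using ij assms by (intro sum_pos2[of _ i]) (auto simp: b_def)
    hence *: "{x. sqrt (\<Sum>k\<in>I. (b k)\<^sup>2) * x = 0} = {0}" by auto
    have "measure (iid_normal I) {z \<in> space (iid_normal I). z i - z j = 0} = measure (distr (iid_normal I) borel (\<lambda>z. \<Sum>k\<in>I. b k * z k)) {0}"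
      by (subst measure_distr) (auto simp: diff vimage_def Int_def conj_commute)
    also have "\<dots> = measure std_normal_distribution {x. sqrt (\<Sum>k\<in>I. (b k)\<^sup>2) * x = 0}"
      by (subst distr_iid_normal_lincomb[OF assms ne]) (auto simp: measure_distr vimage_def)
    also have "\<dots> = 0" unfolding * by (rule std_normal_singleton)
    finally have "{z \<in> space (iid_normal I). z i - z j = 0} \<in> null_sets (iid_normal I)"
      using ij by (auto simp: null_sets_def emeasure_eq_measure)
    from AE_not_in[OF this] show ?thesis
      by (auto elim: AE_mp)
  qed
  hence "AE z in iid_normal I. \<forall>i\<in>I. \<forall>j\<in>I. i \<noteq> j \<longrightarrow> z i \<noteq> z j"
    using assms by (intro AE_finite_allI) auto
  thus ?thesis by eventually_elim (auto simp: inj_on_def)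
qed

section \<open>Sorting permutations and ordering probabilities\<close>

lemma bij_betw_rank:
  fixes k :: "'a \<Rightarrow> 'b :: linorder"
  assumes B: "finite B" and inj: "inj_on k B"
  shows "bij_betw (\<lambda>x. card {y \<in> B. k y < k x}) B {..<card B}"
proof -
  have less: "card {y \<in> B. k y < k x} < card {y \<in> B. k y < k x'}" if "x \<in> B" "k x < k x'" for x x'
    by (rule psubset_card_mono) (use B that in auto)
  have "inj_on (\<lambda>x. card {y \<in> B. k y < k x}) B"
  proof (rule inj_onI)
    fix x x' assume x: "x \<in> B" "x' \<in> B" "card {y \<in> B. k y < k x} = card {y \<in> B. k y < k x'}"
    hence "k x = k x'" using less[of x x'] less[of x' x] by (cases "k x" "k x'" rule: linorder_cases) auto
    thus "x = x'" using inj x by (auto dest: inj_onD)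
  qed
  moreover have "(\<lambda>x. card {y \<in> B. k y < k x}) ` B = {..<card B}"
  proof (rule card_subset_eq)
    show "(\<lambda>x. card {y \<in> B. k y < k x}) ` B \<subseteq> {..<card B}"
    proof (rule image_subsetI)
      fix x assume "x \<in> B"
      hence "card {y \<in> B. k y < k x} < card B" by (intro psubset_card_mono B) auto
      thus "card {y \<in> B. k y < k x} \<in> {..<card B}" by simp
    qed
    show "card ((\<lambda>x. card {y \<in> B. k y < k x}) ` B) = card {..<card B}"
      using calculation by (simp add: card_image)
  qed simp
  ultimately show ?thesis by (simp add: bij_betw_def)
qed

text \<open>The points of \<open>B\<close> are ranked twice, by position and by value. A sorting
  permutation must send the point of a given positional rank to the point of the same rank by value,
  which determines it.\<close>

lemma ex1_sorting_permutation:
  fixes B :: "int set" and z :: "int \<Rightarrow> real"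
  assumes B: "finite B" and inj: "inj_on z B"
  shows "\<exists>!\<sigma>. \<sigma> permutes B \<and> antimono_on B (\<lambda>x. z (\<sigma> x))"
proof -
  \<comment> \<open>The sign gives rank 0 to the largest value, in agreement with non-increasing
    order.\<close>
  define r where "r x = card {y \<in> B. - z y < - z x}" for x
  define r' where "r' x = card {y \<in> B. y < x}" for x
  have "inj_on (\<lambda>x. - z x) B" using inj by (auto simp: inj_on_def)
  from bij_betw_rank[OF B this] have r: "bij_betw r B {..<card B}" unfolding r_def .
  from bij_betw_rank[OF B inj_on_id2] have r': "bij_betw r' B {..<card B}" unfolding r'_def .
  have r_less: "r x < r x'" if "x' \<in> B" "x \<in> B" "z x' < z x" for x x'
    unfolding r_def by (rule psubset_card_mono) (use B that in auto)
  define \<sigma> where "\<sigma> x = (if x \<in> B then inv_into B r (r' x) else x)" for x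
  have "bij_betw (inv_into B r \<circ> r') B B"
    by (rule bij_betw_trans[OF r' bij_betw_inv_into[OF r]])
  hence "bij_betw \<sigma> B B" by (rule bij_betw_cong[THEN iffD1, rotated]) (simp add: \<sigma>_def)
  hence perm: "\<sigma> permutes B" by (rule bij_imp_permutes) (simp add: \<sigma>_def)
  have r\<sigma>: "r (\<sigma> x) = r' x" if "x \<in> B" for x
  proof -
    have "r' x \<in> r ` B" using r r' that by (auto simp: bij_betw_def)
    thus ?thesis using that by (simp add: \<sigma>_def f_inv_into_f)
  qed
  have "antimono_on B (\<lambda>x. z (\<sigma> x))"
  proof (rule monotone_onI)
    fix x y assume xy: "x \<in> B" "y \<in> B" "x \<le> y"
    have "r' x \<le> r' y" unfolding r'_def by (rule card_mono) (use B xy in auto)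
    hence "r (\<sigma> x) \<le> r (\<sigma> y)" using r\<sigma> xy by simp
    thus "z (\<sigma> y) \<le> z (\<sigma> x)"
      using r_less[of "\<sigma> x" "\<sigma> y"] permutes_in_image[OF perm] xy by (force simp: not_less[symmetric])
  qed
  moreover have "\<tau> = \<sigma>" if \<tau>: "\<tau> permutes B" "antimono_on B (\<lambda>x. z (\<tau> x))" for \<tau>
  proof
    fix x
    show "\<tau> x = \<sigma> x"
    proof (cases "x \<in> B")
      case x: True
      have iff: "z (\<tau> x) < z (\<tau> y) \<longleftrightarrow> y < x" if "y \<in> B" for y
      proof
        assume "z (\<tau> x) < z (\<tau> y)"
        thus "y < x" using monotone_onD[OF \<tau>(2) x that] by force
      next
        assume "y < x"
        hence "\<tau> y \<noteq> \<tau> x" using permutes_inj[OF \<tau>(1)] by (auto dest: injD)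
        hence "z (\<tau> y) \<noteq> z (\<tau> x)" using inj permutes_in_image[OF \<tau>(1)] x that by (auto dest: inj_onD)
        thus "z (\<tau> x) < z (\<tau> y)" using monotone_onD[OF \<tau>(2) that x] \<open>y < x\<close> by force
      qed
      \<comment> \<open>\<open>\<tau>\<close> carries the predecessors of \<open>x\<close> onto the
        points with values above \<open>z (\<tau> x)\<close>, so counting them gives the rank of
        \<open>\<tau> x\<close>.\<close>
      have "{y \<in> B. - z y < - z (\<tau> x)} = \<tau> ` {y \<in> B. y < x}"
      proof -
        have "{y \<in> B. - z y < - z (\<tau> x)} = {y \<in> \<tau> ` B. z (\<tau> x) < z y}"
          using permutes_image[OF \<tau>(1)] by simp
        also have "\<dots> = \<tau> ` {y \<in> B. z (\<tau> x) < z (\<tau> y)}" by blast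
        also have "{y \<in> B. z (\<tau> x) < z (\<tau> y)} = {y \<in> B. y < x}" using iff by blast
        finally show ?thesis .
      qed
      hence "r (\<tau> x) = r' x"
        unfolding r_def r'_def using permutes_inj_on[OF \<tau>(1)] by (simp add: card_image)
      hence "r (\<tau> x) = r (\<sigma> x)" using r\<sigma>[OF x] by simp
      thus ?thesis using r permutes_in_image[OF \<tau>(1)] permutes_in_image[OF perm] x
        by (auto simp: bij_betw_def dest: inj_onD)
    qed (use \<tau> perm in \<open>auto simp: permutes_def\<close>)
  qed
  ultimately show ?thesis using perm by blast
qed

lemma measurable_antimono_on:
  fixes f :: "int \<Rightarrow> 'a \<Rightarrow> real"
  assumes "finite B" and [measurable]: "\<And>i. i \<in> B \<Longrightarrow> f i \<in> borel_measurable M"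
  shows "{x \<in> space M. antimono_on B (\<lambda>i. f i x)} \<in> sets M"
proof -
  have "{x \<in> space M. antimono_on B (\<lambda>i. f i x)} = {x \<in> space M. \<forall>i\<in>B. \<forall>j\<in>B. i \<le> j \<longrightarrow> f j x \<le> f i x}"
    by (auto simp: monotone_on_def)
  also have "\<dots> \<in> sets M" using \<open>finite B\<close> by measurable
  finally show ?thesis .
qed

text \<open>Exchangeability: the events that \<open>z\<close> is non-increasing after a given
  permutation of \<open>B\<close> are equally likely, and almost surely exactly one of them occurs
  because the values are distinct.\<close>

lemma prob_iid_normal_antimono_on:
  fixes I :: "int set"
  assumes I: "finite I" and B: "B \<subseteq> I"
  shows "measure (iid_normal I) {z \<in> space (iid_normal I). antimono_on B z} = 1 / fact (card B)"
proof -
  interpret prob_space "iid_normal I" by (rule prob_space_iid_normal)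
  have finB: "finite B" using I B finite_subset by blast
  let ?P = "{\<sigma>. \<sigma> permutes B}"
  define A where "A \<sigma> = {z \<in> space (iid_normal I). antimono_on B (\<lambda>x. z (\<sigma> x))}" for \<sigma>
  have mem: "\<sigma> x \<in> I" if "\<sigma> permutes B" "x \<in> I" for \<sigma> x
    using that B permutes_in_image[OF that(1), of x] permutes_not_in[OF that(1), of x] by (cases "x \<in> B") auto
  have A_sets [measurable]: "A \<sigma> \<in> events" if "\<sigma> permutes B" for \<sigma>
    unfolding A_def using mem[OF that] B by (intro measurable_antimono_on finB) auto
  have equal: "prob (A \<sigma>) = prob (A (\<lambda>x. x))" if \<sigma>: "\<sigma> permutes B" for \<sigma>
  proof -
    have [measurable]: "A (\<lambda>x. x) \<in> events" using A_sets[OF permutes_id] by (simp add: id_def)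
    have "distr (iid_normal I) (iid_normal I) (\<lambda>z. \<lambda>n\<in>I. z (\<sigma> n)) = iid_normal I"
      using mem[OF \<sigma>] permutes_inj_on[OF \<sigma>] by (intro distr_PiM_reindex prob_space_std_normal) auto
    hence "prob (A (\<lambda>x. x)) = measure (distr (iid_normal I) (iid_normal I) (\<lambda>z. \<lambda>n\<in>I. z (\<sigma> n))) (A (\<lambda>x. x))"
      by simp
    also have "\<dots> = prob ((\<lambda>z. \<lambda>n\<in>I. z (\<sigma> n)) -` A (\<lambda>x. x) \<inter> space (iid_normal I))"
      using mem[OF \<sigma>] by (intro measure_distr) auto
    also have "(\<lambda>z. \<lambda>n\<in>I. z (\<sigma> n)) -` A (\<lambda>x. x) \<inter> space (iid_normal I) = A \<sigma>"
      using B by (auto simp: A_def space_iid_normal monotone_on_def subset_iff)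
    finally show ?thesis by simp
  qed
  have "AE z in iid_normal I. (\<Sum>\<sigma>\<in>?P. indicator (A \<sigma>) z) = (1 :: real)"
    using AE_iid_normal_inj_on[OF I] AE_space
  proof eventually_elim
    case (elim z)
    from ex1_sorting_permutation[OF finB inj_on_subset[OF elim(1) B]] obtain \<sigma> 
      where \<sigma>: "\<sigma> permutes B" "antimono_on B (\<lambda>x. z (\<sigma> x))" 
        and uniq: "\<And>\<tau>. \<tau> permutes B \<Longrightarrow> antimono_on B (\<lambda>x. z (\<tau> x)) \<Longrightarrow> \<tau> = \<sigma>" by blast
    have "z \<in> A \<tau> \<longleftrightarrow> \<tau> = \<sigma>" if "\<tau> permutes B" for \<tau>
      using \<sigma> uniq[OF that] elim(2) unfolding A_def by blast
    hence "(\<Sum>\<tau>\<in>?P. indicator (A \<tau>) z) = (\<Sum>\<tau>\<in>?P. if \<tau> = \<sigma> then 1 else (0 :: real))"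
      by (intro sum.cong refl) (simp add: indicator_def)
    also have "\<dots> = 1" using \<sigma> finite_permutations[OF finB] by simp
    finally show ?case .
  qed
  hence "expectation (\<lambda>z. \<Sum>\<sigma>\<in>?P. indicator (A \<sigma>) z :: real) = expectation (\<lambda>_. 1)"
    by (intro integral_cong_AE borel_measurable_sum borel_measurable_indicator) auto
  moreover have "expectation (\<lambda>z. \<Sum>\<sigma>\<in>?P. indicator (A \<sigma>) z :: real) = (\<Sum>\<sigma>\<in>?P. expectation (indicator (A \<sigma>)))"
    by (intro Bochner_Integration.integral_sum) (simp add: integrable_indicator_iff emeasure_eq_measure sets.Int_space_eq2 A_sets)
  moreover have "(\<Sum>\<sigma>\<in>?P. expectation (indicator (A \<sigma>)) :: real) = (\<Sum>\<sigma>\<in>?P. prob (A (\<lambda>x. x)))"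
  proof (intro sum.cong refl)
    fix \<sigma> assume "\<sigma> \<in> ?P"
    moreover have "A \<sigma> \<inter> space (iid_normal I) = A \<sigma>" by (auto simp: A_def)
    ultimately show "expectation (indicator (A \<sigma>)) = prob (A (\<lambda>x. x))" by (simp add: equal)
  qed
  ultimately have "real (card ?P) * prob (A (\<lambda>x. x)) = 1" by (simp add: prob_space)
  hence "fact (card B) * prob (A (\<lambda>x. x)) = 1" using card_permutations[OF refl finB] by simp
  thus ?thesis by (simp add: A_def field_simps)
qed

text \<open>Different level sets use disjoint families of independent coordinates, so the
  probabilities multiply.\<close>

lemma prob_iid_normal_antimono_on_blocks:
  fixes I :: "int set" and p :: "int \<Rightarrow> real"
  assumes I: "finite I" "I \<noteq> {}"
  shows "measure (iid_normal I) {z \<in> space (iid_normal I). \<forall>c\<in>p ` I. antimono_on {j \<in> I. p j = c} z}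
     = (\<Prod>c\<in>p ` I. 1 / fact (card {j \<in> I. p j = c}))"
proof -
  interpret prob_space "iid_normal I" by (rule prob_space_iid_normal)
  let ?L = "\<lambda>c. {j \<in> I. p j = c}"
  have "indep_vars (\<lambda>c. Pi\<^sub>M (?L c) (\<lambda>_. borel)) (\<lambda>c z. restrict (\<lambda>i. z i) (?L c)) (p ` I)"
    by (rule indep_vars_restrict[OF indep_vars_iid_normal[OF I(2)]]) (auto simp: disjoint_family_on_def)
  hence indep: "prob (\<Inter>c\<in>p ` I. (\<lambda>z. restrict (\<lambda>i. z i) (?L c)) -` {v \<in> space (Pi\<^sub>M (?L c) (\<lambda>_. borel)). antimono_on (?L c) v} \<inter> space (iid_normal I))
     = (\<Prod>c\<in>p ` I. prob ((\<lambda>z. restrict (\<lambda>i. z i) (?L c)) -` {v \<in> space (Pi\<^sub>M (?L c) (\<lambda>_. borel)). antimono_on (?L c) v} \<inter> space (iid_normal I)))"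
  proof (rule indep_varsD_finite)
    show "{v \<in> space (Pi\<^sub>M (?L c) (\<lambda>_. borel)). antimono_on (?L c) v} \<in> sets (Pi\<^sub>M (?L c) (\<lambda>_. borel :: real measure))" for c
      using I by (intro measurable_antimono_on[where f = "\<lambda>i v. v i"]) auto
  qed (use I in simp_all)
  have e1: "(\<lambda>z. restrict (\<lambda>i. z i) (?L c)) -` {v \<in> space (Pi\<^sub>M (?L c) (\<lambda>_. borel)). antimono_on (?L c) v} \<inter> space (iid_normal I)
     = {z \<in> space (iid_normal I). antimono_on (?L c) z}" for c
    by (auto simp: space_PiM monotone_on_def)
  have e2: "(\<Inter>c\<in>p ` I. {z \<in> space (iid_normal I). antimono_on (?L c) z}) = {z \<in> space (iid_normal I). \<forall>c\<in>p ` I. antimono_on (?L c) z}"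
    using I(2) by blast
  have e3: "prob {z \<in> space (iid_normal I). antimono_on (?L c) z} = 1 / fact (card (?L c))" for c
    by (rule prob_iid_normal_antimono_on[OF I(1)]) simp
  from indep show ?thesis unfolding e1 e2 e3 .
qed

section \<open>The Gaussian limit\<close>

lemma cone_dist_lipschitz:
  assumes "\<And>i. i \<in> {m..M} \<Longrightarrow> \<bar>w i - v i\<bar> \<le> e"
  shows "\<bar>cone_dist m M J w - cone_dist m M J v\<bar> \<le> real (card {m..M}) * e"
proof -
  have "L2_set (\<lambda>j. w j - v j) {m..M} \<le> (\<Sum>j\<in>{m..M}. \<bar>w j - v j\<bar>)" by (rule L2_set_le_sum_abs)
  also have "\<dots> \<le> real (card {m..M}) * e" using assms by (intro sum_bounded_above) auto
  finally have "L2_set (\<lambda>j. w j - v j) {m..M} \<le> real (card {m..M}) * e" .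
  thus ?thesis
    using cone_dist_triangle[of m M J w v] cone_dist_triangle[of m M J v w] L2_set_minus_commute[of w v "{m..M}"]
    by linarith
qed

lemma cone_dist_near:
  assumes "m \<le> M" "e > 0"
  obtains d where "d > 0" "\<And>w v. (\<forall>i\<in>{m..M}. \<bar>w i - v i\<bar> < d) \<Longrightarrow> \<bar>cone_dist m M J w - cone_dist m M J v\<bar> < e"
proof
  have c: "real (card {m..M}) > 0" using assms(1) by simp
  show "e / (2 * real (card {m..M})) > 0" using c assms by simp
  fix w v :: "int \<Rightarrow> real" assume "\<forall>i\<in>{m..M}. \<bar>w i - v i\<bar> < e / (2 * real (card {m..M}))"
  hence "\<bar>cone_dist m M J w - cone_dist m M J v\<bar> \<le> real (card {m..M}) * (e / (2 * real (card {m..M})))"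
    by (intro cone_dist_lipschitz) (blast intro: less_imp_le)
  also have "\<dots> = e / 2" using c by (simp only: times_divide_eq_right) (simp add: field_simps)
  finally show "\<bar>cone_dist m M J w - cone_dist m M J v\<bar> < e" using assms by linarith
qed

lemma box_open_cone_dist:
  assumes "m \<le> M" "open S"
  shows "box_open {m..M} {v. cone_dist m M J v \<in> S}"
  unfolding box_open_def
proof (rule ballI)
  fix v assume "v \<in> {v. cone_dist m M J v \<in> S}"
  hence "cone_dist m M J v \<in> S" by simp
  then obtain e where e: "e > 0" "\<And>y. dist y (cone_dist m M J v) < e \<Longrightarrow> y \<in> S"
    using assms(2) unfolding open_dist by blast
  obtain d where d: "d > 0" "\<And>w v. (\<forall>i\<in>{m..M}. \<bar>w i - v i\<bar> < d) \<Longrightarrow> \<bar>cone_dist m M J w - cone_dist m M J v\<bar> < e"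
    using cone_dist_near[OF assms(1) e(1)] by blast
  thus "\<exists>d>0. \<forall>w. (\<forall>i\<in>{m..M}. \<bar>w i - v i\<bar> < d) \<longrightarrow> w \<in> {v. cone_dist m M J v \<in> S}"
    using e(2) by (auto simp: dist_real_def)
qed

text \<open>Measurability is read off from the continuity of the distance, which bypasses the
  minimiser chosen by \<open>arg_min\<close>.\<close>

lemma borel_measurable_cone_dist:
  assumes "m \<le> M" "\<And>i. i \<in> {m..M} \<Longrightarrow> (\<lambda>x. f x i) \<in> borel_measurable N"
  shows "(\<lambda>x. cone_dist m M J (f x)) \<in> borel_measurable N"
proof (rule borel_measurable_iff_less[THEN iffD2], rule allI)
  fix a
  have "{x \<in> space N. f x \<in> {v. cone_dist m M J v \<in> {..<a}}} \<in> sets N"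
    using assms by (intro measurable_box_open[where I = "{m..M}"] box_open_cone_dist) auto
  thus "{x \<in> space N. cone_dist m M J (f x) < a} \<in> sets N" by simp
qed

text \<open>If the entries of \<open>q\<close> are nonnegative with sum 1, their square roots form a
  unit vector; \<open>z\<close> is projected onto its orthogonal complement, and then coordinate
  \<open>j\<close> is multiplied by \<open>sqrt (q j)\<close>. This is an explicit square root of
  the multinomial covariance, visibly continuous in \<open>q\<close>.\<close>

definition gvec :: "'i set \<Rightarrow> ('i \<Rightarrow> real) \<Rightarrow> ('i \<Rightarrow> real) \<Rightarrow> 'i \<Rightarrow> real" where
  "gvec I q z j = sqrt (q j) * z j - q j * (\<Sum>k\<in>I. sqrt (q k) * z k)"

lemma measurable_gvec [measurable]: "j \<in> I \<Longrightarrow> (\<lambda>z. gvec I q z j) \<in> borel_measurable (iid_normal I)"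
  unfolding gvec_def by measurable

lemma gvec_scale: "gvec I q (\<lambda>i\<in>I. c * z i) j = c * gvec I q z j" if "j \<in> I"
  using that unfolding gvec_def by (simp add: sum_distrib_left algebra_simps cong: sum.cong)

lemma sum_gvec:
  assumes "finite I"
  shows "(\<Sum>j\<in>I. a j * gvec I q z j) = (\<Sum>k\<in>I. (sqrt (q k) * (a k - (\<Sum>j\<in>I. a j * q j))) * z k)"
proof -
  have "(\<Sum>j\<in>I. a j * gvec I q z j) = (\<Sum>j\<in>I. a j * (sqrt (q j) * z j)) - (\<Sum>j\<in>I. a j * q j) * (\<Sum>k\<in>I. sqrt (q k) * z k)"
    by (simp add: gvec_def right_diff_distrib sum_subtractf sum_distrib_right mult.assoc)
  also have "\<dots> = (\<Sum>k\<in>I. (sqrt (q k) * (a k - (\<Sum>j\<in>I. a j * q j))) * z k)"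
    by (simp add: sum_distrib_left[of "sum _ _"] sum_subtractf[symmetric] algebra_simps)
  finally show ?thesis .
qed

text \<open>Both left-hand sides are the variance of \<open>a\<close> under the weights
  \<open>q\<close>, once through the coefficients of \<open>gvec\<close> and once through the
  quadratic form of the multinomial covariance.\<close>

lemma multinomial_variance:
  fixes q :: "'i \<Rightarrow> real"
  assumes "finite I" "\<forall>j\<in>I. 0 \<le> q j" "(\<Sum>j\<in>I. q j) = 1"
  shows "(\<Sum>k\<in>I. (sqrt (q k) * (a k - (\<Sum>j\<in>I. a j * q j)))\<^sup>2) = (\<Sum>k\<in>I. q k * (a k)\<^sup>2) - (\<Sum>j\<in>I. a j * q j)\<^sup>2"
    and "(\<Sum>i\<in>I. \<Sum>j\<in>I. a i * ((if i = j then q i else 0) - q i * q j) * a j) = (\<Sum>k\<in>I. q k * (a k)\<^sup>2) - (\<Sum>j\<in>I. a j * q j)\<^sup>2"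
proof -
  define A where "A = (\<Sum>j\<in>I. a j * q j)"
  have "(\<Sum>k\<in>I. (sqrt (q k) * (a k - A))\<^sup>2) = (\<Sum>k\<in>I. q k * (a k)\<^sup>2 - 2 * A * (a k * q k) + A\<^sup>2 * q k)"
    using assms(2) by (intro sum.cong) (auto simp: power_mult_distrib power2_eq_square algebra_simps)
  also have "\<dots> = (\<Sum>k\<in>I. q k * (a k)\<^sup>2) - 2 * A * A + A\<^sup>2 * (\<Sum>k\<in>I. q k)"
    by (simp add: sum.distrib sum_subtractf sum_distrib_left[symmetric] A_def)
  also have "\<dots> = (\<Sum>k\<in>I. q k * (a k)\<^sup>2) - A\<^sup>2" by (simp add: assms(3) power2_eq_square)
  finally show "(\<Sum>k\<in>I. (sqrt (q k) * (a k - (\<Sum>j\<in>I. a j * q j)))\<^sup>2) = (\<Sum>k\<in>I. q k * (a k)\<^sup>2) - (\<Sum>j\<in>I. a j * q j)\<^sup>2"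
    by (simp add: A_def)
  have "(\<Sum>j\<in>I. a i * ((if i = j then q i else 0) - q i * q j) * a j) = q i * (a i)\<^sup>2 - a i * q i * A" if "i \<in> I" for i
  proof -
    have "(\<Sum>j\<in>I. a i * ((if i = j then q i else 0) - q i * q j) * a j) = (\<Sum>j\<in>I. (if i = j then q i * (a i)\<^sup>2 else 0) - a i * q i * (a j * q j))"
      by (intro sum.cong) (auto simp: power2_eq_square algebra_simps)
    also have "\<dots> = q i * (a i)\<^sup>2 - a i * q i * A"
      using that assms(1) by (simp add: sum_subtractf sum_distrib_left[symmetric] A_def)
    finally show ?thesis .
  qed
  hence "(\<Sum>i\<in>I. \<Sum>j\<in>I. a i * ((if i = j then q i else 0) - q i * q j) * a j) = (\<Sum>i\<in>I. q i * (a i)\<^sup>2 - a i * q i * A)"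
    by (intro sum.cong) auto
  also have "\<dots> = (\<Sum>k\<in>I. q k * (a k)\<^sup>2) - A * A"
    by (simp add: sum_subtractf sum_distrib_right[symmetric] A_def[symmetric])
  finally show "(\<Sum>i\<in>I. \<Sum>j\<in>I. a i * ((if i = j then q i else 0) - q i * q j) * a j) = (\<Sum>k\<in>I. q k * (a k)\<^sup>2) - (\<Sum>j\<in>I. a j * q j)\<^sup>2"
    by (simp add: A_def power2_eq_square)
qed

lemma distr_gvec_lincomb:
  assumes "finite I" "I \<noteq> {}" "\<forall>j\<in>I. 0 \<le> q j" "(\<Sum>j\<in>I. q j) = 1"
  shows "distr (iid_normal I) borel (\<lambda>z. \<Sum>j\<in>I. a j * gvec I q z j)
    = distr std_normal_distribution borel (\<lambda>x. sqrt ((\<Sum>k\<in>I. q k * (a k)\<^sup>2) - (\<Sum>j\<in>I. a j * q j)\<^sup>2) * x)"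
  unfolding sum_gvec[OF assms(1)] distr_iid_normal_lincomb[OF assms(1,2)] multinomial_variance(1)[OF assms(1,3,4)] ..

lemma mv_normal_multinomial:
  fixes q :: "'i \<Rightarrow> real"
  assumes I: "finite I" "I \<noteq> {}" and q: "\<forall>j\<in>I. 0 \<le> q j" "(\<Sum>j\<in>I. q j) = 1"
  defines "\<Gamma> \<equiv> \<lambda>r s. (if r = s then q r else 0) - q r * q s"
  shows "mv_normal I \<Gamma> = distr (iid_normal I) (Pi\<^sub>M I (\<lambda>_. borel)) (\<lambda>z. \<lambda>j\<in>I. gvec I q z j)"
    (is "_ = ?\<mu>")
proof -
  interpret prob_space "iid_normal I" by (rule prob_space_iid_normal)
  have [measurable]: "(\<lambda>z. \<lambda>j\<in>I. gvec I q z j) \<in> iid_normal I \<rightarrow>\<^sub>M Pi\<^sub>M I (\<lambda>_. borel)"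
    by (intro measurable_restrict) measurable
  have "centered_gaussian I \<Gamma> ?\<mu>"
    unfolding centered_gaussian_def
  proof (intro conjI allI)
    show "prob_space ?\<mu>" by (rule prob_space_distr) measurable
    fix a
    have "distr ?\<mu> borel (\<lambda>g. \<Sum>i\<in>I. a i * g i) = distr (iid_normal I) borel (\<lambda>z. \<Sum>j\<in>I. a j * gvec I q z j)"
      by (subst distr_distr) (auto simp: comp_def intro!: distr_cong sum.cong)
    also have "\<dots> = distr std_normal_distribution borel (\<lambda>z. sqrt (\<Sum>i\<in>I. \<Sum>j\<in>I. a i * \<Gamma> i j * a j) * z)"
      unfolding distr_gvec_lincomb[OF I q] \<Gamma>_def multinomial_variance(2)[OF I(1) q] ..
    finally show "distr ?\<mu> borel (\<lambda>g. \<Sum>i\<in>I. a i * g i) = distr std_normal_distribution borel (\<lambda>z. sqrt (\<Sum>i\<in>I. \<Sum>j\<in>I. a i * \<Gamma> i j * a j) * z)" .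
  qed simp
  moreover have "\<nu> = ?\<mu>" if "centered_gaussian I \<Gamma> \<nu>" for \<nu>
    using that \<open>centered_gaussian I \<Gamma> ?\<mu>\<close> unfolding centered_gaussian_def
    by (intro cramer_wold_unique[OF I]) auto
  ultimately show ?thesis
    unfolding mv_normal_def by (rule the_equality)
qed

section \<open>No atoms away from 0 and full support\<close>

lemma distr_std_normal_scale:
  assumes "0 < c"
  shows "distr std_normal_distribution std_normal_distribution (\<lambda>x. c * x)
    = density std_normal_distribution (\<lambda>x. ennreal (normal_density 0 c x / std_normal_density x))"
proof -
  interpret S: prob_space std_normal_distribution by (rule prob_space_std_normal)
  have "distributed std_normal_distribution lborel (\<lambda>x. x) (normal_density 0 1)"
    by (auto simp: distributed_def distr_id2)
  from S.normal_density_affine[OF this, of c 0] assms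
  have "distributed std_normal_distribution lborel (\<lambda>x. c * x) (normal_density 0 c)" by simp
  hence "distr std_normal_distribution lborel (\<lambda>x. c * x) = density lborel (normal_density 0 c)"
    by (rule distributed_distr_eq_density)
  also have "\<dots> = density std_normal_distribution (\<lambda>x. ennreal (normal_density 0 c x / std_normal_density x))"
  proof -
    have "std_normal_density x * (normal_density 0 c x / std_normal_density x) = normal_density 0 c x" for x
      using normal_density_pos[of 1 0 x] by simp
    thus ?thesis
      by (subst density_density_eq) (auto simp: normal_density_nonneg simp flip: ennreal_mult)
  qed
  finally show ?thesis
    by (subst distr_cong[OF refl, of _ lborel _ "\<lambda>x. c * x"]) auto
qed

text \<open>Scaling every coordinate yields a law with a density with respect to
  \<open>iid_normal I\<close>, namely the finite product of the one-dimensional quotients, so null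
  sets stay null.\<close>

lemma iid_normal_scale_null:
  fixes I :: "'i set"
  assumes I: "finite I" and c: "0 < c" and A: "A \<in> sets (iid_normal I)" "measure (iid_normal I) A = 0"
  shows "measure (iid_normal I) {z \<in> space (iid_normal I). (\<lambda>i\<in>I. c * z i) \<in> A} = 0"
proof -
  interpret P: prob_space "iid_normal I" by (rule prob_space_iid_normal)
  define g where "g x = ennreal (normal_density 0 c x / std_normal_density x)" for x
  have [measurable]: "g \<in> borel_measurable borel" unfolding g_def by measurable
  note scale = distr_std_normal_scale[OF c, folded g_def]
  let ?D = "density std_normal_distribution g"
  interpret S: prob_space std_normal_distribution by (rule prob_space_std_normal)
  have D: "prob_space ?D" unfolding scale[symmetric] by (rule S.prob_space_distr) simp
  interpret D: product_prob_space "\<lambda>_. ?D" by (intro product_prob_spaceI D)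
  interpret S': product_prob_space "\<lambda>_ :: 'i. std_normal_distribution" by (intro product_prob_spaceI prob_space_std_normal)
  have "density (iid_normal I) (\<lambda>z. \<Prod>i\<in>I. g (z i)) = Pi\<^sub>M I (\<lambda>_. ?D)"
  proof (rule D.PiM_eqI[OF I])
    show "sets (density (iid_normal I) (\<lambda>z. \<Prod>i\<in>I. g (z i))) = sets (Pi\<^sub>M I (\<lambda>_. ?D))"
      by (auto intro!: sets_PiM_cong)
    fix B :: "'i \<Rightarrow> real set" assume B: "\<And>i. i \<in> I \<Longrightarrow> B i \<in> sets ?D"
    have "Pi\<^sub>E I B \<in> sets (iid_normal I)" using I B by (intro sets_PiM_I_finite) auto
    hence "emeasure (density (iid_normal I) (\<lambda>z. \<Prod>i\<in>I. g (z i))) (Pi\<^sub>E I B) = (\<integral>\<^sup>+z. (\<Prod>i\<in>I. g (z i)) * indicator (Pi\<^sub>E I B) z \<partial>iid_normal I)"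
      by (subst emeasure_density) auto
    also have "\<dots> = (\<integral>\<^sup>+z. (\<Prod>i\<in>I. g (z i) * indicator (B i) (z i)) \<partial>iid_normal I)"
    proof (rule nn_integral_cong)
      fix z assume z: "z \<in> space (iid_normal I)"
      show "(\<Prod>i\<in>I. g (z i)) * indicator (Pi\<^sub>E I B) z = (\<Prod>i\<in>I. g (z i) * indicator (B i) (z i))"
      proof (cases "z \<in> Pi\<^sub>E I B")
        case True thus ?thesis by (auto intro!: prod.cong simp: PiE_mem)
      next
        case False
        then obtain i where "i \<in> I" "z i \<notin> B i" using z by (auto simp: PiE_def space_iid_normal)
        hence "(\<Prod>i\<in>I. g (z i) * indicator (B i) (z i)) = 0" using I by (intro prod_zero bexI[of _ i]) auto
        thus ?thesis using False by simp
      qed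
    qed
    also have "\<dots> = (\<Prod>i\<in>I. \<integral>\<^sup>+x. g x * indicator (B i) x \<partial>std_normal_distribution)"
      using I B by (intro S'.product_nn_integral_prod) auto
    also have "\<dots> = (\<Prod>i\<in>I. emeasure ?D (B i))"
      using B by (intro prod.cong refl) (subst emeasure_density, auto)
    finally show "emeasure (density (iid_normal I) (\<lambda>z. \<Prod>i\<in>I. g (z i))) (Pi\<^sub>E I B) = (\<Prod>i\<in>I. emeasure ?D (B i))" .
  qed
  also have "\<dots> = distr (iid_normal I) (iid_normal I) (compose I ((*) c))"
    unfolding scale[symmetric] using I by (intro distr_PiM_finite_prob_space'[symmetric] prob_space_std_normal) auto
  finally have eq: "distr (iid_normal I) (iid_normal I) (compose I ((*) c)) = density (iid_normal I) (\<lambda>z. \<Prod>i\<in>I. g (z i))" ..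
  have "A \<in> null_sets (iid_normal I)" using A by (auto simp: null_sets_def P.emeasure_eq_measure)
  moreover have "absolutely_continuous (iid_normal I) (density (iid_normal I) (\<lambda>z. \<Prod>i\<in>I. g (z i)))"
    by (rule absolutely_continuousI_density) measurable
  ultimately have "A \<in> null_sets (distr (iid_normal I) (iid_normal I) (compose I ((*) c)))"
    unfolding eq absolutely_continuous_def by blast
  moreover have [measurable]: "compose I ((*) c) \<in> iid_normal I \<rightarrow>\<^sub>M iid_normal I"
    unfolding compose_def by (intro measurable_restrict) auto
  ultimately have "measure (iid_normal I) (compose I ((*) c) -` A \<inter> space (iid_normal I)) = 0"
    using A by (simp add: null_sets_distr_iff measure_eq_0_null_sets)
  also have "compose I ((*) c) -` A \<inter> space (iid_normal I) = {z \<in> space (iid_normal I). (\<lambda>i\<in>I. c * z i) \<in> A}"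
    by (auto simp: compose_def)
  finally show ?thesis .
qed

lemma homogeneous_no_atom:
  fixes I :: "'i set" and f :: "('i \<Rightarrow> real) \<Rightarrow> real"
  assumes I: "finite I" and f [measurable]: "f \<in> borel_measurable (iid_normal I)"
    and hom: "\<And>c z. 0 < c \<Longrightarrow> f (\<lambda>i\<in>I. c * z i) = c * f z" and t: "t > 0"
  shows "measure (iid_normal I) {z \<in> space (iid_normal I). f z = t} = 0"
proof (rule ccontr)
  interpret P: prob_space "iid_normal I" by (rule prob_space_iid_normal)
  assume pos: "\<not> ?thesis"
  interpret D: real_distribution "distr (iid_normal I) borel f"
    by (simp add: real_distribution_def real_distribution_axioms_def P.prob_space_distr)
  have D: "measure (distr (iid_normal I) borel f) {s} = measure (iid_normal I) {z \<in> space (iid_normal I). f z = s}" for s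
    by (subst measure_distr) (auto intro!: arg_cong[where f = "measure (iid_normal I)"])
  \<comment> \<open>If the level \<open>s\<close> carried no mass, neither would its preimage under
    scaling by \<open>s / t\<close>, which is the level \<open>t\<close>. So every \<open>s\<close>
    in the unit interval would be an atom.\<close>
  have "{0<..<1} \<subseteq> {s. measure (distr (iid_normal I) borel f) {s} \<noteq> 0}"
  proof safe
    fix s :: real assume s: "s \<in> {0<..<1}" and 0: "measure (distr (iid_normal I) borel f) {s} = 0"
    have st: "0 < s / t" and eqv: "s / t * y = s \<longleftrightarrow> y = t" for y
      using s t by (auto simp: field_simps)
    have "measure (iid_normal I) {z \<in> space (iid_normal I). (\<lambda>i\<in>I. s / t * z i) \<in> {z \<in> space (iid_normal I). f z = s}} = 0"
      using s t 0 by (intro iid_normal_scale_null I) (auto simp: D)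
    also have "{z \<in> space (iid_normal I). (\<lambda>i\<in>I. s / t * z i) \<in> {z \<in> space (iid_normal I). f z = s}} = {z \<in> space (iid_normal I). f z = t}"
      unfolding mem_Collect_eq hom[OF st] eqv by (auto simp: space_iid_normal)
    finally show False using pos by simp
  qed
  moreover have "countable {s. measure (distr (iid_normal I) borel f) {s} \<noteq> 0}"
    by (rule D.countable_support)
  ultimately have "countable {0<..<1 :: real}" by (rule countable_subset)
  thus False using uncountable_open_interval[of 0 "1 :: real"] by simp
qed

lemma std_normal_interval_pos:
  assumes "a < b"
  shows "measure std_normal_distribution {a<..<b} > 0"
proof (rule ccontr)
  interpret S: prob_space std_normal_distribution by (rule prob_space_std_normal)
  assume "\<not> ?thesis"
  hence "measure std_normal_distribution {a<..<b} = 0" using measure_nonneg[of std_normal_distribution "{a<..<b}"] by linarith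
  hence "{a<..<b} \<in> null_sets std_normal_distribution" by (auto simp: null_sets_def S.emeasure_eq_measure)
  hence "AE x in lborel. x \<in> {a<..<b} \<longrightarrow> ennreal (std_normal_density x) = 0"
    by (subst (asm) null_sets_density_iff) auto
  hence "AE x in lborel. x \<notin> {a<..<b}"
  proof eventually_elim
    case (elim x)
    thus ?case using normal_density_pos[of 1 0 x] by (auto simp: ennreal_eq_0_iff)
  qed
  hence "{a<..<b} \<in> null_sets lborel" by (subst (asm) AE_iff_null_sets[symmetric]) auto
  hence "emeasure lborel {a<..<b} = 0" by auto
  thus False using assms by simp
qed

lemma iid_normal_box_open_pos:
  fixes I :: "'i set"
  assumes I: "finite I" "I \<noteq> {}" and U: "box_open I U" "v \<in> U"
  shows "measure (iid_normal I) {z \<in> space (iid_normal I). z \<in> U} > 0"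
proof -
  interpret P: prob_space "iid_normal I" by (rule prob_space_iid_normal)
  interpret S: product_prob_space "\<lambda>_ :: 'i. std_normal_distribution" by (intro product_prob_spaceI prob_space_std_normal)
  interpret F: finite_product_prob_space "\<lambda>_. std_normal_distribution" I
    by standard (fact I)
  obtain e where e: "e > 0" "\<And>w. (\<forall>i\<in>I. \<bar>w i - v i\<bar> < e) \<Longrightarrow> w \<in> U"
    using U unfolding box_open_def by metis
  have "0 < (\<Prod>i\<in>I. measure std_normal_distribution {v i - e<..<v i + e})"
    using e by (intro prod_pos) (auto intro!: std_normal_interval_pos)
  also have "\<dots> = measure (iid_normal I) (Pi\<^sub>E I (\<lambda>i. {v i - e<..<v i + e}))"
    by (rule F.prob_times[symmetric]) auto
  also have "\<dots> \<le> measure (iid_normal I) {z \<in> space (iid_normal I). z \<in> U}"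
  proof (rule P.finite_measure_mono)
    show "Pi\<^sub>E I (\<lambda>i. {v i - e<..<v i + e}) \<subseteq> {z \<in> space (iid_normal I). z \<in> U}"
    proof
      fix z assume z: "z \<in> Pi\<^sub>E I (\<lambda>i. {v i - e<..<v i + e})"
      have "z \<in> U"
      proof (rule e(2), rule ballI)
        fix i assume "i \<in> I"
        from PiE_mem[OF z this] show "\<bar>z i - v i\<bar> < e" by auto
      qed
      thus "z \<in> {z \<in> space (iid_normal I). z \<in> U}" using z by (auto simp: space_iid_normal PiE_def)
    qed
    show "{z \<in> space (iid_normal I). z \<in> U} \<in> P.events"
      by (rule measurable_box_open[OF I U(1)]) measurable
  qed
  finally show ?thesis .
qed


text \<open>For \<open>q = emp n x\<close> this is the conditional law behind the critical value;
  for a non-increasing \<open>q = pmf p\<close> and \<open>J\<close> the set of its strict descents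
  it is the limit law of the statistic.\<close>

definition limit_law :: "int \<Rightarrow> int \<Rightarrow> int set \<Rightarrow> (int \<Rightarrow> real) \<Rightarrow> real measure" where
  "limit_law m M J q = distr (iid_normal {m..M}) borel (\<lambda>z. cone_dist m M J (gvec {m..M} q z))"

lemma measurable_cone_dist_gvec:
  assumes "m \<le> M"
  shows "(\<lambda>z. cone_dist m M J (gvec {m..M} q z)) \<in> borel_measurable (iid_normal {m..M})"
  using assms by (intro borel_measurable_cone_dist measurable_gvec)

lemma real_distribution_limit_law: "m \<le> M \<Longrightarrow> real_distribution (limit_law m M J q)"
  unfolding limit_law_def real_distribution_def real_distribution_axioms_def
  by (simp add: prob_space.prob_space_distr[OF prob_space_iid_normal] measurable_cone_dist_gvec)

lemma cdf_limit_law: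
  assumes "m \<le> M"
  shows "cdf (limit_law m M J q) t = measure (iid_normal {m..M}) {z \<in> space (iid_normal {m..M}). cone_dist m M J (gvec {m..M} q z) \<le> t}"
  unfolding limit_law_def cdf_def using measurable_cone_dist_gvec[OF assms]
  by (subst measure_distr) (auto intro!: arg_cong[where f = "measure _"])

lemma crit_value_eq:
  assumes "m \<le> M" and q: "\<forall>j\<in>{m..M}. 0 \<le> emp n x j" "(\<Sum>j\<in>{m..M}. emp n x j) = 1"
  shows "crit_value m M \<alpha> n x J = quantile (limit_law m M J (emp n x)) (1 - \<alpha>)"
proof -
  let ?I = "{m..M}" and ?q = "emp n x"
  have [measurable]: "(\<lambda>z. \<lambda>j\<in>?I. gvec ?I ?q z j) \<in> iid_normal ?I \<rightarrow>\<^sub>M Pi\<^sub>M ?I (\<lambda>_. borel)"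
    by (intro measurable_restrict) measurable
  have [measurable]: "cone_dist m M J \<in> borel_measurable (Pi\<^sub>M ?I (\<lambda>_. borel))"
    by (rule borel_measurable_cone_dist[where f = "\<lambda>v. v"]) (use assms in auto)
  have "Gamma_hat n x = (\<lambda>r s. (if r = s then ?q r else 0) - ?q r * ?q s)"
    by (simp add: fun_eq_iff Gamma_hat_def)
  hence "mv_normal ?I (Gamma_hat n x) = distr (iid_normal ?I) (Pi\<^sub>M ?I (\<lambda>_. borel)) (\<lambda>z. \<lambda>j\<in>?I. gvec ?I ?q z j)"
    using mv_normal_multinomial[of ?I ?q] assms by simp
  moreover have "(\<lambda>g. L2_set (\<lambda>j. blockwise_gren m M J g j - g j) ?I) = cone_dist m M J"
    by (simp add: fun_eq_iff cone_dist_def)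
  ultimately have "distr (mv_normal ?I (Gamma_hat n x)) borel (\<lambda>g. L2_set (\<lambda>j. blockwise_gren m M J g j - g j) ?I)
    = distr (iid_normal ?I) borel (\<lambda>z. cone_dist m M J (\<lambda>j\<in>?I. gvec ?I ?q z j))"
    by (simp add: distr_distr comp_def)
  also have "(\<lambda>z. cone_dist m M J (\<lambda>j\<in>?I. gvec ?I ?q z j)) = (\<lambda>z. cone_dist m M J (gvec ?I ?q z))"
    by (intro ext cone_dist_cong) simp
  finally show ?thesis
    by (simp add: crit_value_def limit_law_def)
qed

lemma limit_law_no_atom:
  assumes "m \<le> M" "0 < t"
  shows "measure (iid_normal {m..M}) {z \<in> space (iid_normal {m..M}). cone_dist m M J (gvec {m..M} q z) = t} = 0"
proof (rule homogeneous_no_atom)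
  fix c :: real and z :: "int \<Rightarrow> real" assume "0 < c"
  have "cone_dist m M J (gvec {m..M} q (\<lambda>i\<in>{m..M}. c * z i)) = cone_dist m M J (\<lambda>j. c * gvec {m..M} q z j)"
    by (intro cone_dist_cong gvec_scale)
  thus "cone_dist m M J (gvec {m..M} q (\<lambda>i\<in>{m..M}. c * z i)) = c * cone_dist m M J (gvec {m..M} q z)"
    using \<open>0 < c\<close> by (simp add: cone_dist_scale)
qed (use assms measurable_cone_dist_gvec in auto)

text \<open>All these laws live on one space, so \<open>q\<close> enters only through the integrand.
  The indicators converge wherever the limiting distance differs from \<open>t\<close>, which fails
  on a null set only as \<open>t > 0\<close>; at 0 there may be an atom.\<close>

lemma cdf_limit_law_tendsto:
  assumes "m \<le> M" "0 < t" and s: "\<And>j. j \<in> {m..M} \<Longrightarrow> (\<lambda>n. s n j) \<longlonglongrightarrow> q j"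
  shows "(\<lambda>n. cdf (limit_law m M J (s n)) t) \<longlonglongrightarrow> cdf (limit_law m M J q) t"
proof -
  let ?I = "{m..M}" and ?N = "iid_normal {m..M}"
  interpret P: prob_space ?N by (rule prob_space_iid_normal)
  let ?T = "\<lambda>q z. cone_dist m M J (gvec ?I q z)"
  note [measurable] = measurable_cone_dist_gvec[OF assms(1)]
  have cdf: "cdf (limit_law m M J q) t = (LINT z|?N. indicator {z \<in> space ?N. ?T q z \<le> t} z)" for q
    unfolding cdf_limit_law[OF assms(1)] by (subst Bochner_Integration.integral_indicator) (auto intro!: arg_cong[where f = "measure _"])
  have conv: "(\<lambda>n. ?T (s n) z) \<longlonglongrightarrow> ?T q z" for z
  proof (rule LIMSEQ_I)
    fix e :: real assume "0 < e"
    obtain d where d: "d > 0" "\<And>w v. (\<forall>i\<in>{m..M}. \<bar>w i - v i\<bar> < d) \<Longrightarrow> \<bar>cone_dist m M J w - cone_dist m M J v\<bar> < e"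
      using cone_dist_near[OF assms(1) \<open>0 < e\<close>] by blast
    have "(\<lambda>n. gvec ?I (s n) z i) \<longlonglongrightarrow> gvec ?I q z i" if "i \<in> ?I" for i
      unfolding gvec_def using that by (intro tendsto_intros s)
    hence "\<forall>\<^sub>F n in sequentially. \<forall>i\<in>?I. \<bar>gvec ?I (s n) z i - gvec ?I q z i\<bar> < d"
      using d(1) by (intro eventually_ball_finite ballI) (auto simp: tendsto_iff dist_real_def)
    then obtain n0 where "\<forall>n\<ge>n0. \<forall>i\<in>?I. \<bar>gvec ?I (s n) z i - gvec ?I q z i\<bar> < d"
      unfolding eventually_sequentially by blast
    hence "\<bar>?T (s n) z - ?T q z\<bar> < e" if "n0 \<le> n" for n
      using that by (intro d(2)) blast
    thus "\<exists>n0. \<forall>n\<ge>n0. norm (?T (s n) z - ?T q z) < e"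
      by auto
  qed
  have "{z \<in> space ?N. ?T q z = t} \<in> null_sets ?N"
    using limit_law_no_atom[OF assms(1,2), of J q] by (auto simp: null_sets_def P.emeasure_eq_measure)
  from AE_not_in[OF this] have "AE z in ?N. ?T q z \<noteq> t"
    using AE_space by eventually_elim auto
  hence "AE z in ?N. (\<lambda>n. indicator {z \<in> space ?N. ?T (s n) z \<le> t} z :: real) \<longlonglongrightarrow> indicator {z \<in> space ?N. ?T q z \<le> t} z"
    using AE_space
  proof eventually_elim
    case (elim z)
    show ?case
    proof (cases "?T q z < t")
      case True
      hence "\<forall>\<^sub>F n in sequentially. ?T (s n) z < t" using conv[of z] by (intro order_tendstoD(2)) auto
      thus ?thesis using True elim(2) by (intro tendsto_eventually) (auto elim!: eventually_mono)
    next
      case False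
      hence "t < ?T q z" using elim(1) by simp
      hence "\<forall>\<^sub>F n in sequentially. t < ?T (s n) z" using conv[of z] by (intro order_tendstoD(1)) auto
      thus ?thesis using \<open>t < ?T q z\<close> elim(2) by (intro tendsto_eventually) (auto elim!: eventually_mono)
    qed
  qed
  hence "(\<lambda>n. LINT z|?N. indicator {z \<in> space ?N. ?T (s n) z \<le> t} z :: real) \<longlonglongrightarrow> (LINT z|?N. indicator {z \<in> space ?N. ?T q z \<le> t} z)"
    by (intro integral_dominated_convergence[where w = "\<lambda>_. 1"]) auto
  thus ?thesis unfolding cdf .
qed

text \<open>On a level set of \<open>p\<close> the entries of \<open>gvec\<close> are a common
  positive multiple of those of \<open>z\<close> minus a common term, so only the order of
  \<open>z\<close> counts. For non-increasing \<open>p\<close> the level sets are the blocks between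
  knots.\<close>

lemma gvec_in_mono_cone_iff:
  assumes p: "p \<in> mono_cone m M {}" "\<And>j. j \<in> {m..M} \<Longrightarrow> 0 < p j"
    and J: "J = {j \<in> {m..M - 1}. p (j + 1) < p j}"
  shows "gvec {m..M} p z \<in> mono_cone m M J \<longleftrightarrow> (\<forall>c\<in>p ` {m..M}. antimono_on {j \<in> {m..M}. p j = c} z)"
proof -
  have eqp: "p (j + 1) = p j" if "j \<in> {m..M - 1} - J" for j
    using that p(1) by (intro antisym) (auto simp: J mono_cone_def not_less)
  have "gvec {m..M} p z (j + 1) \<le> gvec {m..M} p z j \<longleftrightarrow> z (j + 1) \<le> z j" if "j \<in> {m..M - 1} - J" for j
    using p(2)[of j] that unfolding gvec_def eqp[OF that] by simp
  hence "gvec {m..M} p z \<in> mono_cone m M J \<longleftrightarrow> z \<in> mono_cone m M J"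
    by (simp add: mono_cone_def)
  also have "\<dots> \<longleftrightarrow> (\<forall>c\<in>p ` {m..M}. antimono_on {j \<in> {m..M}. p j = c} z)"
  proof
    assume z: "z \<in> mono_cone m M J"
    show "\<forall>c\<in>p ` {m..M}. antimono_on {j \<in> {m..M}. p j = c} z"
    proof
      fix c assume "c \<in> p ` {m..M}"
      then obtain b where b: "b \<in> {m..M}" "p b = c" by blast
      have anti: "p y \<le> p x" if "m \<le> x" "x \<le> y" "y \<le> M" for x y
        using p(1) that by (auto simp: antimono_on_iff_mono_cone[symmetric] monotone_on_def)
      have "{j \<in> {m..M}. p j = c} \<subseteq> knot_block m M J b"
      proof
        fix i assume i: "i \<in> {j \<in> {m..M}. p j = c}"
        have "i \<le> k \<longleftrightarrow> b \<le> k" if k: "k \<in> J" for k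
        proof (rule ccontr)
          assume "\<not> ?thesis"
          \<comment> \<open>A knot between \<open>i\<close> and \<open>b\<close> would be a strict
            descent between two points with the same value of \<open>p\<close>.\<close>
          hence "i \<le> k \<and> k + 1 \<le> b \<or> b \<le> k \<and> k + 1 \<le> i" by auto
          thus False using anti[of i k] anti[of "k + 1" b] anti[of b k] anti[of "k + 1" i] i b k
            by (auto simp: J)
        qed
        thus "i \<in> knot_block m M J b" using i by (simp add: knot_block_def)
      qed
      with mono_cone_antimono_on_knot_block[OF z, of b] show "antimono_on {j \<in> {m..M}. p j = c} z"
        by (rule monotone_on_subset)
    qed
  next
    assume z: "\<forall>c\<in>p ` {m..M}. antimono_on {j \<in> {m..M}. p j = c} z"
    show "z \<in> mono_cone m M J"
      unfolding mono_cone_def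
    proof (intro CollectI ballI)
      fix j assume j: "j \<in> {m..M - 1} - J"
      hence "antimono_on {i \<in> {m..M}. p i = p j} z" using z by auto
      thus "z (j + 1) \<le> z j" using j eqp[OF j] by (auto simp: monotone_on_def)
    qed
  qed
  finally show ?thesis .
qed

lemma limit_law_atom:
  assumes "m \<le> M" and p: "pmf p \<in> mono_cone m M {}" "\<And>j. j \<in> {m..M} \<Longrightarrow> 0 < pmf p j"
    and J: "J = {j \<in> {m..M - 1}. pmf p (j + 1) < pmf p j}"
  shows "measure (iid_normal {m..M}) {z \<in> space (iid_normal {m..M}). cone_dist m M J (gvec {m..M} (pmf p) z) = 0} = 1 - max_level m M p"
proof -
  have "(gvec {m..M} (pmf p) z \<in> mono_cone m M J) = (\<forall>c\<in>pmf p ` {m..M}. antimono_on {j \<in> {m..M}. pmf p j = c} z)" for z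
    using p by (intro gvec_in_mono_cone_iff J)
  note in_cone = this
  have I: "finite {m..M}" "{m..M} \<noteq> {}" using assms(1) by auto
  show ?thesis
    unfolding cone_dist_eq_0_iff max_level_def in_cone prob_iid_normal_antimono_on_blocks[OF I] by simp
qed

text \<open>The purpose is strict increase of the limiting distribution function on the nonnegative
  half-line. One point with distance inside the interval suffices, since its neighbourhoods have
  positive Gaussian mass.\<close>

lemma limit_law_interval_pos:
  assumes "m \<le> M" and p: "\<And>j. j \<in> {m..M} \<Longrightarrow> 0 < p j" "(\<Sum>j\<in>{m..M}. p j) = 1"
    and i: "i \<in> {m..M - 1} - J" and st: "0 \<le> s" "s < t"
  shows "0 < measure (iid_normal {m..M}) {z \<in> space (iid_normal {m..M}). s < cone_dist m M J (gvec {m..M} p z) \<and> cone_dist m M J (gvec {m..M} p z) < t}"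
proof -
  let ?I = "{m..M}"
  \<comment> \<open>An ascent at \<open>i\<close>, hence a vector outside the cone. Its entries sum
    to 0, which places it in the range of \<open>gvec\<close>; \<open>z0\<close> is a
    preimage.\<close>
  define g where "g j = (if j = i + 1 then 1 else if j = i then - 1 else 0 :: real)" for j
  define z0 where "z0 j = g j / sqrt (p j)" for j
  have "(\<Sum>j\<in>?I. g j) = (\<Sum>j\<in>?I. (if j = i + 1 then 1 else 0) - (if j = i then 1 else 0))"
    by (intro sum.cong) (auto simp: g_def)
  also have "\<dots> = 0" using i by (simp add: sum_subtractf)
  finally have "(\<Sum>k\<in>?I. sqrt (p k) * z0 k) = 0"
    using p(1) by (simp add: z0_def less_imp_neq[THEN not_sym] cong: sum.cong_simp)
  hence gz0: "gvec ?I p z0 j = g j" if "j \<in> ?I" for j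
    using p(1)[OF that] by (simp add: gvec_def z0_def)
  define a where "a = cone_dist m M J (gvec ?I p z0)"
  have "g \<notin> mono_cone m M J" using i by (auto simp: mono_cone_def g_def intro!: bexI[of _ i])
  moreover have "a = cone_dist m M J g" unfolding a_def by (intro cone_dist_cong gz0)
  ultimately have a: "0 < a" using cone_dist_eq_0_iff[of m M J g] cone_dist_nonneg[of m M J g] by auto
  \<comment> \<open>By homogeneity the multiple with factor \<open>r\<close> has the midpoint of
    \<open>s\<close> and \<open>t\<close> as its distance.\<close>
  define r where "r = (s + t) / 2 / a"
  have r: "0 < r" using a st by (simp add: r_def)
  have ra: "r * a = (s + t) / 2" using a by (simp add: r_def)
  have "cone_dist m M J (gvec ?I p (\<lambda>j\<in>?I. r * z0 j)) = cone_dist m M J (\<lambda>j. r * gvec ?I p z0 j)"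
    by (intro cone_dist_cong gvec_scale)
  also have "\<dots> = (s + t) / 2" using r ra by (simp add: cone_dist_scale a_def)
  finally have mem: "(\<lambda>j\<in>?I. r * z0 j) \<in> {z. cone_dist m M J (gvec ?I p z) \<in> {s<..<t}}"
    using st by simp
  have "box_open ?I {z. cone_dist m M J (gvec ?I p z) \<in> {s<..<t}}"
    unfolding box_open_def
  proof (rule ballI)
    fix v assume "v \<in> {z. cone_dist m M J (gvec ?I p z) \<in> {s<..<t}}"
    hence v: "s < cone_dist m M J (gvec ?I p v)" "cone_dist m M J (gvec ?I p v) < t" by auto
    define e where "e = min (cone_dist m M J (gvec ?I p v) - s) (t - cone_dist m M J (gvec ?I p v))"
    have e: "e > 0" using v by (simp add: e_def)
    obtain d where d: "d > 0" "\<And>w v. (\<forall>i\<in>{m..M}. \<bar>w i - v i\<bar> < d) \<Longrightarrow> \<bar>cone_dist m M J w - cone_dist m M J v\<bar> < e"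
      using cone_dist_near[OF assms(1) e] by blast
    have p1: "p j \<le> 1" if "j \<in> ?I" for j
      using member_le_sum[OF that, of p] p(1) p(2) by (force intro: less_imp_le)
    \<comment> \<open>\<open>K\<close> is a Lipschitz constant of \<open>gvec\<close> in the maximum
      norm: 1 from the coordinate itself and 1 from each term of the sum.\<close>
    define K where "K = 1 + real (card ?I)"
    have K: "K > 0" by (simp add: K_def)
    have lip_aux: "\<bar>c * x\<bar> \<le> b" if "0 \<le> c" "c \<le> 1" "\<bar>x\<bar> < b" for b c x :: real
      using mult_mono[of c 1 "\<bar>x\<bar>" b] that by (simp add: abs_mult)
    have lip: "\<bar>gvec ?I p w j - gvec ?I p v j\<bar> < d" if w: "\<forall>i\<in>?I. \<bar>w i - v i\<bar> < d / (2 * K)" and j: "j \<in> ?I" for w j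
    proof -
      have sq: "0 \<le> sqrt (p k)" "sqrt (p k) \<le> 1" if "k \<in> ?I" for k using p(1)[OF that] p1[OF that] by simp_all
      have trm: "\<bar>sqrt (p k) * (w k - v k)\<bar> \<le> d / (2 * K)" if "k \<in> ?I" for k
        using sq[OF that] bspec[OF w that] by (rule lip_aux)
      have "\<bar>\<Sum>k\<in>?I. sqrt (p k) * (w k - v k)\<bar> \<le> (\<Sum>k\<in>?I. \<bar>sqrt (p k) * (w k - v k)\<bar>)" by (rule sum_abs)
      also have "\<dots> \<le> real (card ?I) * (d / (2 * K))" using trm by (intro sum_bounded_above) auto
      finally have S: "\<bar>\<Sum>k\<in>?I. sqrt (p k) * (w k - v k)\<bar> \<le> real (card ?I) * (d / (2 * K))" .
      have "\<bar>p j * (\<Sum>k\<in>?I. sqrt (p k) * (w k - v k))\<bar> \<le> 1 * (real (card ?I) * (d / (2 * K)))"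
        unfolding abs_mult using p1[OF j] p(1)[OF j] S by (intro mult_mono) auto
      moreover have "gvec ?I p w j - gvec ?I p v j = sqrt (p j) * (w j - v j) - p j * (\<Sum>k\<in>?I. sqrt (p k) * (w k - v k))"
        by (simp add: gvec_def right_diff_distrib sum_subtractf)
      ultimately have "\<bar>gvec ?I p w j - gvec ?I p v j\<bar> \<le> d / (2 * K) + real (card ?I) * (d / (2 * K))"
        using trm[OF j] by linarith
      also have "\<dots> = K * (d / (2 * K))" by (simp only: K_def distrib_right mult_1)
      also have "\<dots> = d / 2" using K by simp
      finally show ?thesis using d(1) by linarith
    qed
    show "\<exists>e>0. \<forall>w. (\<forall>i\<in>?I. \<bar>w i - v i\<bar> < e) \<longrightarrow> w \<in> {z. cone_dist m M J (gvec ?I p z) \<in> {s<..<t}}"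
    proof (intro exI[of _ "d / (2 * K)"] conjI allI impI)
      fix w assume "\<forall>i\<in>?I. \<bar>w i - v i\<bar> < d / (2 * K)"
      hence "\<bar>cone_dist m M J (gvec ?I p w) - cone_dist m M J (gvec ?I p v)\<bar> < e"
        using lip by (intro d(2)) blast
      thus "w \<in> {z. cone_dist m M J (gvec ?I p z) \<in> {s<..<t}}" by (auto simp: e_def)
    qed (use d K in simp)
  qed
  from iid_normal_box_open_pos[OF _ _ this mem] assms(1) show ?thesis by simp
qed

text \<open>One bound serves all \<open>J\<close> and \<open>q\<close>: under the alternative
  nothing is known about the estimated knots, yet the critical value must stay bounded.\<close>

lemma limit_law_uniformly_tight:
  assumes "m \<le> M" "\<beta> < 1"
  obtains K where "0 < K" "\<And>J q. (\<And>j. j \<in> {m..M} \<Longrightarrow> 0 \<le> q j \<and> q j \<le> 1) \<Longrightarrow> \<beta> \<le> cdf (limit_law m M J q) K"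
proof -
  let ?I = "{m..M}" and ?N = "iid_normal {m..M}"
  interpret P: prob_space ?N by (rule prob_space_iid_normal)
  define H where "H z = (1 + real (card ?I)) * (\<Sum>k\<in>?I. \<bar>z k\<bar>)" for z :: "int \<Rightarrow> real"
  have [measurable]: "H \<in> borel_measurable ?N" unfolding H_def by measurable
  interpret D: real_distribution "distr ?N borel H"
    by (simp add: real_distribution_def real_distribution_axioms_def P.prob_space_distr)
  have "\<forall>\<^sub>F K in at_top. \<beta> < cdf (distr ?N borel H) K"
    using D.cdf_lim_at_top_prob assms(2) by (rule order_tendstoD)
  hence "\<forall>\<^sub>F K in at_top. 0 < K \<and> \<beta> < cdf (distr ?N borel H) K"
    using eventually_gt_at_top[of 0] by eventually_elim auto
  then obtain K where K: "0 < K" "\<beta> < cdf (distr ?N borel H) K"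
    by (auto dest: eventually_happens)
  have bound: "cone_dist m M J (gvec ?I q z) \<le> H z" if q: "\<And>j. j \<in> ?I \<Longrightarrow> 0 \<le> q j \<and> q j \<le> 1" for J q z
  proof -
    have sq: "0 \<le> sqrt (q k)" "sqrt (q k) \<le> 1" if "k \<in> ?I" for k using q[OF that] by simp_all
    have trm: "\<bar>sqrt (q k) * z k\<bar> \<le> \<bar>z k\<bar>" if "k \<in> ?I" for k
      using mult_mono[of "sqrt (q k)" 1 "\<bar>z k\<bar>" "\<bar>z k\<bar>"] sq[OF that] by (simp add: abs_mult)
    have S: "\<bar>\<Sum>k\<in>?I. sqrt (q k) * z k\<bar> \<le> (\<Sum>k\<in>?I. \<bar>z k\<bar>)"
      using trm by (intro order.trans[OF sum_abs] sum_mono)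
    have g: "\<bar>gvec ?I q z j\<bar> \<le> \<bar>z j\<bar> + (\<Sum>k\<in>?I. \<bar>z k\<bar>)" if j: "j \<in> ?I" for j
    proof -
      have "\<bar>q j * (\<Sum>k\<in>?I. sqrt (q k) * z k)\<bar> \<le> 1 * (\<Sum>k\<in>?I. \<bar>z k\<bar>)"
        unfolding abs_mult using q[OF j] S by (intro mult_mono) auto
      thus ?thesis unfolding gvec_def using trm[OF j] by linarith
    qed
    have "cone_dist m M J (gvec ?I q z) \<le> (\<Sum>j\<in>?I. \<bar>gvec ?I q z j\<bar>)"
      by (rule order.trans[OF cone_dist_le_norm L2_set_le_sum_abs])
    also have "\<dots> \<le> (\<Sum>j\<in>?I. \<bar>z j\<bar> + (\<Sum>k\<in>?I. \<bar>z k\<bar>))" by (intro sum_mono g)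
    also have "\<dots> = H z" by (simp add: sum.distrib H_def distrib_right del: card_atLeastAtMost_int)
    finally show ?thesis .
  qed
  have "\<beta> \<le> cdf (limit_law m M J q) K" if q: "\<And>j. j \<in> ?I \<Longrightarrow> 0 \<le> q j \<and> q j \<le> 1" for J q
  proof -
    note [measurable] = measurable_cone_dist_gvec[OF assms(1), of J q]
    have "cdf (distr ?N borel H) K = measure ?N {z \<in> space ?N. H z \<le> K}"
      unfolding cdf_def by (subst measure_distr) (auto intro!: arg_cong[where f = "measure _"])
    also have "\<dots> \<le> measure ?N {z \<in> space ?N. cone_dist m M J (gvec ?I q z) \<le> K}"
    proof (rule P.finite_measure_mono)
      show "{z \<in> space ?N. H z \<le> K} \<subseteq> {z \<in> space ?N. cone_dist m M J (gvec ?I q z) \<le> K}"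
        using bound[of q, OF q] by (auto intro: order.trans)
    qed measurable
    finally show ?thesis using K(2) unfolding cdf_limit_law[OF assms(1)] by linarith
  qed
  with K(1) show thesis by (rule that)
qed

section \<open>Quantiles\<close>

text \<open>On the reals \<open>Inf\<close> is informative only for a nonempty set with a lower
  bound: \<open>0 < \<beta>\<close> supplies the lower bound here, \<open>\<beta> < 1\<close> the
  nonemptiness in \<open>quantile_ge\<close>.\<close>

lemma quantile_le:
  assumes "real_distribution D" "0 < \<beta>" "\<beta> \<le> cdf D t"
  shows "quantile D \<beta> \<le> t"
proof -
  interpret real_distribution D by fact
  have "\<forall>\<^sub>F s in at_bot. cdf D s < \<beta>"
    using cdf_lim_at_bot assms(2) by (rule order_tendstoD)
  then obtain b where b: "\<And>s. s \<le> b \<Longrightarrow> cdf D s < \<beta>"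
    unfolding eventually_at_bot_linorder by blast
  have "bdd_below {t. \<beta> \<le> cdf D t}"
    by (rule bdd_belowI[of _ b]) (use b in \<open>force simp: not_less[symmetric]\<close>)
  thus ?thesis
    unfolding quantile_def using assms(3) by (intro cInf_lower) auto
qed

lemma quantile_ge:
  assumes "real_distribution D" "\<beta> < 1" "cdf D t < \<beta>"
  shows "t \<le> quantile D \<beta>"
proof -
  interpret real_distribution D by fact
  have "\<forall>\<^sub>F s in at_top. \<beta> < cdf D s"
    using cdf_lim_at_top_prob assms(2) by (rule order_tendstoD)
  hence "{t. \<beta> \<le> cdf D t} \<noteq> {}"
    by (auto dest!: eventually_happens intro: less_imp_le)
  moreover have "t \<le> s" if "\<beta> \<le> cdf D s" for s
    using that assms(3) cdf_nondecreasing[of s t] by (cases "t \<le> s") auto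
  ultimately show ?thesis
    unfolding quantile_def by (intro cInf_greatest) auto
qed

text \<open>By right-continuity the infimum defining the quantile belongs to the set.\<close>

lemma cdf_quantile_ge:
  assumes "real_distribution D" "\<beta> < 1" "0 < \<beta>"
  shows "\<beta> \<le> cdf D (quantile D \<beta>)"
proof (rule ccontr)
  interpret real_distribution D by fact
  assume "\<not> ?thesis"
  hence "\<forall>\<^sub>F t in at_right (quantile D \<beta>). cdf D t < \<beta>"
    using cdf_is_right_cont[of "quantile D \<beta>"] by (intro order_tendstoD) (auto simp: continuous_within)
  then obtain b where b: "quantile D \<beta> < b" "\<And>t. quantile D \<beta> < t \<Longrightarrow> t < b \<Longrightarrow> cdf D t < \<beta>"
    unfolding eventually_at_right_field by blast
  obtain t where t: "quantile D \<beta> < t" "t < b" using b(1) dense by blast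
  have "t \<le> quantile D \<beta>" using assms b(2)[OF t] by (intro quantile_ge) auto
  thus False using t by simp
qed

lemma cdf_less_of_less_quantile:
  assumes "real_distribution D" "0 < \<beta>" "t < quantile D \<beta>"
  shows "cdf D t < \<beta>"
  using quantile_le[OF assms(1,2), of t] assms(3) by (cases "cdf D t < \<beta>") auto

lemma filterlim_std_normal_quantile:
  "filterlim (\<lambda>n. quantile std_normal_distribution (1 - 1 / real n)) at_top sequentially"
  unfolding filterlim_at_top
proof
  fix K :: real
  interpret real_distribution std_normal_distribution by (rule real_dist_normal_dist)
  have "measure std_normal_distribution {..K} + measure std_normal_distribution {K<..<K + 1} = measure std_normal_distribution ({..K} \<union> {K<..<K + 1})"
    by (intro finite_measure_Union[symmetric]) auto
  also have "\<dots> \<le> 1" by (rule prob_le_1)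
  finally have "cdf std_normal_distribution K < 1"
    using std_normal_interval_pos[of K "K + 1"] by (simp add: cdf_def)
  moreover have "(\<lambda>n. 1 - 1 / real n) \<longlonglongrightarrow> 1" by real_asymp
  ultimately have "\<forall>\<^sub>F n in sequentially. cdf std_normal_distribution K < 1 - 1 / real n"
    by (intro order_tendstoD) auto
  thus "\<forall>\<^sub>F n in sequentially. K \<le> quantile std_normal_distribution (1 - 1 / real n)"
    using eventually_gt_at_top[of 0]
  proof eventually_elim
    case (elim n)
    thus ?case by (intro quantile_ge real_dist_normal_dist) auto
  qed
qed

text \<open>Markov's inequality for the fourth moment, which equals 3. The second moment would only give
  the bound \<open>sqrt n\<close>, which is not of smaller order than \<open>sqrt n\<close>.\<close>

lemma std_normal_quantile_le:
  assumes "2 \<le> n"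
  shows "quantile std_normal_distribution (1 - 1 / real n) \<le> root 4 (3 * real n)"
proof (rule quantile_le[OF real_dist_normal_dist])
  interpret real_distribution std_normal_distribution by (rule real_dist_normal_dist)
  define t where "t = root 4 (3 * real n)"
  have t: "0 < t" and t4: "t ^ 4 = 3 * real n" using assms by (auto simp: t_def)
  have m4: "(LINT x|std_normal_distribution. x ^ 4) = 3"
    using std_normal_distribution_even_moments(1)[of 2] by (simp add: fact_numeral)
  have int4: "integrable std_normal_distribution (\<lambda>x. x ^ 4)"
    using integrable_std_normal_distribution_moment[of 4] by simp
  have "prob {t<..} \<le> prob {x \<in> space std_normal_distribution. t ^ 4 \<le> x ^ 4}"
    using t by (intro finite_measure_mono) (auto intro!: power_mono)
  also have "\<dots> \<le> (LINT x|std_normal_distribution. x ^ 4) / t ^ 4"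
    using int4 t by (intro integral_Markov_inequality_measure[where A = "{}"]) auto
  also have "\<dots> = 1 / real n" using assms by (simp add: m4 t4)
  finally have "prob {t<..} \<le> 1 / real n" .
  moreover have "prob {..t} = 1 - prob {t<..}"
    using prob_compl[of "{t<..}"] by (simp add: Compl_eq_Diff_UNIV[symmetric])
  ultimately show "1 - 1 / real n \<le> cdf std_normal_distribution (root 4 (3 * real n))"
    by (simp add: cdf_def t_def)
qed (use assms in auto)

lemma tendsto_std_normal_quantile_over_sqrt:
  "(\<lambda>n. quantile std_normal_distribution (1 - 1 / real n) / sqrt (real n)) \<longlonglongrightarrow> 0"
proof (rule tendsto_sandwich[where f = "\<lambda>_. 0" and h = "\<lambda>n. root 4 (3 * real n) / sqrt (real n)"])
  show "(\<lambda>n. root 4 (3 * real n) / sqrt (real n)) \<longlonglongrightarrow> 0" by real_asymp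
  show "\<forall>\<^sub>F n in sequentially. quantile std_normal_distribution (1 - 1 / real n) / sqrt (real n) \<le> root 4 (3 * real n) / sqrt (real n)"
    using eventually_ge_at_top[of 2] by eventually_elim (auto intro!: divide_right_mono std_normal_quantile_le)
  have "\<forall>\<^sub>F n in sequentially. 0 \<le> quantile std_normal_distribution (1 - 1 / real n)"
    using filterlim_std_normal_quantile by (auto simp: filterlim_at_top)
  thus "\<forall>\<^sub>F n in sequentially. 0 \<le> quantile std_normal_distribution (1 - 1 / real n) / sqrt (real n)"
    by eventually_elim auto
qed auto

lemma cdf_limit_law_neg:
  assumes "m \<le> M" "t < 0"
  shows "cdf (limit_law m M J q) t = 0"
proof -
  have empty: "{z \<in> space (iid_normal {m..M}). cone_dist m M J (gvec {m..M} q z) \<le> t} = {}"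
    using assms(2) cone_dist_nonneg[of m M J] by (auto simp: not_le intro: less_le_trans)
  show ?thesis unfolding cdf_limit_law[OF assms(1)] empty by simp
qed

lemma quantile_limit_law_nonneg:
  assumes "m \<le> M" "0 < \<beta>" "\<beta> < 1"
  shows "0 \<le> quantile (limit_law m M J q) \<beta>"
proof (rule dense_le)
  fix t :: real assume "t < 0"
  thus "t \<le> quantile (limit_law m M J q) \<beta>"
    using assms by (intro quantile_ge real_distribution_limit_law) (auto simp: cdf_limit_law_neg)
qed

text \<open>Limit theorems along sequences, such as dominated convergence, become statements about a
  fixed neighbourhood; otherwise violating points at distance below 1/(n+1) would form a sequence
  converging to \<open>q\<close>. In this form they apply to the random vector
  \<open>emp n x\<close> on the event that it is close to \<open>pmf p\<close>.\<close>

lemma eventually_sequences_imp_nhds: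
  fixes q :: "'i \<Rightarrow> real"
  assumes "\<And>s. (\<And>j. j \<in> I \<Longrightarrow> (\<lambda>n. s n j) \<longlonglongrightarrow> q j) \<Longrightarrow> \<forall>\<^sub>F n in sequentially. P (s n)"
  obtains d where "0 < d" "\<And>q'. (\<forall>j\<in>I. \<bar>q' j - q j\<bar> < d) \<Longrightarrow> P q'"
proof (rule ccontr)
  assume *: "\<not> thesis"
  have "\<exists>q'. (\<forall>j\<in>I. \<bar>q' j - q j\<bar> < 1 / real (Suc n)) \<and> \<not> P q'" for n
    using that[of "1 / real (Suc n)"] * by auto
  then obtain s where s: "\<And>n. \<forall>j\<in>I. \<bar>s n j - q j\<bar> < 1 / real (Suc n)" "\<And>n. \<not> P (s n)" by metis
  have "(\<lambda>n. s n j) \<longlonglongrightarrow> q j" if "j \<in> I" for j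
  proof (rule LIMSEQ_I)
    fix e :: real assume "0 < e"
    then obtain n0 where n0: "1 / real (Suc n0) < e" using nat_approx_posE by blast
    have "norm (s n j - q j) < e" if "n0 \<le> n" for n
    proof -
      have "1 / real (Suc n) \<le> 1 / real (Suc n0)" using that by (simp add: frac_le)
      thus ?thesis using bspec[OF s(1)[of n] \<open>j \<in> I\<close>] n0 by simp
    qed
    thus "\<exists>n0. \<forall>n\<ge>n0. norm (s n j - q j) < e" by blast
  qed
  hence "\<forall>\<^sub>F n in sequentially. P (s n)" by (rule assms)
  with s(2) show False by simp
qed

lemma cdf_limit_law_strict_mono:
  assumes "m \<le> M" and p: "\<And>j. j \<in> {m..M} \<Longrightarrow> 0 < p j" "(\<Sum>j\<in>{m..M}. p j) = 1"
    and i: "i \<in> {m..M - 1} - J" and st: "0 \<le> s" "s < t"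
  shows "cdf (limit_law m M J p) s < cdf (limit_law m M J p) t"
proof -
  let ?N = "iid_normal {m..M}" and ?T = "\<lambda>z. cone_dist m M J (gvec {m..M} p z)"
  interpret P: prob_space ?N by (rule prob_space_iid_normal)
  note [measurable] = measurable_cone_dist_gvec[OF assms(1)]
  have "cdf (limit_law m M J p) s + 0 < measure ?N {z \<in> space ?N. ?T z \<le> s} + measure ?N {z \<in> space ?N. s < ?T z \<and> ?T z < t}"
    unfolding cdf_limit_law[OF assms(1)] using assms by (intro add_le_less_mono limit_law_interval_pos) auto
  also have "\<dots> = measure ?N ({z \<in> space ?N. ?T z \<le> s} \<union> {z \<in> space ?N. s < ?T z \<and> ?T z < t})"
    by (intro P.finite_measure_Union[symmetric]) auto
  also have "\<dots> \<le> cdf (limit_law m M J p) t"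
    unfolding cdf_limit_law[OF assms(1)] using st by (intro P.finite_measure_mono) auto
  finally show ?thesis by simp
qed

text \<open>The limiting distribution function is strictly above \<open>\<beta>\<close> to the right
  of the quantile, by the strict increase that \<open>i\<close> provides, and below
  \<open>\<beta>\<close> to its left. Both inequalities survive convergence at a fixed positive
  point.\<close>

lemma quantile_limit_law_near:
  assumes "m \<le> M" and p: "\<And>j. j \<in> {m..M} \<Longrightarrow> 0 < p j" "(\<Sum>j\<in>{m..M}. p j) = 1"
    and i: "i \<in> {m..M - 1} - J" and \<beta>: "0 < \<beta>" "\<beta> < 1" and e: "0 < e"
  obtains d where "0 < d" "\<And>q. (\<forall>j\<in>{m..M}. \<bar>q j - p j\<bar> < d) \<Longrightarrow>
    \<bar>quantile (limit_law m M J q) \<beta> - quantile (limit_law m M J p) \<beta>\<bar> \<le> e"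
proof -
  let ?t = "quantile (limit_law m M J p) \<beta>"
  have t: "0 \<le> ?t" using assms by (intro quantile_limit_law_nonneg)
  have rd: "real_distribution (limit_law m M J q)" for q by (rule real_distribution_limit_law[OF assms(1)])
  have "\<forall>\<^sub>F n in sequentially. \<bar>quantile (limit_law m M J (s n)) \<beta> - ?t\<bar> \<le> e"
    if s: "\<And>j. j \<in> {m..M} \<Longrightarrow> (\<lambda>n. s n j) \<longlonglongrightarrow> p j" for s
  proof -
    have "\<beta> \<le> cdf (limit_law m M J p) ?t" using \<beta> by (intro cdf_quantile_ge rd)
    also have "\<dots> < cdf (limit_law m M J p) (?t + e)"
      using e t by (intro cdf_limit_law_strict_mono[OF assms(1) p i]) auto
    finally have "\<forall>\<^sub>F n in sequentially. \<beta> < cdf (limit_law m M J (s n)) (?t + e)"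
      using e t by (intro order_tendstoD(1)[OF cdf_limit_law_tendsto[OF assms(1) _ s]]) auto
    hence up: "\<forall>\<^sub>F n in sequentially. quantile (limit_law m M J (s n)) \<beta> \<le> ?t + e"
      by eventually_elim (use \<beta> in \<open>auto intro!: quantile_le rd\<close>)
    have low: "\<forall>\<^sub>F n in sequentially. ?t - e \<le> quantile (limit_law m M J (s n)) \<beta>"
    \<comment> \<open>\<open>cdf_limit_law_tendsto\<close> speaks about positive points only. If
      \<open>?t - e\<close> is not positive, nonnegativity of the quantiles is enough.\<close>
    proof (cases "0 < ?t - e")
      case True
      have "cdf (limit_law m M J p) (?t - e) < \<beta>"
        using \<beta> e by (intro cdf_less_of_less_quantile rd) auto
      hence "\<forall>\<^sub>F n in sequentially. cdf (limit_law m M J (s n)) (?t - e) < \<beta>"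
        by (intro order_tendstoD(2)[OF cdf_limit_law_tendsto[OF assms(1) True s]]) auto
      thus ?thesis
        by eventually_elim (use \<beta> in \<open>auto intro!: quantile_ge rd\<close>)
    next
      case False
      thus ?thesis
        using quantile_limit_law_nonneg[OF assms(1) \<beta>, of J] by (intro always_eventually allI) (meson not_less order_trans)
    qed
    from up low show ?thesis by eventually_elim auto
  qed
  from eventually_sequences_imp_nhds[where P = "\<lambda>q. \<bar>quantile (limit_law m M J q) \<beta> - ?t\<bar> \<le> e", OF this] that
  show thesis by blast
qed

lemma isCont_cdf_limit_law:
  assumes "m \<le> M" "0 < t"
  shows "isCont (cdf (limit_law m M J q)) t"
proof -
  interpret real_distribution "limit_law m M J q" by (rule real_distribution_limit_law[OF assms(1)])
  have "measure (limit_law m M J q) {t} = measure (iid_normal {m..M}) {z \<in> space (iid_normal {m..M}). cone_dist m M J (gvec {m..M} q z) = t}"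
    unfolding limit_law_def using measurable_cone_dist_gvec[OF assms(1)]
    by (subst measure_distr) (auto intro!: arg_cong[where f = "measure _"])
  thus ?thesis using limit_law_no_atom[OF assms] by (simp add: isCont_cdf)
qed

text \<open>Equality can fail only through a jump at the quantile, and positive points carry no
  atom.\<close>

lemma cdf_limit_law_quantile:
  assumes "m \<le> M" and \<beta>: "0 < \<beta>" "\<beta> < 1" and pos: "0 < quantile (limit_law m M J q) \<beta>"
  shows "cdf (limit_law m M J q) (quantile (limit_law m M J q) \<beta>) = \<beta>"
proof (rule antisym)
  let ?D = "limit_law m M J q"
  have rd: "real_distribution ?D" by (rule real_distribution_limit_law[OF assms(1)])
  show "\<beta> \<le> cdf ?D (quantile ?D \<beta>)" using \<beta> by (intro cdf_quantile_ge rd)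
  have "(cdf ?D \<longlongrightarrow> cdf ?D (quantile ?D \<beta>)) (at_left (quantile ?D \<beta>))"
    using isCont_cdf_limit_law[OF assms(1) pos] by (simp add: isCont_def filterlim_at_split)
  moreover have "\<forall>\<^sub>F t in at_left (quantile ?D \<beta>). cdf ?D t \<le> \<beta>"
    using \<beta> by (auto simp: eventually_at_left_field intro!: exI[of _ "quantile ?D \<beta> - 1"] less_imp_le cdf_less_of_less_quantile[OF rd])
  ultimately show "cdf ?D (quantile ?D \<beta>) \<le> \<beta>"
    by (rule tendsto_upperbound) simp
qed

section \<open>Asymptotics of the test\<close>

text \<open>Serves to shift the numbering: the observations are indexed from 1, the summands of the
  central limit theorem from 0.\<close>

lemma (in prob_space) indep_vars_reindex_inj:
  assumes X: "indep_vars M' X I" and f: "inj_on f J" "f ` J \<subseteq> I"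
  shows "indep_vars (\<lambda>j. M' (f j)) (\<lambda>j. X (f j)) J"
proof -
  have ind: "indep_sets (\<lambda>i. {X i -` A \<inter> space M |A. A \<in> sets (M' i)}) I" (is "indep_sets ?F I")
    using X by (simp add: indep_vars_def2)
  have "indep_sets (\<lambda>j. ?F (f j)) J"
  proof (rule indep_setsI)
    show "?F (f j) \<subseteq> events" if "j \<in> J" for j
      using ind f(2) that unfolding indep_sets_def by blast
    fix A K assume K: "K \<noteq> {}" "K \<subseteq> J" "finite K" "\<forall>j\<in>K. A j \<in> ?F (f j)"
    have inj: "inj_on f K" using f(1) K(2) by (rule inj_on_subset)
    define g where "g = inv_into K f"
    have g: "g (f j) = j" if "j \<in> K" for j using inj that by (simp add: g_def)
    have "prob (\<Inter>i\<in>f ` K. A (g i)) = (\<Prod>i\<in>f ` K. prob (A (g i)))"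
    proof (rule indep_setsD[OF ind])
      show "f ` K \<subseteq> I" using f(2) K(2) by blast
      show "\<forall>i\<in>f ` K. A (g i) \<in> ?F i" using K(4) g by simp
    qed (use K in auto)
    also have "(\<Inter>i\<in>f ` K. A (g i)) = (\<Inter>j\<in>K. A j)" using g by auto
    also have "(\<Prod>i\<in>f ` K. prob (A (g i))) = (\<Prod>j\<in>K. prob (A j))"
      using inj g by (simp add: prod.reindex)
    finally show "prob (\<Inter>j\<in>K. A j) = (\<Prod>j\<in>K. prob (A j))" .
  qed
  thus ?thesis
    using X f(2) unfolding indep_vars_def2 by auto
qed

section \<open>Dependence on the first n observations\<close>

lemma emp_restrict: "emp n (restrict x {1..n}) = emp n x"
  by (auto simp: emp_def fun_eq_iff intro!: sum.cong)

lemma S1_hat_restrict: "S1_hat n (restrict x {1..n}) = S1_hat n x"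
  by (simp add: S1_hat_def)

lemma J0_hat_restrict: "J0_hat n (restrict x {1..n}) = J0_hat n x"
  unfolding J0_hat_def I0_hat_def sigma_hat_def emp_restrict S1_hat_restrict ..

lemma test_stat_restrict: "test_stat m M n (restrict x {1..n}) = test_stat m M n x"
  unfolding test_stat_def emp_restrict ..

lemma rejects_restrict: "rejects m M \<alpha> n (restrict x {1..n}) = rejects m M \<alpha> n x"
proof -
  have "Gamma_hat n (restrict x {1..n}) = Gamma_hat n x"
    by (intro ext) (simp only: Gamma_hat_def emp_restrict)
  thus ?thesis
    unfolding rejects_def crit_value_def J0_hat_restrict test_stat_restrict by simp
qed

locale multinomial_sample = prob_space \<Omega> for \<Omega> :: "'w measure" +
  fixes X :: "nat \<Rightarrow> 'w \<Rightarrow> int" and p :: "int pmf" and m M :: int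
  assumes less: "m < M" and support: "set_pmf p = {m..M}"
    and indep: "indep_vars (\<lambda>_. count_space UNIV) X {1..}"
    and law: "\<And>i. i \<ge> 1 \<Longrightarrow> distr \<Omega> (count_space UNIV) (X i) = measure_pmf p"
begin

abbreviation I :: "int set" where "I \<equiv> {m..M}"

abbreviation sample :: "'w \<Rightarrow> nat \<Rightarrow> int" where "sample \<omega> \<equiv> \<lambda>i. X i \<omega>"

definition scaled :: "nat \<Rightarrow> (nat \<Rightarrow> int) \<Rightarrow> int \<Rightarrow> real" where
  "scaled n x j = sqrt (real n) * (emp n x j - pmf p j)"

lemma scaled_restrict: "scaled n (restrict x {1..n}) = scaled n x"
  by (intro ext) (simp only: scaled_def emp_restrict)

lemma le: "m \<le> M" and I: "finite I" "I \<noteq> {}"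
  using less by auto

lemma measurable_X [measurable]: "i \<ge> 1 \<Longrightarrow> X i \<in> \<Omega> \<rightarrow>\<^sub>M count_space UNIV"
  using indep by (auto simp: indep_vars_def)

text \<open>A finite product of countable discrete spaces is discrete, so any predicate on the first
  \<open>n\<close> observations is measurable, including those defined through
  \<open>arg_min\<close> and \<open>quantile\<close>.\<close>

lemma events_sample:
  assumes "\<And>x. Q (restrict x {1..n}) = Q x"
  shows "{\<omega> \<in> space \<Omega>. Q (sample \<omega>)} \<in> events"
proof -
  have "(\<lambda>\<omega>. restrict (sample \<omega>) {1..n}) \<in> \<Omega> \<rightarrow>\<^sub>M Pi\<^sub>M {1..n} (\<lambda>_. count_space UNIV)"
    by (intro measurable_restrict measurable_X) auto
  also have "Pi\<^sub>M {1..n} (\<lambda>_. count_space UNIV :: int measure) = count_space (Pi\<^sub>E {1..n} (\<lambda>_. UNIV))"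
    by (rule count_space_PiM_finite) auto
  finally have meas: "(\<lambda>\<omega>. restrict (sample \<omega>) {1..n}) \<in> \<Omega> \<rightarrow>\<^sub>M count_space (Pi\<^sub>E {1..n} (\<lambda>_. UNIV))" .
  have "(\<lambda>\<omega>. restrict (sample \<omega>) {1..n}) -` {y \<in> Pi\<^sub>E {1..n} (\<lambda>_. UNIV). Q y} \<inter> space \<Omega> \<in> events"
    by (rule measurable_sets[OF meas]) auto
  also have "(\<lambda>\<omega>. restrict (sample \<omega>) {1..n}) -` {y \<in> Pi\<^sub>E {1..n} (\<lambda>_. UNIV). Q y} \<inter> space \<Omega>
    = {\<omega> \<in> space \<Omega>. Q (restrict (sample \<omega>) {1..n})}" by auto
  finally show ?thesis unfolding assms .
qed

lemma pmf_pos: "j \<in> I \<Longrightarrow> 0 < pmf p j"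
  using support by (simp add: pmf_positive)

lemma sum_pmf: "(\<Sum>j\<in>I. pmf p j) = 1"
  using I support by (intro sum_pmf_eq_1) auto

lemma AE_support: "i \<ge> 1 \<Longrightarrow> AE \<omega> in \<Omega>. X i \<omega> \<in> I"
proof -
  assume i: "i \<ge> 1"
  have "AE x in distr \<Omega> (count_space UNIV) (X i). x \<in> I"
    unfolding law[OF i] by (simp add: AE_measure_pmf_iff support)
  thus ?thesis using i by (subst (asm) AE_distr_iff) auto
qed

lemma integral_X:
  fixes h :: "int \<Rightarrow> real"
  assumes "i \<ge> 1"
  shows "expectation (\<lambda>\<omega>. h (X i \<omega>)) = (\<Sum>j\<in>I. h j * pmf p j)"
proof -
  have "expectation (\<lambda>\<omega>. h (X i \<omega>)) = (LINT x|distr \<Omega> (count_space UNIV) (X i). h x)"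
    using assms by (intro integral_distr[symmetric]) auto
  also have "\<dots> = (\<Sum>j\<in>I. h j * pmf p j)"
    unfolding law[OF assms] using I support by (intro integral_measure_pmf_real) auto
  finally show ?thesis .
qed

lemma sum_scaled:
  assumes "n \<ge> 1"
  shows "(\<Sum>j\<in>I. a j * scaled n x j) = (\<Sum>i<n. (\<Sum>j\<in>I. a j * of_bool (x (Suc i) = j)) - (\<Sum>j\<in>I. a j * pmf p j)) / sqrt (real n)"
proof -
  let ?mu = "\<Sum>j\<in>I. a j * pmf p j"
  have "(\<Sum>j\<in>I. a j * emp n x j) = (\<Sum>j\<in>I. \<Sum>i=1..n. a j * of_bool (x i = j)) / real n"
  proof -
    have "a j * emp n x j = (\<Sum>i=1..n. a j * of_bool (x i = j)) / real n" for j
      by (simp only: emp_def times_divide_eq_right sum_distrib_left)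
    thus ?thesis by (simp only: sum_divide_distrib)
  qed
  also have "(\<Sum>j\<in>I. \<Sum>i=1..n. a j * of_bool (x i = j)) = (\<Sum>i=1..n. \<Sum>j\<in>I. a j * of_bool (x i = j))"
    by (rule sum.swap)
  also have "\<dots> = (\<Sum>i<n. \<Sum>j\<in>I. a j * of_bool (x (Suc i) = j))"
    by (rule sum.reindex_bij_witness[of _ Suc "\<lambda>i. i - 1"]) auto
  finally have 1: "(\<Sum>j\<in>I. a j * emp n x j) = (\<Sum>i<n. \<Sum>j\<in>I. a j * of_bool (x (Suc i) = j)) / real n" .
  have "(\<Sum>j\<in>I. a j * scaled n x j) = sqrt (real n) * ((\<Sum>j\<in>I. a j * emp n x j) - ?mu)"
    by (simp add: scaled_def sum_distrib_left sum_subtractf algebra_simps)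
  also have "\<dots> = (\<Sum>i<n. (\<Sum>j\<in>I. a j * of_bool (x (Suc i) = j)) - ?mu) * (sqrt (real n) / real n)"
    using assms unfolding 1 by (simp add: sum_subtractf field_simps)
  also have "sqrt (real n) / real n = 1 / sqrt (real n)"
    using assms by (simp add: field_simps real_sqrt_mult_self)
  finally show ?thesis by simp
qed

text \<open>The linear form is a normalised sum of bounded i.i.d. variables, so the one-dimensional
  central limit theorem applies. That theorem presupposes positive variance; directions of zero
  variance are handled exactly.\<close>

lemma cos_conv_scaled:
  "(\<lambda>n. expectation (\<lambda>\<omega>. cos ((\<Sum>j\<in>I. a j * scaled n (sample \<omega>) j) + c)))
     \<longlonglongrightarrow> (LINT z|iid_normal I. cos ((\<Sum>j\<in>I. a j * gvec I (pmf p) z j) + c))"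
proof -
  interpret S: prob_space std_normal_distribution by (rule prob_space_std_normal)
  define h where "h x = (\<Sum>j\<in>I. a j * of_bool (x = j))" for x
  have h: "h j = a j" if "j \<in> I" for j
    using that I(1) by (simp add: h_def of_bool_def if_distrib[of "\<lambda>y. _ * y"] cong: if_cong)
  define \<mu> where "\<mu> = (\<Sum>j\<in>I. a j * pmf p j)"
  define V where "V = (\<Sum>j\<in>I. pmf p j * (a j)\<^sup>2) - \<mu>\<^sup>2"
  have V: "V = (\<Sum>k\<in>I. (sqrt (pmf p k) * (a k - \<mu>))\<^sup>2)"
    unfolding V_def \<mu>_def using sum_pmf I by (intro multinomial_variance(1)[symmetric]) auto
  hence V0: "0 \<le> V" by (simp add: sum_nonneg)
  have rhs: "(LINT z|iid_normal I. cos ((\<Sum>j\<in>I. a j * gvec I (pmf p) z j) + c)) = (LINT x|std_normal_distribution. cos (sqrt V * x + c))"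
  proof -
    have "(LINT z|iid_normal I. cos ((\<Sum>j\<in>I. a j * gvec I (pmf p) z j) + c)) = (LINT y|distr (iid_normal I) borel (\<lambda>z. \<Sum>j\<in>I. a j * gvec I (pmf p) z j). cos (y + c))"
      by (intro integral_distr[symmetric]) measurable
    also have "\<dots> = (LINT x|std_normal_distribution. cos (sqrt V * x + c))"
      unfolding V_def \<mu>_def using sum_pmf I by (subst distr_gvec_lincomb) (auto simp: integral_distr)
    finally show ?thesis .
  qed
  have lhs: "(\<Sum>j\<in>I. a j * scaled n x j) = (\<Sum>i<n. h (x (Suc i)) - \<mu>) / sqrt (real n)" if "n \<ge> 1" for n x
    unfolding sum_scaled[OF that] h_def \<mu>_def ..
  show ?thesis
  proof (cases "V = 0")
    case True
    hence zero: "\<forall>k\<in>I. (sqrt (pmf p k) * (a k - \<mu>))\<^sup>2 = 0"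
      unfolding V using I by (subst (asm) sum_nonneg_eq_0_iff) auto
    \<comment> \<open>All \<open>pmf p k\<close> are positive, so zero variance forces
      \<open>a\<close> to be constant on the support, and the linear form then vanishes almost
      surely.\<close>
    have a: "a k = \<mu>" if "k \<in> I" for k using bspec[OF zero that] pmf_pos[OF that] by simp
    have "expectation (\<lambda>\<omega>. cos ((\<Sum>j\<in>I. a j * scaled n (sample \<omega>) j) + c)) = cos c" if "n \<ge> 1" for n
    proof -
      have "AE \<omega> in \<Omega>. \<forall>i\<in>{..<n}. X (Suc i) \<omega> \<in> I"
        by (intro AE_finite_allI AE_support) auto
      hence "AE \<omega> in \<Omega>. cos ((\<Sum>j\<in>I. a j * scaled n (sample \<omega>) j) + c) = cos c"
      proof eventually_elim
        case (elim \<omega>)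
        hence "(\<Sum>i<n. h (X (Suc i) \<omega>) - \<mu>) = 0" by (intro sum.neutral) (auto simp: h a)
        thus ?case unfolding lhs[OF that] by simp
      qed
      moreover have "(\<lambda>\<omega>. cos ((\<Sum>j\<in>I. a j * scaled n (sample \<omega>) j) + c)) \<in> borel_measurable \<Omega>"
        unfolding lhs[OF that] by measurable
      ultimately have "expectation (\<lambda>\<omega>. cos ((\<Sum>j\<in>I. a j * scaled n (sample \<omega>) j) + c)) = expectation (\<lambda>_. cos c)"
        by (intro integral_cong_AE) auto
      thus ?thesis by (simp add: prob_space)
    qed
    hence "\<forall>\<^sub>F n in sequentially. expectation (\<lambda>\<omega>. cos ((\<Sum>j\<in>I. a j * scaled n (sample \<omega>) j) + c)) = cos c"
      by (intro eventually_mono[OF eventually_ge_at_top[of 1]])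
    moreover have "(LINT x|std_normal_distribution. cos (sqrt V * x + c)) = cos c"
      using True S.prob_space by simp
    ultimately show ?thesis unfolding rhs by (simp add: tendsto_eventually)
  next
    case False
    define Y where "Y i \<omega> = h (X (Suc i) \<omega>)" for i \<omega>
    have [measurable]: "Y i \<in> borel_measurable \<Omega>" for i unfolding Y_def by measurable
    have clt: "weak_conv_m (\<lambda>n. distr \<Omega> borel (\<lambda>\<omega>. (\<Sum>i<n. Y i \<omega> - \<mu>) / sqrt (real n * (sqrt V)\<^sup>2))) std_normal_distribution"
    proof (rule central_limit_theorem)
      have "indep_vars (\<lambda>_. count_space UNIV) (\<lambda>i. X (Suc i)) UNIV"
        using indep_vars_reindex_inj[OF indep, of Suc UNIV] by auto
      thus "indep_vars (\<lambda>_. borel) Y UNIV"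
        unfolding Y_def by (rule indep_vars_compose2) auto
      show Emean: "expectation (Y i) = \<mu>" for i
      proof -
        have "expectation (Y i) = (\<Sum>j\<in>I. h j * pmf p j)"
          unfolding Y_def by (rule integral_X) simp
        also have "\<dots> = \<mu>" unfolding \<mu>_def by (intro sum.cong refl) (simp add: h)
        finally show ?thesis .
      qed
      show "0 < sqrt V" using False V0 by simp
      have bounded: "\<bar>h x\<bar> \<le> (\<Sum>j\<in>I. \<bar>a j\<bar>)" for x
        unfolding h_def by (intro order.trans[OF sum_abs] sum_mono) auto
      have bounded2: "(h x)\<^sup>2 \<le> (\<Sum>j\<in>I. \<bar>a j\<bar>)\<^sup>2" for x
        using power_mono[OF bounded abs_ge_zero, of x 2] by simp
      show int2: "integrable \<Omega> (\<lambda>\<omega>. (Y i \<omega>)\<^sup>2)" for i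
        by (rule integrable_const_bound[where B = "(\<Sum>j\<in>I. \<bar>a j\<bar>)\<^sup>2"])
           (simp_all add: Y_def bounded2)
      show "variance (Y i) = (sqrt V)\<^sup>2" for i
      proof -
        have "variance (Y i) = expectation (\<lambda>\<omega>. (Y i \<omega> - \<mu>)\<^sup>2)" by (simp add: Emean)
        also have "\<dots> = (\<Sum>j\<in>I. (h j - \<mu>)\<^sup>2 * pmf p j)"
          unfolding Y_def using integral_X[of "Suc i" "\<lambda>x. (h x - \<mu>)\<^sup>2"] by simp
        also have "\<dots> = V" unfolding V by (intro sum.cong) (auto simp: h power_mult_distrib)
        finally show ?thesis using V0 by simp
      qed
      show "distr \<Omega> borel (Y i) = distr (measure_pmf p) borel h" for i
      proof -
        have "distr \<Omega> borel (Y i) = distr (distr \<Omega> (count_space UNIV) (X (Suc i))) borel h"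
          by (subst distr_distr) (auto simp: comp_def Y_def[abs_def])
        thus ?thesis by (simp add: law)
      qed
    qed
    have "(\<lambda>n. LINT y|distr \<Omega> borel (\<lambda>\<omega>. (\<Sum>i<n. Y i \<omega> - \<mu>) / sqrt (real n * (sqrt V)\<^sup>2)). cos (sqrt V * y + c))
      \<longlonglongrightarrow> (LINT y|std_normal_distribution. cos (sqrt V * y + c))"
      using clt by (intro weak_conv_imp_integral_bdd_continuous_conv[where B = 1] real_dist_normal_dist)
         (auto simp: real_distribution_def real_distribution_axioms_def prob_space_distr)
    moreover have "\<forall>\<^sub>F n in sequentially. (LINT y|distr \<Omega> borel (\<lambda>\<omega>. (\<Sum>i<n. Y i \<omega> - \<mu>) / sqrt (real n * (sqrt V)\<^sup>2)). cos (sqrt V * y + c))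
      = expectation (\<lambda>\<omega>. cos ((\<Sum>j\<in>I. a j * scaled n (sample \<omega>) j) + c))"
      using eventually_ge_at_top[of 1]
    proof eventually_elim
      case (elim n)
      have "sqrt V * (s / sqrt (real n * (sqrt V)\<^sup>2)) = s / sqrt (real n)" for s
        using False V0 by (simp add: real_sqrt_mult)
      thus ?case unfolding lhs[OF elim] by (subst integral_distr) (auto simp: Y_def)
    qed
    ultimately show ?thesis unfolding rhs by (rule Lim_transform_eventually)
  qed
qed

sublocale projected_convergence \<Omega> "iid_normal I" I "\<lambda>n \<omega>. scaled n (sample \<omega>)" "gvec I (pmf p)"
proof (intro projected_convergence.intro projected_convergence_axioms.intro)
  show "(\<lambda>\<omega>. scaled n (sample \<omega>) i) \<in> borel_measurable \<Omega>" for n i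
    unfolding scaled_def emp_def by (intro borel_measurable_times borel_measurable_diff borel_measurable_divide borel_measurable_sum borel_measurable_const measurable_compose[OF measurable_X]) auto
qed (use I cos_conv_scaled prob_space_axioms prob_space_iid_normal in auto)


text \<open>A respectful predicate depends on the first \<open>n\<close> observations only. These take values in a countable
  space, so that it defines an event; \<open>whp\<close> reads ``with high probability''.\<close>

definition respectful :: "(nat \<Rightarrow> (nat \<Rightarrow> int) \<Rightarrow> bool) \<Rightarrow> bool" where
  "respectful Q \<longleftrightarrow> (\<forall>n x. Q n (restrict x {1..n}) = Q n x)"

definition P :: "(nat \<Rightarrow> (nat \<Rightarrow> int) \<Rightarrow> bool) \<Rightarrow> nat \<Rightarrow> real" where
  "P Q n = prob {\<omega> \<in> space \<Omega>. Q n (sample \<omega>)}"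

definition whp :: "(nat \<Rightarrow> (nat \<Rightarrow> int) \<Rightarrow> bool) \<Rightarrow> bool" where
  "whp Q \<longleftrightarrow> respectful Q \<and> P Q \<longlonglongrightarrow> 1"

lemma respectful_event: "respectful Q \<Longrightarrow> {\<omega> \<in> space \<Omega>. Q n (sample \<omega>)} \<in> events"
  by (rule events_sample[where n = n]) (simp only: respectful_def)

lemma P_mono:
  assumes "respectful R" "\<And>x. Q n x \<Longrightarrow> R n x"
  shows "P Q n \<le> P R n"
  unfolding P_def using assms by (intro finite_measure_mono respectful_event) auto

lemma P_conj:
  assumes "respectful Q" "respectful R"
  shows "P Q n + P R n - 1 \<le> P (\<lambda>n x. Q n x \<and> R n x) n"
proof -
  note [measurable] = assms[THEN respectful_event]
  have "P Q n + P R n - P (\<lambda>n x. Q n x \<and> R n x) n = prob ({\<omega> \<in> space \<Omega>. Q n (sample \<omega>)} \<union> {\<omega> \<in> space \<Omega>. R n (sample \<omega>)})"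
    unfolding P_def using measure_Un3[of "{\<omega> \<in> space \<Omega>. Q n (sample \<omega>)}" \<Omega> "{\<omega> \<in> space \<Omega>. R n (sample \<omega>)}"]
    by (simp add: fmeasurable_eq_sets Int_def conj_ac)
  also have "\<dots> \<le> 1" by (rule prob_le_1)
  finally show ?thesis by linarith
qed

lemma respectful_conj: "respectful Q \<Longrightarrow> respectful R \<Longrightarrow> respectful (\<lambda>n x. Q n x \<and> R n x)"
  by (simp add: respectful_def)

lemma whpI:
  assumes "respectful Q" "\<And>y. y < 1 \<Longrightarrow> \<forall>\<^sub>F n in sequentially. y < P Q n"
  shows "whp Q"
  unfolding whp_def
proof
  show "P Q \<longlonglongrightarrow> 1"
  proof (rule order_tendstoI)
    fix a :: real assume "1 < a"
    moreover have "P Q n \<le> 1" for n by (simp add: P_def)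
    ultimately show "\<forall>\<^sub>F n in sequentially. P Q n < a" by (intro always_eventually allI) (rule le_less_trans)
  qed (rule assms(2))
qed (rule assms(1))

lemma whpD: "whp Q \<Longrightarrow> y < 1 \<Longrightarrow> \<forall>\<^sub>F n in sequentially. y < P Q n"
  unfolding whp_def by (auto intro: order_tendstoD)

lemma whp_conj:
  assumes "whp Q" "whp R"
  shows "whp (\<lambda>n x. Q n x \<and> R n x)"
proof (rule whpI)
  show "respectful (\<lambda>n x. Q n x \<and> R n x)" using assms by (simp add: whp_def respectful_conj)
  fix y :: real assume "y < 1"
  hence y: "(y + 1) / 2 < 1" by simp
  show "\<forall>\<^sub>F n in sequentially. y < P (\<lambda>n x. Q n x \<and> R n x) n"
    using whpD[OF assms(1) y] whpD[OF assms(2) y]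
  proof eventually_elim
    case (elim n)
    thus ?case using P_conj[of Q R n] assms by (simp add: whp_def)
  qed
qed

lemma whp_mono:
  assumes "whp Q" "respectful R" "\<forall>\<^sub>F n in sequentially. \<forall>x. Q n x \<longrightarrow> R n x"
  shows "whp R"
proof (rule whpI[OF assms(2)])
  fix y :: real assume "y < 1"
  from whpD[OF assms(1) this] assms(3) show "\<forall>\<^sub>F n in sequentially. y < P R n"
  proof eventually_elim
    case (elim n)
    thus ?case using P_mono[OF assms(2), of Q n] by auto
  qed
qed

lemma respectful_scaled: "respectful (\<lambda>n x. Q n (scaled n x))"
  unfolding respectful_def by (simp only: scaled_restrict simp_thms)

lemma respectful_emp: "respectful (\<lambda>n x. Q n (emp n x))"
  unfolding respectful_def by (simp only: emp_restrict simp_thms)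

text \<open>A good event \<open>G\<close> fixes what the decision depends on besides
  \<open>scaled\<close>; the remaining condition on \<open>scaled\<close> is open, so its Gaussian
  mass is an asymptotic lower bound.\<close>

lemma eventually_P_greater:
  assumes "whp G" and U: "box_open I U" and y: "y < measure (iid_normal I) {z \<in> space (iid_normal I). gvec I (pmf p) z \<in> U}"
    and R: "respectful R" "\<forall>\<^sub>F n in sequentially. \<forall>x. G n x \<and> scaled n x \<in> U \<longrightarrow> R n x"
  shows "\<forall>\<^sub>F n in sequentially. y < P R n"
proof -
  \<comment> \<open>The slack \<open>y' - y\<close> absorbs the probability that \<open>G\<close>
    fails.\<close>
  obtain y' where y': "y < y'" "y' < measure (iid_normal I) {z \<in> space (iid_normal I). gvec I (pmf p) z \<in> U}"
    using y dense by blast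
  have rU: "respectful (\<lambda>n x. scaled n x \<in> U)" using respectful_scaled[of "\<lambda>n v. v \<in> U"] .
  have G: "respectful G" using assms(1) by (simp add: whp_def)
  have "\<forall>\<^sub>F n in sequentially. 1 - (y' - y) < P G n" using y'(1) by (intro whpD[OF assms(1)]) simp
  thus ?thesis
    using portmanteau_open[OF I(2) U y'(2)] R(2)
  proof (eventually_elim)
    case (elim n)
    have "P G n + P (\<lambda>n x. scaled n x \<in> U) n - 1 \<le> P (\<lambda>n x. G n x \<and> scaled n x \<in> U) n"
      by (rule P_conj[OF G rU])
    also have "\<dots> \<le> P R n" using elim(3) by (intro P_mono R) auto
    finally show ?case using elim(1,2) y'(1) unfolding P_def by linarith
  qed
qed

lemma whp_support: "whp (\<lambda>n x. 1 \<le> n \<and> (\<forall>i\<in>{1..n}. x i \<in> I))"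
proof (rule whpI)
  show r: "respectful (\<lambda>n x. 1 \<le> n \<and> (\<forall>i\<in>{1..n}. x i \<in> I))"
    by (simp add: respectful_def)
  fix y :: real assume "y < 1"
  have "P (\<lambda>n x. 1 \<le> n \<and> (\<forall>i\<in>{1..n}. x i \<in> I)) n = 1" if "1 \<le> n" for n
  proof -
    have "AE \<omega> in \<Omega>. \<forall>i\<in>{1..n}. X i \<omega> \<in> I"
      by (intro AE_finite_allI AE_support) auto
    hence "AE \<omega> in \<Omega>. 1 \<le> n \<and> (\<forall>i\<in>{1..n}. X i \<omega> \<in> I)" using that by simp
    thus ?thesis
      unfolding P_def using respectful_event[OF r] by (subst prob_Collect_eq_1) auto
  qed
  thus "\<forall>\<^sub>F n in sequentially. y < P (\<lambda>n x. 1 \<le> n \<and> (\<forall>i\<in>{1..n}. x i \<in> I)) n"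
    using \<open>y < 1\<close> by (intro eventually_mono[OF eventually_ge_at_top[of 1]]) simp
qed

text \<open>Tightness of \<open>scaled\<close>. \<open>K\<close> may tend to infinity arbitrarily
  slowly, so that the same lemma serves bounds of order \<open>sqrt n\<close> and of the order of
  the normal quantile.\<close>

lemma whp_scaled_less:
  assumes K: "filterlim K at_top sequentially"
  shows "whp (\<lambda>n x. \<forall>j\<in>I. \<bar>scaled n x j\<bar> < K n)"
proof (rule whpI)
  interpret N: prob_space "iid_normal I" by (rule prob_space_iid_normal)
  show r: "respectful (\<lambda>n x. \<forall>j\<in>I. \<bar>scaled n x j\<bar> < K n)"
    using respectful_scaled[of "\<lambda>n v. \<forall>j\<in>I. \<bar>v j\<bar> < K n"] .
  fix y :: real assume "y < 1"
  define A where "A k = {z \<in> space (iid_normal I). gvec I (pmf p) z \<in> {v. \<forall>j\<in>I. \<bar>v j\<bar> < real k}}" for k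
  have bo: "box_open I {v. \<forall>j\<in>I. \<bar>v j\<bar> < real k}" for k
    unfolding box_open_def
  proof (rule ballI)
    fix v :: "int \<Rightarrow> real" assume v: "v \<in> {v. \<forall>j\<in>I. \<bar>v j\<bar> < real k}"
    define e where "e = Min ((\<lambda>j. real k - \<bar>v j\<bar>) ` I)"
    have e: "e \<le> real k - \<bar>v j\<bar>" if "j \<in> I" for j unfolding e_def using that by (intro Min_le) auto
    have "0 < e" unfolding e_def using v I by (subst Min_gr_iff) auto
    moreover have "w \<in> {v. \<forall>j\<in>I. \<bar>v j\<bar> < real k}" if w: "\<forall>j\<in>I. \<bar>w j - v j\<bar> < e" for w
    proof (clarify)
      fix j assume "j \<in> I"
      with bspec[OF w this] e[OF this] show "\<bar>w j\<bar> < real k" by linarith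
    qed
    ultimately show "\<exists>e>0. \<forall>w. (\<forall>j\<in>I. \<bar>w j - v j\<bar> < e) \<longrightarrow> w \<in> {v. \<forall>j\<in>I. \<bar>v j\<bar> < real k}" by blast
  qed
  have "(\<lambda>k. measure (iid_normal I) (A k)) \<longlonglongrightarrow> measure (iid_normal I) (\<Union>k. A k)"
  proof (rule N.finite_Lim_measure_incseq)
    show "range A \<subseteq> N.events"
      unfolding A_def using measurable_box_open[OF I bo, of "gvec I (pmf p)" "iid_normal I"] by auto
    show "incseq A" unfolding A_def incseq_def by force
  qed
  also have "(\<Union>k. A k) = space (iid_normal I)"
  proof -
    have "\<exists>k. z \<in> A k" if "z \<in> space (iid_normal I)" for z
    proof -
      obtain k where k: "(\<Sum>j\<in>I. \<bar>gvec I (pmf p) z j\<bar>) < real k" using reals_Archimedean2 by blast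
      have "\<bar>gvec I (pmf p) z j\<bar> \<le> (\<Sum>j\<in>I. \<bar>gvec I (pmf p) z j\<bar>)" if "j \<in> I" for j
        using that by (intro member_le_sum) auto
      hence "\<forall>j\<in>I. \<bar>gvec I (pmf p) z j\<bar> < real k" using k by (meson le_less_trans)
      thus ?thesis using that by (auto simp: A_def)
    qed
    thus ?thesis by (auto simp: A_def)
  qed
  finally have "\<forall>\<^sub>F k in sequentially. y < measure (iid_normal I) (A k)"
    using \<open>y < 1\<close> by (intro order_tendstoD) (simp_all add: N.prob_space)
  then obtain k where k: "y < measure (iid_normal I) (A k)" by (auto dest: eventually_happens)
  have "\<forall>\<^sub>F n in sequentially. real k \<le> K n" using K by (simp add: filterlim_at_top)
  thus "\<forall>\<^sub>F n in sequentially. y < P (\<lambda>n x. \<forall>j\<in>I. \<bar>scaled n x j\<bar> < K n) n"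
    by (intro eventually_P_greater[OF whp_support bo k[unfolded A_def] r]) (auto elim!: eventually_mono)
qed

section \<open>Consistency of the empirical quantities\<close>

lemma emp_eq: "1 \<le> n \<Longrightarrow> emp n x j = pmf p j + scaled n x j / sqrt (real n)"
  by (simp add: scaled_def)

lemma emp_nonneg: "0 \<le> emp n x j"
  by (simp add: emp_def sum_nonneg)

lemma sum_emp:
  assumes "1 \<le> n \<and> (\<forall>i\<in>{1..n}. x i \<in> I)"
  shows "(\<Sum>j\<in>I. emp n x j) = 1"
proof -
  have "(\<Sum>j\<in>I. emp n x j) = (\<Sum>j\<in>I. \<Sum>i=1..n. of_bool (x i = j)) / real n"
    unfolding emp_def by (rule sum_divide_distrib[symmetric])
  also have "(\<Sum>j\<in>I. \<Sum>i=1..n. of_bool (x i = j) :: real) = (\<Sum>i=1..n. \<Sum>j\<in>I. of_bool (x i = j))"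
    by (rule sum.swap)
  also have "\<dots> = (\<Sum>i=1..n. 1)"
  proof (intro sum.cong refl)
    fix i assume "i \<in> {1..n}"
    hence "x i \<in> I" using assms by blast
    have "(\<Sum>j\<in>I. of_bool (x i = j) :: real) = (\<Sum>j\<in>I. if x i = j then 1 else 0)"
      by (intro sum.cong) auto
    thus "(\<Sum>j\<in>I. of_bool (x i = j) :: real) = 1" using \<open>x i \<in> I\<close> by simp
  qed
  also have "\<dots> / real n = 1" using assms by simp
  finally show ?thesis .
qed

lemma whp_emp_close:
  assumes "0 < d"
  shows "whp (\<lambda>n x. \<forall>j\<in>I. \<bar>emp n x j - pmf p j\<bar> < d)"
proof (rule whp_mono[OF whp_scaled_less[of "\<lambda>n. sqrt (real n) * d"]])
  show "filterlim (\<lambda>n. sqrt (real n) * d) at_top sequentially" using assms by real_asymp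
  show "respectful (\<lambda>n x. \<forall>j\<in>I. \<bar>emp n x j - pmf p j\<bar> < d)"
    using respectful_emp[of "\<lambda>n q. \<forall>j\<in>I. \<bar>q j - pmf p j\<bar> < d"] .
  show "\<forall>\<^sub>F n in sequentially. \<forall>x. (\<forall>j\<in>I. \<bar>scaled n x j\<bar> < sqrt (real n) * d) \<longrightarrow> (\<forall>j\<in>I. \<bar>emp n x j - pmf p j\<bar> < d)"
    using eventually_gt_at_top[of 0] by eventually_elim (simp add: scaled_def abs_mult)
qed

lemma test_stat_eq:
  assumes "1 \<le> n \<and> (\<forall>i\<in>{1..n}. x i \<in> I)"
  shows "test_stat m M n x = sqrt (real n) * cone_dist m M {} (emp n x)"
  unfolding test_stat_def using grenander_dist[of "emp n x" m M] sum_emp[OF assms] emp_nonneg by simp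

lemma crit_value_sample:
  assumes "1 \<le> n \<and> (\<forall>i\<in>{1..n}. x i \<in> I)"
  shows "crit_value m M \<alpha> n x J = quantile (limit_law m M J (emp n x)) (1 - \<alpha>)"
  using sum_emp[OF assms] emp_nonneg le by (intro crit_value_eq) auto

lemma emp_le_1:
  assumes "1 \<le> n \<and> (\<forall>i\<in>{1..n}. x i \<in> I)" "j \<in> I"
  shows "emp n x j \<le> 1"
  using member_le_sum[of j I "emp n x"] assms(2) sum_emp[OF assms(1)] emp_nonneg by auto

lemma S1_hat_eq:
  assumes "1 \<le> n \<and> (\<forall>i\<in>{1..n}. x i \<in> I)" "0 < emp n x m" "0 < emp n x M"
  shows "S1_hat n x = {m..M - 1}"
proof -
  have mem: "j \<in> x ` {1..n}" if "0 < emp n x j" for j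
  proof (rule ccontr)
    assume "j \<notin> x ` {1..n}"
    hence "(\<Sum>i=1..n. of_bool (x i = j) :: real) = 0" by (intro sum.neutral) auto
    thus False using that by (simp add: emp_def)
  qed
  have "Min (x ` {1..n}) = m" using assms mem by (intro Min_eqI) auto
  moreover have "Max (x ` {1..n}) = M" using assms mem by (intro Max_eqI) auto
  ultimately show ?thesis by (simp add: S1_hat_def)
qed

abbreviation knots :: "int set" where "knots \<equiv> {j \<in> {m..M - 1}. pmf p (j + 1) < pmf p j}"

lemma knot_gap:
  obtains \<delta> where "0 < \<delta>" "\<And>j. j \<in> knots \<Longrightarrow> \<delta> \<le> pmf p j - pmf p (j + 1)"
proof -
  \<comment> \<open>The extra 1 keeps the minimum defined when there is no knot.\<close>
  define \<delta> where "\<delta> = Min (insert 1 ((\<lambda>j. pmf p j - pmf p (j + 1)) ` knots))"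
  have fin: "finite knots" by (rule finite_subset[of _ "{m..M - 1}"]) auto
  have "0 < \<delta>" unfolding \<delta>_def using fin by (subst Min_gr_iff) auto
  moreover have "\<delta> \<le> pmf p j - pmf p (j + 1)" if "j \<in> knots" for j
    unfolding \<delta>_def using fin that by (intro Min_le) auto
  ultimately show thesis by (rule that)
qed

lemma whp_test_stat_local:
  assumes H0: "pmf p \<in> mono_cone m M {}"
  shows "whp (\<lambda>n x. test_stat m M n x = cone_dist m M knots (scaled n x))"
proof -
  obtain \<delta> where \<delta>: "0 < \<delta>" "\<And>j. j \<in> knots \<Longrightarrow> \<delta> \<le> pmf p j - pmf p (j + 1)" using knot_gap by blast
  \<comment> \<open>Entries of \<open>scaled\<close> below \<open>sqrt n * c\<close> make 4 times
    its norm at most \<open>sqrt n * \<delta>\<close>, as \<open>cone_dist_local\<close> asks; the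
    cardinality comes from bounding the norm by the sum of absolute values.\<close>
  define c where "c = \<delta> / (4 * real (card I))"
  have card: "0 < real (card I)" using I by (simp add: card_gt_0_iff del: card_atLeastAtMost_int)
  hence c: "0 < c" using \<delta>(1) unfolding c_def by (intro divide_pos_pos mult_pos_pos) auto
  have "filterlim (\<lambda>n. sqrt (real n) * c) at_top sequentially" using c by real_asymp
  from whp_conj[OF whp_support whp_scaled_less[OF this]] show ?thesis
  proof (rule whp_mono)
    show "respectful (\<lambda>n x. test_stat m M n x = cone_dist m M knots (scaled n x))"
      by (simp only: respectful_def test_stat_restrict scaled_restrict simp_thms)
    have "test_stat m M n x = cone_dist m M knots (scaled n x)"
      if x: "1 \<le> n \<and> (\<forall>i\<in>{1..n}. x i \<in> I)" and small: "\<forall>j\<in>I. \<bar>scaled n x j\<bar> < sqrt (real n) * c" for n x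
    proof -
      have "L2_set (scaled n x) I \<le> (\<Sum>j\<in>I. \<bar>scaled n x j\<bar>)" by (rule L2_set_le_sum_abs)
      also have "\<dots> \<le> real (card I) * (sqrt (real n) * c)" using small by (intro sum_bounded_above) (auto intro: less_imp_le)
      finally have "4 * L2_set (scaled n x) I \<le> 4 * (real (card I) * (sqrt (real n) * c))" by simp
      also have "\<dots> = sqrt (real n) * \<delta>"
      proof -
        have "4 * (N * (s * (\<delta> / (4 * N)))) = s * \<delta>" if "0 < N" for N s :: real
          using that by (simp add: field_simps)
        from this[OF card] show ?thesis unfolding c_def .
      qed
      finally have "sqrt (real n) * cone_dist m M {} (\<lambda>j. pmf p j + scaled n x j / sqrt (real n)) = cone_dist m M knots (scaled n x)"
        using x by (intro cone_dist_local[OF H0 refl \<delta>(2)]) auto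
      moreover have "emp n x = (\<lambda>j. pmf p j + scaled n x j / sqrt (real n))" using x emp_eq by (intro ext) simp
      ultimately show ?thesis unfolding test_stat_eq[OF x] by simp
    qed
    thus "\<forall>\<^sub>F n in sequentially. \<forall>x. (1 \<le> n \<and> (\<forall>i\<in>{1..n}. x i \<in> I)) \<and> (\<forall>j\<in>I. \<bar>scaled n x j\<bar> < sqrt (real n) * c)
      \<longrightarrow> test_stat m M n x = cone_dist m M knots (scaled n x)"
      by (intro always_eventually) blast
  qed
qed

text \<open>At a strict descent the left side of the comparison grows like \<open>sqrt n\<close> and
  outruns the quantile, provided \<open>sigma_hat\<close> is bounded above. On a flat piece it stays
  bounded in probability and falls behind the quantile, provided \<open>sigma_hat\<close> is bounded
  away from 0.\<close>

lemma whp_J0_hat: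
  assumes H0: "pmf p \<in> mono_cone m M {}"
  shows "whp (\<lambda>n x. J0_hat n x = knots)"
proof -
  obtain \<delta> where \<delta>: "0 < \<delta>" "\<And>j. j \<in> knots \<Longrightarrow> \<delta> \<le> pmf p j - pmf p (j + 1)" using knot_gap by blast
  define \<pi> where "\<pi> = Min (pmf p ` I)"
  have \<pi>: "0 < \<pi>" "\<And>j. j \<in> I \<Longrightarrow> \<pi> \<le> pmf p j"
    unfolding \<pi>_def using pmf_pos I by (auto simp: Min_gr_iff intro!: Min_le)
  \<comment> \<open>\<open>\<delta> / 4\<close> leaves half of every gap after two errors. The other
    two bounds keep the empirical variance on flat pieces above \<open>\<pi>\<close>: two
    frequencies of at least \<open>7 / 8 * \<pi>\<close> lose at most
    \<open>(2 * d)\<^sup>2 \<le> d \<le> \<pi> / 8\<close>.\<close>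
  define d where "d = min (\<delta> / 4) (min (\<pi> / 8) (1 / 4))"
  have d: "0 < d" "d \<le> \<delta> / 4" "d \<le> \<pi> / 8" "d \<le> 1 / 4" using \<delta>(1) \<pi>(1) by (auto simp: d_def)
  define z where "z n = quantile std_normal_distribution (1 - 1 / real n)" for n
  have z_lim: "filterlim z at_top sequentially"
    unfolding z_def[abs_def] by (rule filterlim_std_normal_quantile)
  \<comment> \<open>Each of two neighbouring entries of \<open>scaled\<close> is allowed half of
    \<open>sqrt \<pi> * z n\<close>, where \<open>sqrt \<pi>\<close> is the lower bound of
    \<open>sigma_hat\<close> on flat pieces.\<close>
  hence "filterlim (\<lambda>n. sqrt \<pi> / 2 * z n) at_top sequentially"
    using \<pi>(1) by (intro filterlim_tendsto_pos_mult_at_top[OF tendsto_const]) auto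
  from whp_conj[OF whp_support whp_conj[OF whp_emp_close[OF d(1)] whp_scaled_less[OF this]]] show ?thesis
  proof (rule whp_mono)
    show "respectful (\<lambda>n x. J0_hat n x = knots)"
      by (simp only: respectful_def J0_hat_restrict simp_thms)
    have ev0: "\<forall>\<^sub>F n in sequentially. 0 \<le> z n" using z_lim by (simp add: filterlim_at_top)
    have "(\<lambda>n. z n / sqrt (real n)) \<longlonglongrightarrow> 0" unfolding z_def by (rule tendsto_std_normal_quantile_over_sqrt)
    hence "\<forall>\<^sub>F n in sequentially. z n / sqrt (real n) < \<delta> / 4" using \<delta>(1) by (intro order_tendstoD) auto
    with ev0 eventually_gt_at_top[of 0]
    show "\<forall>\<^sub>F n in sequentially. \<forall>x. (1 \<le> n \<and> (\<forall>i\<in>{1..n}. x i \<in> I)) \<and> (\<forall>j\<in>I. \<bar>emp n x j - pmf p j\<bar> < d)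
       \<and> (\<forall>j\<in>I. \<bar>scaled n x j\<bar> < sqrt \<pi> / 2 * z n) \<longrightarrow> J0_hat n x = knots"
    proof eventually_elim
      case (elim n)
      show ?case
      proof (intro allI impI, elim conjE)
        fix x assume n: "1 \<le> n" and x: "\<forall>i\<in>{1..n}. x i \<in> I" and close: "\<forall>j\<in>I. \<bar>emp n x j - pmf p j\<bar> < d"
          and small: "\<forall>j\<in>I. \<bar>scaled n x j\<bar> < sqrt \<pi> / 2 * z n"
        have sx: "1 \<le> n \<and> (\<forall>i\<in>{1..n}. x i \<in> I)" using n x by blast
        have lower: "7 / 8 * \<pi> \<le> emp n x j" if "j \<in> I" for j
          using bspec[OF close that] \<pi>(2)[OF that] d(3) by linarith
        have "0 < emp n x m" "0 < emp n x M" using lower[of m] lower[of M] \<pi>(1) le by auto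
        from S1_hat_eq[OF sx this] have S1: "S1_hat n x = {m..M - 1}" .
        have key: "sqrt (real n) * (emp n x j - emp n x (j + 1)) \<le> z n * sigma_hat n x j \<longleftrightarrow> j \<notin> knots"
          if j: "j \<in> {m..M - 1}" for j
        proof -
          have jI: "j \<in> I" "j + 1 \<in> I" using j by auto
          show ?thesis
          proof (cases "j \<in> knots")
            case True
            have "\<delta> / 2 \<le> emp n x j - emp n x (j + 1)"
              using bspec[OF close jI(1)] bspec[OF close jI(2)] \<delta>(2)[OF True] d(2) by linarith
            hence "sqrt (real n) * (\<delta> / 2) \<le> sqrt (real n) * (emp n x j - emp n x (j + 1))"
              by (intro mult_left_mono) auto
            \<comment> \<open>The empirical variance is at most 2; the bound 4 is taken because its
              root is rational.\<close>
            moreover have "sigma_hat n x j \<le> sqrt 4"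
              unfolding sigma_hat_def using emp_le_1[OF sx jI(1)] emp_le_1[OF sx jI(2)]
              by (intro real_sqrt_le_mono) (smt (verit) zero_le_power2)
            hence "z n * sigma_hat n x j \<le> z n * 2" using elim(1) by (intro mult_left_mono) auto
            moreover have "z n * 2 < sqrt (real n) * (\<delta> / 2)" using elim(2,3) by (simp add: field_simps)
            ultimately show ?thesis using True by auto
          next
            case False
            hence pj: "pmf p (j + 1) = pmf p j" using H0 j by (intro antisym) (auto simp: mono_cone_def not_less)
            have "\<bar>emp n x j - emp n x (j + 1)\<bar> \<le> 2 * d"
              using bspec[OF close jI(1)] bspec[OF close jI(2)] pj by linarith
            hence "(emp n x j - emp n x (j + 1))\<^sup>2 \<le> (2 * d)\<^sup>2" by (rule abs_le_square_iff[THEN iffD1, OF order.trans[OF _ abs_ge_self]])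
            also have "\<dots> = 4 * d * d" by (simp add: power2_eq_square)
            also have "\<dots> \<le> 1 * d" using d by (intro mult_right_mono) auto
            finally have "\<pi> \<le> emp n x j + emp n x (j + 1) - (emp n x j - emp n x (j + 1))\<^sup>2"
              using lower[OF jI(1)] lower[OF jI(2)] d(3) \<pi>(1) by linarith
            hence s: "sqrt \<pi> \<le> sigma_hat n x j" unfolding sigma_hat_def by (rule real_sqrt_le_mono)
            have "sqrt (real n) * (emp n x j - emp n x (j + 1)) = scaled n x j - scaled n x (j + 1)"
              unfolding scaled_def pj by (simp add: algebra_simps)
            also have "\<dots> \<le> sqrt \<pi> * z n" using bspec[OF small jI(1)] bspec[OF small jI(2)] by linarith
            also have "\<dots> \<le> sigma_hat n x j * z n" using s elim(1) by (rule mult_right_mono)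
            finally show ?thesis using False by (simp add: mult.commute)
          qed
        qed
        show "J0_hat n x = knots"
          unfolding J0_hat_def I0_hat_def S1 z_def[symmetric] using key by blast
      qed
    qed
  qed
qed


section \<open>Limits of the rejection probability\<close>

lemma mono_cone_iff_rho1: "pmf p \<in> mono_cone m M {} \<longleftrightarrow> 0 \<le> rho1 m M p"
proof -
  have "0 \<le> rho1 m M p \<longleftrightarrow> (\<forall>j\<in>{m..M - 1}. 0 \<le> pmf p j - pmf p (j + 1))"
    unfolding rho1_def using less by (subst Min_ge_iff) auto
  thus ?thesis by (simp add: mono_cone_def)
qed

text \<open>Every index is a knot, so the local cone is the whole space and the statistic is 0 with
  high probability. No critical value of a nonempty sample from the support is negative, and
  rejection requires strict inequality.\<close>

lemma rejection_tendsto_0: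
  assumes \<alpha>: "0 < \<alpha>" "\<alpha> < 1" and rho: "0 < rho1 m M p"
  shows "P (rejects m M \<alpha>) \<longlonglongrightarrow> 0"
proof -
  have H0: "pmf p \<in> mono_cone m M {}" using rho mono_cone_iff_rho1 by simp
  have gap: "rho1 m M p \<le> pmf p j - pmf p (j + 1)" if "j \<in> {m..M - 1}" for j
    unfolding rho1_def using that by (intro Min_le) auto
  have knots: "knots = {m..M - 1}"
    using gap rho by force
  have zero: "cone_dist m M knots v = 0" for v
    unfolding cone_dist_eq_0_iff knots by (simp add: mono_cone_def)
  have r: "respectful (\<lambda>n x. \<not> rejects m M \<alpha> n x)"
    by (simp only: respectful_def rejects_restrict simp_thms)
  have "whp (\<lambda>n x. \<not> rejects m M \<alpha> n x)"
  proof (rule whp_mono[OF whp_conj[OF whp_support whp_test_stat_local[OF H0]] r])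
    show "\<forall>\<^sub>F n in sequentially. \<forall>x. (1 \<le> n \<and> (\<forall>i\<in>{1..n}. x i \<in> I)) \<and> test_stat m M n x = cone_dist m M knots (scaled n x) \<longrightarrow> \<not> rejects m M \<alpha> n x"
    proof (intro always_eventually allI impI, elim conjE)
      fix n x assume n: "1 \<le> n" and x: "\<forall>i\<in>{1..n}. x i \<in> I" and t: "test_stat m M n x = cone_dist m M knots (scaled n x)"
      have "0 \<le> crit_value m M \<alpha> n x (J0_hat n x)"
        using n x \<alpha> le by (subst crit_value_sample) (auto intro!: quantile_limit_law_nonneg)
      thus "\<not> rejects m M \<alpha> n x" unfolding rejects_def t zero by simp
    qed
  qed
  hence "(\<lambda>n. 1 - P (\<lambda>n x. \<not> rejects m M \<alpha> n x) n) \<longlonglongrightarrow> 1 - 1"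
    unfolding whp_def by (intro tendsto_intros) auto
  moreover have "1 - P (\<lambda>n x. \<not> rejects m M \<alpha> n x) n = P (rejects m M \<alpha>) n" for n
  proof -
    have "{\<omega> \<in> space \<Omega>. rejects m M \<alpha> n (sample \<omega>)} \<in> events"
      by (rule respectful_event[of "rejects m M \<alpha>"]) (simp only: respectful_def rejects_restrict simp_thms)
    thus ?thesis unfolding P_def by (subst prob_neg) auto
  qed
  ultimately show ?thesis by simp
qed

text \<open>The statistic grows like \<open>sqrt n\<close> times the distance of \<open>p\<close>
  from the monotone cone, while the critical value is bounded by \<open>K\<close> whatever knots are
  estimated.\<close>

lemma rejection_tendsto_1:
  assumes \<alpha>: "0 < \<alpha>" "\<alpha> < 1" and rho: "rho1 m M p < 0"
  shows "P (rejects m M \<alpha>) \<longlonglongrightarrow> 1"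
proof -
  define D where "D = cone_dist m M {} (pmf p)"
  have "pmf p \<notin> mono_cone m M {}" using rho mono_cone_iff_rho1 by simp
  hence D: "0 < D" using cone_dist_nonneg[of m M "{}" "pmf p"] cone_dist_eq_0_iff[of m M "{}" "pmf p"] unfolding D_def by linarith
  obtain d where d: "0 < d" "\<And>w v. (\<forall>i\<in>I. \<bar>w i - v i\<bar> < d) \<Longrightarrow> \<bar>cone_dist m M {} w - cone_dist m M {} v\<bar> < D / 2"
    using cone_dist_near[OF le, of "D / 2"] D by auto
  obtain K where K: "0 < K" "\<And>J q. (\<And>j. j \<in> I \<Longrightarrow> 0 \<le> q j \<and> q j \<le> 1) \<Longrightarrow> 1 - \<alpha> \<le> cdf (limit_law m M J q) K"
    using limit_law_uniformly_tight[OF le, of "1 - \<alpha>"] \<alpha> by auto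
  have r: "respectful (rejects m M \<alpha>)"
    by (simp only: respectful_def rejects_restrict simp_thms)
  have "whp (rejects m M \<alpha>)"
  proof (rule whp_mono[OF whp_conj[OF whp_support whp_emp_close[OF d(1)]] r])
    have "filterlim (\<lambda>n. sqrt (real n) * (D / 2)) at_top sequentially" using D by real_asymp
    hence "\<forall>\<^sub>F n in sequentially. K < sqrt (real n) * (D / 2)" by (simp add: filterlim_at_top_dense)
    thus "\<forall>\<^sub>F n in sequentially. \<forall>x. (1 \<le> n \<and> (\<forall>i\<in>{1..n}. x i \<in> I)) \<and> (\<forall>j\<in>I. \<bar>emp n x j - pmf p j\<bar> < d) \<longrightarrow> rejects m M \<alpha> n x"
    proof eventually_elim
      case (elim n)
      show ?case
      proof (intro allI impI, erule conjE)
        fix x assume sx: "1 \<le> n \<and> (\<forall>i\<in>{1..n}. x i \<in> I)" and close: "\<forall>j\<in>I. \<bar>emp n x j - pmf p j\<bar> < d"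
        have "crit_value m M \<alpha> n x (J0_hat n x) \<le> K"
          unfolding crit_value_sample[OF sx] using \<alpha> emp_nonneg emp_le_1[OF sx]
          by (intro quantile_le real_distribution_limit_law le K(2)) auto
        also have "K < sqrt (real n) * (D / 2)" by (rule elim)
        also have "\<dots> \<le> sqrt (real n) * cone_dist m M {} (emp n x)"
        proof (rule mult_left_mono)
          show "D / 2 \<le> cone_dist m M {} (emp n x)" using d(2)[OF close] unfolding D_def by linarith
        qed simp
        finally show "rejects m M \<alpha> n x" unfolding rejects_def test_stat_eq[OF sx] .
      qed
    qed
  qed
  thus ?thesis by (simp add: whp_def)
qed

text \<open>If \<open>\<alpha> = max_level m M p\<close>, then the limiting critical value is \<open>0\<close> and the statistic has to be
  compared with it at an atom. There the interior of the cone replaces the sublevel sets of the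
  distance: its boundary carries no Gaussian mass.\<close>

lemma gvec_interior_cone:
  assumes H0: "pmf p \<in> mono_cone m M {}"
  defines "U \<equiv> {v. \<forall>j\<in>{m..M - 1} - knots. v (j + 1) < v j}"
  shows "box_open I U"
    and "measure (iid_normal I) {z \<in> space (iid_normal I). gvec I (pmf p) z \<in> U} = 1 - max_level m M p"
proof -
  show bo: "box_open I U"
    unfolding box_open_def
  proof (rule ballI)
    fix v assume v: "v \<in> U"
    define e where "e = Min (insert 1 ((\<lambda>j. v j - v (j + 1)) ` ({m..M - 1} - knots)))"
    have fin: "finite ({m..M - 1} - knots)" by simp
    have e: "e \<le> v j - v (j + 1)" if "j \<in> {m..M - 1} - knots" for j
      unfolding e_def using fin that by (intro Min_le) auto
    have "0 < e" unfolding e_def using fin v by (subst Min_gr_iff) (auto simp: U_def)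
    moreover have "w \<in> U" if w: "\<forall>j\<in>I. \<bar>w j - v j\<bar> < e / 2" for w
      unfolding U_def
    proof (rule CollectI, rule ballI)
      fix j assume j: "j \<in> {m..M - 1} - knots"
      hence "j \<in> I" "j + 1 \<in> I" by auto
      from bspec[OF w this(1)] bspec[OF w this(2)] e[OF j] show "w (j + 1) < w j" by linarith
    qed
    ultimately show "\<exists>e>0. \<forall>w. (\<forall>j\<in>I. \<bar>w j - v j\<bar> < e) \<longrightarrow> w \<in> U"
      by (intro exI[of _ "e / 2"]) auto
  qed
  have eqp: "pmf p (j + 1) = pmf p j" if "j \<in> {m..M - 1} - knots" for j
    using H0 that by (intro antisym) (auto simp: mono_cone_def not_less)
  have "AE z in iid_normal I. gvec I (pmf p) z \<in> U \<longleftrightarrow> cone_dist m M knots (gvec I (pmf p) z) = 0"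
    using AE_iid_normal_inj_on[OF I(1)]
  proof eventually_elim
    case (elim z)
    have "gvec I (pmf p) z (j + 1) < gvec I (pmf p) z j \<longleftrightarrow> gvec I (pmf p) z (j + 1) \<le> gvec I (pmf p) z j"
      if j: "j \<in> {m..M - 1} - knots" for j
    proof -
      \<comment> \<open>Distinct coordinates exclude equality in the inequalities that define the
        cone, since the coefficients at \<open>j\<close> and \<open>j + 1\<close> coincide.\<close>
      have "z (j + 1) \<noteq> z j" using inj_onD[OF elim, of "j + 1" j] j by auto
      moreover have "0 < sqrt (pmf p j)" using pmf_pos[of j] j by auto
      ultimately have "gvec I (pmf p) z (j + 1) \<noteq> gvec I (pmf p) z j" unfolding gvec_def eqp[OF j] by simp
      thus ?thesis by linarith
    qed
    thus ?case unfolding cone_dist_eq_0_iff mono_cone_def U_def by blast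
  qed
  hence "measure (iid_normal I) {z \<in> space (iid_normal I). gvec I (pmf p) z \<in> U}
      = measure (iid_normal I) {z \<in> space (iid_normal I). cone_dist m M knots (gvec I (pmf p) z) = 0}"
  proof (intro measure_eq_AE)
    show "{z \<in> space (iid_normal I). gvec I (pmf p) z \<in> U} \<in> sets (iid_normal I)"
      by (rule measurable_box_open[OF I bo]) measurable
    show "{z \<in> space (iid_normal I). cone_dist m M knots (gvec I (pmf p) z) = 0} \<in> sets (iid_normal I)"
      using measurable_cone_dist_gvec[OF le] by measurable
  qed (auto elim: eventually_mono)
  also have "\<dots> = 1 - max_level m M p"
    using pmf_pos by (intro limit_law_atom[OF le H0 _ refl]) auto
  finally show "measure (iid_normal I) {z \<in> space (iid_normal I). gvec I (pmf p) z \<in> U} = 1 - max_level m M p" .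
qed

text \<open>Rejection is asymptotically at least as likely as any \<open>y < \<alpha>\<close>,
  acceptance at least as likely as any \<open>y < 1 - \<alpha>\<close>. The two thresholds add up to
  1, so each lower bound is also the upper bound for the complementary event.\<close>

lemma rejection_tendsto_level:
  assumes \<alpha>: "0 < \<alpha>" "\<alpha> < 1" and rho: "rho1 m M p = 0" and level: "\<alpha> \<le> max_level m M p"
  shows "P (rejects m M \<alpha>) \<longlonglongrightarrow> \<alpha>"
proof -
  let ?N = "iid_normal I" and ?T = "\<lambda>z. cone_dist m M knots (gvec I (pmf p) z)"
  interpret N: prob_space ?N by (rule prob_space_iid_normal)
  have H0: "pmf p \<in> mono_cone m M {}" using rho mono_cone_iff_rho1 by simp
  define F where "F = cdf (limit_law m M knots (pmf p))"
  define t where "t = quantile (limit_law m M knots (pmf p)) (1 - \<alpha>)"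
  have rd: "real_distribution (limit_law m M knots (pmf p))" by (rule real_distribution_limit_law[OF le])
  have t0: "0 \<le> t" unfolding t_def using \<alpha> le by (intro quantile_limit_law_nonneg) auto
  have [measurable]: "?T \<in> borel_measurable ?N" by (rule measurable_cone_dist_gvec[OF le])
  have F: "F s = measure ?N {z \<in> space ?N. ?T z \<le> s}" for s
    unfolding F_def by (rule cdf_limit_law[OF le])
  have F_less: "measure ?N {z \<in> space ?N. ?T z < s} = F s" if "0 < s" for s
  proof -
    have "F s = measure ?N ({z \<in> space ?N. ?T z < s} \<union> {z \<in> space ?N. ?T z = s})"
      unfolding F by (intro arg_cong[where f = "measure ?N"]) auto
    also have "\<dots> = measure ?N {z \<in> space ?N. ?T z < s} + measure ?N {z \<in> space ?N. ?T z = s}"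
    proof (rule N.finite_measure_Union)
      show "{z \<in> space ?N. ?T z < s} \<in> N.events" "{z \<in> space ?N. ?T z = s} \<in> N.events"
        by measurable
    qed auto
    finally show ?thesis using limit_law_no_atom[OF le that] by simp
  qed
  have F0: "F 0 = 1 - max_level m M p"
  proof -
    have "F 0 = measure ?N {z \<in> space ?N. ?T z = 0}"
      unfolding F using cone_dist_nonneg[of m M knots] by (intro arg_cong[where f = "measure ?N"]) (auto intro: antisym)
    also have "\<dots> = 1 - max_level m M p"
      using pmf_pos by (intro limit_law_atom[OF le H0 _ refl]) auto
    finally show ?thesis .
  qed
  have Ft: "F t = 1 - \<alpha>"
  proof (cases "0 < t")
    case True
    thus ?thesis unfolding F_def t_def using \<alpha> le by (intro cdf_limit_law_quantile) auto
  next
    case False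
    \<comment> \<open>Here the restriction on the level enters: the quantile gives only
      \<open>1 - \<alpha> \<le> F 0\<close>, and the reverse inequality is
      \<open>1 - max_level m M p \<le> 1 - \<alpha>\<close>.\<close>
    hence "t = 0" using t0 by simp
    moreover have "1 - \<alpha> \<le> F t" unfolding F_def t_def using \<alpha> by (intro cdf_quantile_ge rd) auto
    ultimately show ?thesis using F0 level by simp
  qed
  obtain i where i: "i \<in> {m..M - 1} - knots"
  proof -
    have "rho1 m M p \<in> (\<lambda>j. pmf p j - pmf p (j + 1)) ` {m..M - 1}"
      unfolding rho1_def using less by (intro Min_in) auto
    then obtain i where "i \<in> {m..M - 1}" "pmf p i - pmf p (i + 1) = 0" using rho by auto
    thus thesis by (intro that[of i]) auto
  qed
  have rR: "respectful (rejects m M \<alpha>)"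
    by (simp only: respectful_def rejects_restrict simp_thms)
  have rA: "respectful (\<lambda>n x. \<not> rejects m M \<alpha> n x)"
    by (simp only: respectful_def rejects_restrict simp_thms)
  \<comment> \<open>Nonnegativity of the critical value is recorded separately: for
    \<open>t = 0\<close>, closeness to \<open>t\<close> would leave room for negative
    values.\<close>
  define G where "G e n x \<longleftrightarrow> test_stat m M n x = cone_dist m M knots (scaled n x) \<and> 0 \<le> crit_value m M \<alpha> n x (J0_hat n x)
    \<and> \<bar>crit_value m M \<alpha> n x (J0_hat n x) - t\<bar> \<le> e" for e n x
  have G: "whp (G e)" if e: "0 < e" for e
  proof -
    have s: "0 < 1 - \<alpha>" "1 - \<alpha> < 1" using \<alpha> by auto
    obtain d where d: "0 < d" "\<And>q. (\<forall>j\<in>I. \<bar>q j - pmf p j\<bar> < d) \<Longrightarrow> \<bar>quantile (limit_law m M knots q) (1 - \<alpha>) - t\<bar> \<le> e"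
      using quantile_limit_law_near[OF le pmf_pos sum_pmf i s e] unfolding t_def by blast
    have "J0_hat n (restrict x {1..n}) = J0_hat n x" for n and x :: "nat \<Rightarrow> int" by (rule J0_hat_restrict)
    moreover have "crit_value m M \<alpha> n (restrict x {1..n}) J = crit_value m M \<alpha> n x J" for n x J
      unfolding crit_value_def by (simp only: Gamma_hat_def[abs_def] emp_restrict)
    ultimately have r: "respectful (G e)"
      unfolding respectful_def G_def by (simp only: test_stat_restrict scaled_restrict simp_thms)
    show ?thesis
    proof (rule whp_mono[OF whp_conj[OF whp_conj[OF whp_support whp_emp_close[OF d(1)]] whp_conj[OF whp_J0_hat[OF H0] whp_test_stat_local[OF H0]]] r])
      show "\<forall>\<^sub>F n in sequentially. \<forall>x. ((1 \<le> n \<and> (\<forall>i\<in>{1..n}. x i \<in> I)) \<and> (\<forall>j\<in>I. \<bar>emp n x j - pmf p j\<bar> < d))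
        \<and> (J0_hat n x = knots \<and> test_stat m M n x = cone_dist m M knots (scaled n x)) \<longrightarrow> G e n x"
      proof (intro always_eventually allI impI, elim conjE)
        fix n x assume n: "1 \<le> n" and x: "\<forall>i\<in>{1..n}. x i \<in> I" and close: "\<forall>j\<in>I. \<bar>emp n x j - pmf p j\<bar> < d"
          and J: "J0_hat n x = knots" and ts: "test_stat m M n x = cone_dist m M knots (scaled n x)"
        have sx: "1 \<le> n \<and> (\<forall>i\<in>{1..n}. x i \<in> I)" using n x by blast
        show "G e n x"
          unfolding G_def J crit_value_sample[OF sx]
          using ts d(2)[OF close] quantile_limit_law_nonneg[OF le s] by blast
      qed
    qed
  qed
  have upper: "\<forall>\<^sub>F n in sequentially. y < P (rejects m M \<alpha>) n" if y: "y < \<alpha>" for y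
  proof -
    interpret L: real_distribution "limit_law m M knots (pmf p)" by (rule rd)
    \<comment> \<open>Distance above \<open>t + e\<close> forces rejection on the good event.
      Right-continuity lets the mass of this open set come close to \<open>\<alpha>\<close> even if
      \<open>t = 0\<close> is an atom.\<close>
    have "\<forall>\<^sub>F s in at_right t. F s < 1 - y"
      using L.cdf_is_right_cont[of t] Ft y unfolding F_def continuous_within by (intro order_tendstoD) auto
    then obtain b where b: "t < b" "\<And>s. t < s \<Longrightarrow> s < b \<Longrightarrow> F s < 1 - y"
      unfolding eventually_at_right_field by blast
    define e where "e = (b - t) / 2"
    have e: "0 < e" and Fe: "F (t + e) < 1 - y" using b by (auto simp: e_def field_simps)
    show ?thesis
    proof (rule eventually_P_greater[OF G[OF e] box_open_cone_dist[OF le open_greaterThan, of _ "t + e"] _ rR])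
      have "measure ?N {z \<in> space ?N. gvec I (pmf p) z \<in> {v. cone_dist m M knots v \<in> {t + e<..}}} = measure ?N {z \<in> space ?N. \<not> ?T z \<le> t + e}"
        by (intro arg_cong[where f = "measure ?N"]) auto
      also have "\<dots> = 1 - F (t + e)" unfolding F by (intro N.prob_neg) measurable
      finally show "y < measure ?N {z \<in> space ?N. gvec I (pmf p) z \<in> {v. cone_dist m M knots v \<in> {t + e<..}}}"
        using Fe by simp
      show "\<forall>\<^sub>F n in sequentially. \<forall>x. G e n x \<and> scaled n x \<in> {v. cone_dist m M knots v \<in> {t + e<..}} \<longrightarrow> rejects m M \<alpha> n x"
        by (intro always_eventually) (auto simp: G_def rejects_def)
    qed
  qed
  have lower: "\<forall>\<^sub>F n in sequentially. y < P (\<lambda>n x. \<not> rejects m M \<alpha> n x) n" if y: "y < 1 - \<alpha>" for y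
  \<comment> \<open>For \<open>t > 0\<close> acceptance follows from a distance below some
    \<open>s < t\<close>, and continuity at \<open>t\<close> makes the loss small. For
    \<open>t = 0\<close> no such sublevel set is nonempty, and the interior of the cone takes
    over.\<close>
  proof (cases "0 < t")
    case True
    have "isCont F t" unfolding F_def by (rule isCont_cdf_limit_law[OF le True])
    hence "(F \<longlongrightarrow> F t) (at_left t)" by (simp add: isCont_def filterlim_at_split)
    hence "\<forall>\<^sub>F s in at_left t. y < F s" using y Ft by (intro order_tendstoD) auto
    then obtain b where b: "b < t" "\<And>s. b < s \<Longrightarrow> s < t \<Longrightarrow> y < F s"
      unfolding eventually_at_left_field by blast
    define s where "s = (max b 0 + t) / 2"
    have s: "0 < s" "s < t" "b < s" using b True by (auto simp: s_def max_def field_simps)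
    have "0 < t - s" using s by simp
    show ?thesis
    proof (rule eventually_P_greater[OF G[OF \<open>0 < t - s\<close>] box_open_cone_dist[OF le open_lessThan, of _ s] _ rA])
      have "measure ?N {z \<in> space ?N. gvec I (pmf p) z \<in> {v. cone_dist m M knots v \<in> {..<s}}} = F s"
        using F_less[OF s(1)] by simp
      thus "y < measure ?N {z \<in> space ?N. gvec I (pmf p) z \<in> {v. cone_dist m M knots v \<in> {..<s}}}"
        using b(2)[OF s(3,2)] by simp
      show "\<forall>\<^sub>F n in sequentially. \<forall>x. G (t - s) n x \<and> scaled n x \<in> {v. cone_dist m M knots v \<in> {..<s}} \<longrightarrow> \<not> rejects m M \<alpha> n x"
        by (intro always_eventually) (auto simp: G_def rejects_def)
    qed
  next
    case False
    hence "t = 0" using t0 by simp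
    show ?thesis
    \<comment> \<open>The tolerance 1 is arbitrary: a vanishing statistic and a nonnegative critical
      value already give acceptance.\<close>
    proof (rule eventually_P_greater[OF G[OF zero_less_one] gvec_interior_cone(1)[OF H0] _ rA])
      show "y < measure ?N {z \<in> space ?N. gvec I (pmf p) z \<in> {v. \<forall>j\<in>{m..M - 1} - knots. v (j + 1) < v j}}"
        unfolding gvec_interior_cone(2)[OF H0] using y Ft F0 \<open>t = 0\<close> by simp
      show "\<forall>\<^sub>F n in sequentially. \<forall>x. G 1 n x \<and> scaled n x \<in> {v. \<forall>j\<in>{m..M - 1} - knots. v (j + 1) < v j} \<longrightarrow> \<not> rejects m M \<alpha> n x"
      proof (intro always_eventually allI impI, elim conjE)
        fix n x assume G: "G 1 n x" and v: "scaled n x \<in> {v. \<forall>j\<in>{m..M - 1} - knots. v (j + 1) < v j}"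
        have "cone_dist m M knots (scaled n x) = 0"
          unfolding cone_dist_eq_0_iff mono_cone_def using v by (blast intro: less_imp_le)
        thus "\<not> rejects m M \<alpha> n x" using G unfolding G_def rejects_def by linarith
      qed
    qed
  qed
  show ?thesis
  proof (rule order_tendstoI)
    fix y assume "\<alpha> < y"
    hence "1 - y < 1 - \<alpha>" by simp
    from lower[OF this] show "\<forall>\<^sub>F n in sequentially. P (rejects m M \<alpha>) n < y"
    proof eventually_elim
      case (elim n)
      have "P (\<lambda>n x. \<not> rejects m M \<alpha> n x) n = 1 - P (rejects m M \<alpha>) n"
        unfolding P_def by (intro prob_neg respectful_event[OF rR])
      thus ?case using elim by simp
    qed
  qed (rule upper)
qed

end

theorem corollary2:
  fixes \<Omega> :: "'w measure" and X :: "nat \<Rightarrow> 'w \<Rightarrow> int" and p :: "int pmf"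
    and m M :: int and \<alpha> :: real
  assumes "m < M"
    and "set_pmf p = {m..M}"
    and "0 < \<alpha>" and "\<alpha> < 1"
    and "prob_space \<Omega>"
    and "prob_space.indep_vars \<Omega> (\<lambda>_. count_space UNIV) X {1..}"
    and "\<And>i. i \<ge> 1 \<Longrightarrow> distr \<Omega> (count_space UNIV) (X i) = measure_pmf p"
  shows "(rho1 m M p \<ge> 0 \<and> rho1 m M p = 0 \<and> \<alpha> \<le> max_level m M p \<longrightarrow>
            (\<lambda>n. measure \<Omega> {\<omega> \<in> space \<Omega>. rejects m M \<alpha> n (\<lambda>i. X i \<omega>)}) \<longlonglongrightarrow> \<alpha>) \<and>
         (rho1 m M p \<ge> 0 \<and> rho1 m M p > 0 \<longrightarrow>
            (\<lambda>n. measure \<Omega> {\<omega> \<in> space \<Omega>. rejects m M \<alpha> n (\<lambda>i. X i \<omega>)}) \<longlonglongrightarrow> 0) \<and>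
         (rho1 m M p < 0 \<longrightarrow>
            (\<lambda>n. measure \<Omega> {\<omega> \<in> space \<Omega>. rejects m M \<alpha> n (\<lambda>i. X i \<omega>)}) \<longlonglongrightarrow> 1)"
proof -
  interpret multinomial_sample \<Omega> X p m M
    using assms by (intro multinomial_sample.intro multinomial_sample_axioms.intro)
  have "P (rejects m M \<alpha>) = (\<lambda>n. measure \<Omega> {\<omega> \<in> space \<Omega>. rejects m M \<alpha> n (\<lambda>i. X i \<omega>)})"
    by (simp add: fun_eq_iff P_def)
  thus ?thesis
    using rejection_tendsto_level[of \<alpha>] rejection_tendsto_0[of \<alpha>] rejection_tendsto_1[of \<alpha>] assms(3,4) by simp
qed

end
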